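(* Let $d\ge1$ and let $\phi$ be a function on $[0,\infty)$ with compact support. Suppose that $F_{\phi}(x)=\phi(|x|)$ is integrable on $\mathbb{R}^d$, and let $f_{\phi}$ be the periodization of $F_{\phi}$. Then, for all $\lambda>0$ and all $x\in\mathbb{T}^d$, $$S_\lambda(f_\phi)(x)=\sigma_{\lambda}(F_\phi)(x)+\sum_{j=0}^{d_\sharp}(-1)^j\Delta_j(\lambda^2:x)A_{\phi}^{(j)}(\lambda^2)+(-1)^{d_\sharp+1}\sum_{m\in\mathbb{Z}^d\setminus\{0\}}\int_0^{\lambda^2}\mathcal{D}_{d_\sharp}(s:x-m)\,A_{\phi}^{(d_\sharp+1)}(s)\,ds.$$
   Context: $\mathbb{T}^d$ is identified with $(-1/2,1/2]^d\subset\mathbb{R}^d$; $|\cdot|$ is the Euclidean norm, products such as $\xi x$ are inner products. For integrable $F$ on $\mathbb{R}^d$: $\hat F(\xi)=\int_{\mathbb{R}^d}F(x)e^{-2\pi i\xi x}\,dx$, $\sigma_\lambda(F)(x)=\int_{|\xi|<\lambda}\hat F(\xi)e^{2\pi i\xi x}\,d\xi$; its periodization is $f(x)=\sum_{m\in\mathbb{Z}^d}F(x+m)$ (convergent in $L^1(\mathbb{T}^d)$). For integrable $f$ on $\mathbb{T}^d$: $\hat f(m)=\int_{\mathbb{T}^d}f(x)e^{-2\pi imx}\,dx$, $S_\lambda(f)(x)=\sum_{m\in\mathbb{Z}^d,\,|m|<\lambda}\hat f(m)e^{2\pi imx}$. $d_\sharp=\left[\frac{d-1}2\right]+1$ is the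 smallest integer greater than $(d-1)/2$. For $\alpha>-1$, $s>0$, $x\in\mathbb{R}^d$: $D_{\alpha}(s:x)=\frac1{\Gamma(\alpha+1)}\sum_{m\in\mathbb{Z}^d,\,|m|^2<s}(s-|m|^2)^\alpha e^{2\pi imx}$, $\ \mathcal{D}_{\alpha}(s:x)=\frac1{\Gamma(\alpha+1)}\int_{|\xi|^2<s}(s-|\xi|^2)^\alpha e^{2\pi i\xi x}\,d\xi$, both set to $0$ for $s=0$, and $\Delta_\alpha(s:x)=D_\alpha(s:x)-\mathcal{D}_\alpha(s:x)$. For $\nu>-1$: $\Lambda_\nu(t:s)=J_\nu(2\pi t\sqrt s)/s^{\nu/2}$ for $t\ge0$, $s>0$, and $\Lambda_\nu(t:0)=(\pi t)^\nu/\Gamma(\nu+1)$, where $J_\nu$ is the Bessel function of the first kind. $A_\phi(s)=2\pi\int_0^\infty\phi(t)\Lambda_{\frac d2-1}(t:s)\,t^{\frac d2}\,dt$, $s\ge0$ (so that $\hat F_\phi(\xi)=A_\phi(|\xi|^2)$). Since $\phi$ has compact support, $A_\phi$ is infinitely differentiable on $[0,\infty)$, and $A_\phi^{(j)}(s)=2\pi(-\pi)^j\int_0^\infty\phi(t)\Lambda_{\frac d2-1+j}(t:s)\,t^{\frac d2+j}\,dt$ is its $j$-th derivative. *)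

theory Defs
  imports "HOL-Analysis.Analysis"
begin

text \<open>
  The space is \<^typ>\<open>real ^ 'n\<close>, of dimension \<open>d = CARD('n) \<ge> 1\<close>.
  Throughout, \<open>cis t\<close> is \<open>e\<^sup>i\<^sup>t\<close>, and integrals are Lebesgue integrals over the
  completed measure \<^const>\<open>lebesgue\<close>, so that functions need only be Lebesgue measurable.
\<close>

definition int_lattice :: "(real ^ 'n) set" where
  "int_lattice = {m. \<forall>i. m $ i \<in> \<int>}"

definition torus :: "(real ^ 'n) set" where
  "torus = {x. \<forall>i. - 1/2 < x $ i \<and> x $ i \<le> 1/2}"


subsection \<open>Fourier transforms, Fourier series and spherical partial sums\<close>

definition fourier_transform :: "(real ^ 'n \<Rightarrow> complex) \<Rightarrow> real ^ 'n \<Rightarrow> complex" where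
  "fourier_transform F \<xi> = (LINT x|lebesgue. F x * cis (- 2 * pi * (\<xi> \<bullet> x)))"

definition fourier_partial_integral ::
    "real \<Rightarrow> (real ^ 'n \<Rightarrow> complex) \<Rightarrow> real ^ 'n \<Rightarrow> complex" where
  "fourier_partial_integral l F x =
     (LINT \<xi>:{\<xi>. norm \<xi> < l}|lebesgue. fourier_transform F \<xi> * cis (2 * pi * (\<xi> \<bullet> x)))"

definition fourier_coeff :: "(real ^ 'n \<Rightarrow> complex) \<Rightarrow> real ^ 'n \<Rightarrow> complex" where
  "fourier_coeff f m = (LINT x:torus|lebesgue. f x * cis (- 2 * pi * (m \<bullet> x)))"

definition fourier_partial_sum ::
    "real \<Rightarrow> (real ^ 'n \<Rightarrow> complex) \<Rightarrow> real ^ 'n \<Rightarrow> complex" where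
  "fourier_partial_sum l f x =
     (\<Sum>m\<in>{m \<in> int_lattice. norm m < l}. fourier_coeff f m * cis (2 * pi * (m \<bullet> x)))"

text \<open>
  For integrable \<open>F\<close> the series converges absolutely almost everywhere, and its pointwise sum
  represents the limit in \<open>L\<^sup>1\<close> of the torus. If \<open>F\<close> has bounded support, only finitely
  many terms are nonzero at each point.
\<close>

definition periodization :: "(real ^ 'n \<Rightarrow> complex) \<Rightarrow> real ^ 'n \<Rightarrow> complex" where
  "periodization F x = (\<Sum>\<^sub>\<infinity>m\<in>int_lattice. F (x + m))"

text \<open>
  A function on \<open>[0,\<infinity>)\<close> is given as a function on \<^typ>\<open>real\<close> whose values at negative
  arguments are never used.
\<close>

definition radial :: "(real \<Rightarrow> complex) \<Rightarrow> real ^ 'n \<Rightarrow> complex" where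
  "radial \<phi> x = \<phi> (norm x)"

definition compact_support_halfline :: "(real \<Rightarrow> complex) \<Rightarrow> bool" where
  "compact_support_halfline \<phi> \<longleftrightarrow> compact (closure {t. 0 \<le> t \<and> \<phi> t \<noteq> 0})"


subsection \<open>Riesz means of lattice and continuous exponentials\<close>

text \<open>For \<open>s = 0\<close> the range of summation or integration is empty, so both values are \<open>0\<close>.\<close>

definition D_lattice :: "real \<Rightarrow> real \<Rightarrow> real ^ 'n \<Rightarrow> complex" where
  "D_lattice \<alpha> s x = of_real (1 / Gamma (\<alpha> + 1)) *
     (\<Sum>m\<in>{m \<in> int_lattice. (norm m)\<^sup>2 < s}.
        of_real ((s - (norm m)\<^sup>2) powr \<alpha>) * cis (2 * pi * (m \<bullet> x)))"

definition D_cont :: "real \<Rightarrow> real \<Rightarrow> real ^ 'n \<Rightarrow> complex" where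
  "D_cont \<alpha> s x = of_real (1 / Gamma (\<alpha> + 1)) *
     (LINT \<xi>:{\<xi>. (norm \<xi>)\<^sup>2 < s}|lebesgue.
        of_real ((s - (norm \<xi>)\<^sup>2) powr \<alpha>) * cis (2 * pi * (\<xi> \<bullet> x)))"

definition D_diff :: "real \<Rightarrow> real \<Rightarrow> real ^ 'n \<Rightarrow> complex" where
  "D_diff \<alpha> s x = D_lattice \<alpha> s x - D_cont \<alpha> s x"


subsection \<open>Bessel functions and the radial profile of the Fourier transform\<close>

text \<open>The convention \<open>0\<^sup>0 = 1\<close> is needed below, whereas \<open>0 powr 0 = 0\<close>.\<close>

definition rpow :: "real \<Rightarrow> real \<Rightarrow> real" where
  "rpow x \<nu> = (if \<nu> = 0 then 1 else x powr \<nu>)"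

text \<open>The Bessel function of the first kind, for \<open>\<nu> > - 1\<close> and \<open>z \<ge> 0\<close>, by its power series.\<close>

definition bessel_J :: "real \<Rightarrow> real \<Rightarrow> real" where
  "bessel_J \<nu> z = rpow (z / 2) \<nu> *
     (\<Sum>k. (- 1) ^ k / (fact k * Gamma (real k + \<nu> + 1)) * (z / 2) ^ (2 * k))"

text \<open>
  If \<open>\<nu> < 0\<close> then \<open>bessel_Lambda \<nu> 0 s\<close> is a junk value (the limit as \<open>t\<close> tends
  to \<open>0\<close> is infinite); below, \<open>t = 0\<close> matters only as a null set of integration.
\<close>

definition bessel_Lambda :: "real \<Rightarrow> real \<Rightarrow> real \<Rightarrow> real" where
  "bessel_Lambda \<nu> t s =
     (if s = 0 then rpow (pi * t) \<nu> / Gamma (\<nu> + 1)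
      else bessel_J \<nu> (2 * pi * t * sqrt s) / s powr (\<nu> / 2))"

definition radial_profile :: "nat \<Rightarrow> (real \<Rightarrow> complex) \<Rightarrow> real \<Rightarrow> complex" where
  "radial_profile d \<phi> s = 2 * of_real pi *
     (LINT t:{0..}|lebesgue.
        \<phi> t * of_real (bessel_Lambda (real d / 2 - 1) t s * t powr (real d / 2)))"

text \<open>The \<open>j\<close>-th derivative of a function on \<open>[0,\<infinity>)\<close>, one-sided at \<open>0\<close>.\<close>

definition nth_deriv_halfline :: "nat \<Rightarrow> (real \<Rightarrow> complex) \<Rightarrow> real \<Rightarrow> complex" where
  "nth_deriv_halfline j =
     ((\<lambda>g s. vector_derivative g (at s within {0..})) ^^ j)"

text \<open>The smallest integer greater than \<open>(d - 1) / 2\<close>, for \<open>d \<ge> 1\<close>.\<close>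

definition d_sharp :: "nat \<Rightarrow> nat" where
  "d_sharp d = (d - 1) div 2 + 1"

end

theory Submission
  imports Defs "HOL-Probability.Distributions"
begin

text \<open>
  Since \<open>\<phi>\<close> has compact support, the Fourier transform of \<open>F = \<phi>(\<bar>x\<bar>)\<close> at \<open>\<xi>\<close> and the profile \<open>A\<close> at
  \<open>\<bar>\<xi>\<bar>\<^sup>2\<close> are given by the same everywhere convergent power series. Hence \<open>A\<close> extends to an entire
  function, and \<open>A(\<bar>m\<bar>\<^sup>2)\<close> is the \<open>m\<close>-th Fourier coefficient of the periodization. Taylor's formula for
  \<open>A\<close> at \<open>l\<^sup>2\<close>, of order \<open>J = d_sharp d\<close>, turns both partial sums into Riesz means up to the order \<open>J\<close>
  plus the contribution of a remainder \<open>K(\<xi>)\<close>, extended by \<open>0\<close> outside the ball of radius \<open>l\<close>. The two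
  remainders are compared by Poisson's summation formula for \<open>K(\<xi>) exp(2\<pi>i \<xi>x)\<close>. The series of Fourier
  transforms converges absolutely without any Bessel function asymptotics: \<open>K\<close> vanishes to order
  \<open>J + 1 > d/2\<close> on the sphere, so it has \<open>J + 1\<close> bounded derivatives in each coordinate, and Bessel's
  inequality and the Cauchy-Schwarz inequality apply as in Bernstein's theorem.
\<close>

section \<open>Integration in polar coordinates\<close>

text \<open>The hypothesis gives measurability of the radial function on the whole space only, so a
  Borel profile on the half-line has to be recovered before polar coordinates apply. Null sets and
  Lebesgue sets of radii are studied for this reason. The choice of J is tied to the lattice sum.
  Bessel's inequality controls the square sums of |(x - m)_i|^(J+1) times the transform of K, for
  one coordinate i at a time, so that mixed derivatives are avoided. The Cauchy-Schwarz inequality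
  then needs the weights 1 / (1 + sum_i |(x - m)_i|^(2J+2)) to be summable over the lattice, which
  holds because 2(J + 1) > d. The term m = 0 of Poisson's formula is the remainder that belongs to
  the spherical integral of the Fourier transform. This explains why the series of the theorem omits
  0 and why only the differences of the Riesz means appear.\<close>

lemma cball_measurable [measurable]: "cball (x :: 'a::euclidean_space) r \<in> sets borel"
  by simp

lemma cis_measurable [measurable]: "cis \<in> borel_measurable borel"
  by (intro borel_measurable_continuous_onI continuous_intros)

lemma nn_integral_lborel_scaleR:
  fixes f :: "'a::euclidean_space \<Rightarrow> ennreal"
  assumes [measurable]: "f \<in> borel_measurable borel" and r: "r > 0"
  shows "(\<integral>\<^sup>+x. f x \<partial>lborel) = ennreal (r ^ DIM('a)) * (\<integral>\<^sup>+x. f (r *\<^sub>R x) \<partial>lborel)"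
  using r by (subst lborel_affine[of r 0]) (auto simp: nn_integral_density nn_integral_distr nn_integral_cmult)

lemma integral_lborel_uminus:
  fixes f :: "'a::euclidean_space \<Rightarrow> 'b::{banach, second_countable_topology}"
  assumes [measurable]: "f \<in> borel_measurable borel"
  shows "(\<integral>x. f (- x) \<partial>lborel) = (\<integral>x. f x \<partial>lborel)"
proof -
  have "(lborel :: 'a measure) = distr lborel borel (\<lambda>x. - x)"
    by (subst lborel_affine[of "-1" 0]) (auto simp: density_1)
  then have "(\<integral>x. f x \<partial>lborel) = (\<integral>x. f x \<partial>distr lborel borel (\<lambda>x. - x))" by simp
  also have "\<dots> = (\<integral>x. f (- x) \<partial>lborel)" by (subst integral_distr) auto
  finally show ?thesis ..
qed

lemma integral_lborel_translate:
  fixes f :: "'a::euclidean_space \<Rightarrow> 'b::{banach, second_countable_topology}"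
  assumes [measurable]: "f \<in> borel_measurable borel"
  shows "(\<integral>x. f (x + a) \<partial>lborel) = (\<integral>x. f x \<partial>lborel)"
  by (subst (2) lborel_distr_plus[of a, symmetric]) (simp add: integral_distr add.commute)

lemma nn_integral_lborel_translate:
  fixes f :: "'a::euclidean_space \<Rightarrow> ennreal"
  assumes [measurable]: "f \<in> borel_measurable borel"
  shows "(\<integral>\<^sup>+x. f (x + a) \<partial>lborel) = (\<integral>\<^sup>+x. f x \<partial>lborel)"
  by (subst (2) lborel_distr_plus[of a, symmetric]) (simp add: nn_integral_distr add.commute)

text \<open>Even powers suffice, since against a radial weight the odd powers of the linear form
  integrate to zero.\<close>

definition ball_moment :: "nat \<Rightarrow> 'a::euclidean_space \<Rightarrow> real" where
  "ball_moment k \<xi> = enn2real (\<integral>\<^sup>+x. ennreal ((\<xi> \<bullet> x) ^ (2 * k)) * indicator (cball 0 1) x \<partial>lborel)"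

text \<open>This is the integral of the 2k-th power of the linear form over the unit sphere,
  obtained without a surface measure: the radial part of the ball integral is the integral of
  r^(d+2k-1) over [0,1], that is 1/(d+2k).\<close>

definition sphere_moment :: "nat \<Rightarrow> 'a::euclidean_space \<Rightarrow> real" where
  "sphere_moment k \<xi> = real (DIM('a) + 2 * k) * ball_moment k \<xi>"

text \<open>By Cauchy-Schwarz the integrand is at most |\<xi>|^(2k) on the unit ball, so the
  integral is finite and \<open>enn2real\<close> loses nothing.\<close>

lemma ball_moment_nn:
  fixes \<xi> :: "'a::euclidean_space"
  shows "(\<integral>\<^sup>+x. ennreal ((\<xi> \<bullet> x) ^ (2 * k)) * indicator (cball 0 1) x \<partial>lborel) = ennreal (ball_moment k \<xi>)"
proof -
  have "(\<integral>\<^sup>+x. ennreal ((\<xi> \<bullet> x) ^ (2 * k)) * indicator (cball 0 1) x \<partial>lborel)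
      \<le> (\<integral>\<^sup>+x. ennreal (norm \<xi> ^ (2 * k)) * indicator (cball 0 1) (x::'a) \<partial>lborel)"
  proof (rule nn_integral_mono)
    fix x :: 'a
    have "\<bar>\<xi> \<bullet> x\<bar> ^ (2 * k) \<le> norm \<xi> ^ (2 * k)" if "norm x \<le> 1"
      using that Cauchy_Schwarz_ineq2[of \<xi> x] mult_left_le[of "norm x" "norm \<xi>"] by (intro power_mono) auto
    then show "ennreal ((\<xi> \<bullet> x) ^ (2 * k)) * indicator (cball 0 1) x
        \<le> ennreal (norm \<xi> ^ (2 * k)) * indicator (cball 0 1) x"
      by (auto split: split_indicator simp: power_mult intro!: ennreal_leI)
  qed
  also have "\<dots> < top"
    by (subst nn_integral_cmult_indicator) (auto simp: emeasure_cball ennreal_mult_less_top)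
  finally show ?thesis by (simp add: ball_moment_def)
qed

lemma ball_moment_nonneg: "ball_moment k \<xi> \<ge> 0"
  by (simp add: ball_moment_def)

lemma sphere_moment_nonneg: "sphere_moment k \<xi> \<ge> 0"
  by (simp add: sphere_moment_def ball_moment_nonneg)

text \<open>The substitution x -> r x contributes r^d from Lebesgue measure and r^(2k) from the
  homogeneity of the integrand.\<close>

lemma ball_moment_cball:
  fixes \<xi> :: "'a::euclidean_space"
  assumes "r > 0"
  shows "(\<integral>\<^sup>+x. ennreal ((\<xi> \<bullet> x) ^ (2 * k)) * indicator (cball 0 r) x \<partial>lborel)
    = ennreal (r ^ (DIM('a) + 2 * k) * ball_moment k \<xi>)"
proof -
  have "(\<integral>\<^sup>+x. ennreal ((\<xi> \<bullet> x) ^ (2 * k)) * indicator (cball 0 r) x \<partial>lborel) = 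
    ennreal (r ^ DIM('a)) * (\<integral>\<^sup>+x. ennreal ((\<xi> \<bullet> (r *\<^sub>R x)) ^ (2 * k)) * indicator (cball 0 r) (r *\<^sub>R x) \<partial>lborel)"
    by (rule nn_integral_lborel_scaleR[OF _ assms]) measurable
  also have "(\<integral>\<^sup>+x. ennreal ((\<xi> \<bullet> (r *\<^sub>R x)) ^ (2 * k)) * indicator (cball 0 r) (r *\<^sub>R x) \<partial>lborel)
    = (\<integral>\<^sup>+x. ennreal (r ^ (2 * k)) * (ennreal ((\<xi> \<bullet> x) ^ (2 * k)) * indicator (cball 0 1) x) \<partial>lborel)"
    using assms by (intro nn_integral_cong)
      (auto split: split_indicator simp: power_mult_distrib ennreal_mult mult_le_cancel_left1)
  also have "\<dots> = ennreal (r ^ (2 * k)) * ennreal (ball_moment k \<xi>)"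
    by (subst nn_integral_cmult) (auto simp: ball_moment_nn)
  finally show ?thesis using assms
    by (simp add: ennreal_mult ball_moment_nonneg power_add mult_ac)
qed

text \<open>Both sides agree on the half-lines \<open>{..r}\<close>, because the left one scales like \<open>r ^ (d + 2k)\<close>.\<close>

lemma distr_norm_polar:
  fixes \<xi> :: "'a::euclidean_space"
  shows "distr (density lborel (\<lambda>x. ennreal ((\<xi> \<bullet> x) ^ (2 * k)))) borel norm
    = density lborel (\<lambda>t. ennreal (sphere_moment k \<xi> * t ^ (DIM('a) + 2 * k - 1)) * indicator {0..} t)"
    (is "?M = ?N")
proof -
  define n where "n = DIM('a) + 2 * k - 1"
  have n: "DIM('a) + 2 * k = Suc n" by (simp add: n_def)
  let ?E = "range (\<lambda>a::real. {..a})"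
  have M: "emeasure ?M {..r} = (\<integral>\<^sup>+x. ennreal ((\<xi> \<bullet> x) ^ (2 * k)) * indicator (cball 0 r) x \<partial>lborel)" for r
    by (subst emeasure_distr, simp, simp, subst emeasure_density)
       (measurable, auto intro!: nn_integral_cong split: split_indicator)
  have N: "emeasure ?N {..r} = (\<integral>\<^sup>+t. ennreal (sphere_moment k \<xi> * t ^ n) * indicator {0..r} t \<partial>lborel)" for r
    by (subst emeasure_density) (auto intro!: nn_integral_cong split: split_indicator simp: n_def)
  have eq: "emeasure ?M {..r} = emeasure ?N {..r}" for r
  proof -
    consider "r < 0" | "r = 0" | "r > 0" by linarith
    then show ?thesis
    proof cases
      case 1
      then show ?thesis unfolding M N by simp
    next
      case 2
      have "(\<integral>\<^sup>+x. ennreal ((\<xi> \<bullet> x) ^ (2 * k)) * indicator {0} x \<partial>lborel) = 0" by simp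
      moreover have "(\<integral>\<^sup>+t. ennreal (sphere_moment k \<xi> * t ^ n) * indicator {0..0} t \<partial>lborel) = 0" by simp
      ultimately show ?thesis unfolding M N using 2 by simp
    next
      case 3
      have "(\<integral>\<^sup>+t. ennreal (sphere_moment k \<xi> * t ^ n) * indicator {0..r} t \<partial>lborel)
         = ennreal (ball_moment k \<xi> * r ^ Suc n - ball_moment k \<xi> * 0 ^ Suc n)"
      \<comment> \<open>The antiderivative is the moment of the ball of radius r; differentiating it
        produces the factor d + 2k of \<open>sphere_moment\<close>.\<close>
      proof (rule nn_integral_FTC_Icc)
        fix x :: real assume "x \<in> {0..r}"
        show "((\<lambda>r. ball_moment k \<xi> * r ^ Suc n) has_real_derivative sphere_moment k \<xi> * x ^ n) (at x)"
          unfolding sphere_moment_def n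
          by (rule derivative_eq_intros refl)+ simp
        show "0 \<le> sphere_moment k \<xi> * x ^ n"
          using \<open>x \<in> {0..r}\<close> by (simp add: sphere_moment_nonneg)
      qed (use 3 in auto)
      then show ?thesis unfolding M N ball_moment_cball[OF 3] unfolding n by (simp add: mult.commute)
    qed
  qed
  show ?thesis
  proof (rule measure_eqI_generator_eq[where E="?E" and A="\<lambda>i. {..real i}" and \<Omega>=UNIV])
    show "Int_stable ?E"
      unfolding Int_stable_def by (auto intro: image_eqI[where x="min _ _"])
    show "sets ?M = sigma_sets UNIV ?E" "sets ?N = sigma_sets UNIV ?E"
      by (simp_all add: borel_eq_atMost)
    show "(\<Union>i. {..real i}) = UNIV" by (auto simp: real_arch_simple)
    show "emeasure ?M {..real i} \<noteq> \<infinity>" for i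
      using ball_moment_cball[of "real i" \<xi> k] eq[of "real i"]
      by (cases "i = 0") (auto simp: M N[of 0])
  qed (auto simp: eq)
qed

text \<open>For k = 0 the integrand is 1 whatever \<open>\<xi>\<close> is, so this is the area of
  the unit sphere, d times the volume of the unit ball.\<close>

lemma sphere_moment_0:
  "sphere_moment 0 (\<xi> :: 'a::euclidean_space) = 2 * pi powr (real DIM('a) / 2) / Gamma (real DIM('a) / 2)"
proof -
  let ?d = "real DIM('a)"
  have "ennreal (ball_moment 0 \<xi>) = ennreal (unit_ball_vol ?d)"
    unfolding ball_moment_nn[symmetric] by (simp add: emeasure_cball)
  then have "ball_moment 0 \<xi> = unit_ball_vol ?d"
    by (subst (asm) ennreal_inj) (auto simp: ball_moment_nonneg)
  moreover have "Gamma (?d / 2 + 1) = ?d / 2 * Gamma (?d / 2)"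
    by (rule Gamma_plus1) (auto simp: nonpos_Ints_def dest!: arg_cong[where f="\<lambda>x. x \<le> 0"])
  ultimately show ?thesis
    by (simp add: sphere_moment_def unit_ball_vol_def)
qed

lemma nn_integral_polar:
  fixes \<xi> :: "'a::euclidean_space"
  assumes [measurable]: "g \<in> borel_measurable borel"
  shows "(\<integral>\<^sup>+x. ennreal ((\<xi> \<bullet> x) ^ (2 * k)) * g (norm x) \<partial>lborel) =
    (\<integral>\<^sup>+t. ennreal (sphere_moment k \<xi> * t ^ (DIM('a) + 2 * k - 1)) * indicator {0..} t * g t \<partial>lborel)"
proof -
  have "(\<integral>\<^sup>+x. ennreal ((\<xi> \<bullet> x) ^ (2 * k)) * g (norm x) \<partial>lborel)
     = (\<integral>\<^sup>+t. g t \<partial>distr (density lborel (\<lambda>x. ennreal ((\<xi> \<bullet> x) ^ (2 * k)))) borel norm)"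
    by (subst nn_integral_distr) (auto simp: nn_integral_density)
  then show ?thesis unfolding distr_norm_polar by (simp add: nn_integral_density)
qed

lemma integral_polar:
  fixes \<xi> :: "'a::euclidean_space" and g :: "real \<Rightarrow> complex"
  assumes [measurable]: "g \<in> borel_measurable borel"
  shows "(\<integral>x. (\<xi> \<bullet> x) ^ (2 * k) *\<^sub>R g (norm x) \<partial>lborel) =
    (\<integral>t. (sphere_moment k \<xi> * t ^ (DIM('a) + 2 * k - 1) * indicator {0..} t) *\<^sub>R g t \<partial>lborel)"
proof -
  have "(\<integral>x. (\<xi> \<bullet> x) ^ (2 * k) *\<^sub>R g (norm x) \<partial>lborel)
     = (\<integral>t. g t \<partial>distr (density lborel (\<lambda>x. ennreal ((\<xi> \<bullet> x) ^ (2 * k)))) borel norm)"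
    by (subst integral_distr) (auto simp: integral_density)
  also have "distr (density lborel (\<lambda>x. ennreal ((\<xi> \<bullet> x) ^ (2 * k)))) borel norm
     = density lborel (\<lambda>t. ennreal (sphere_moment k \<xi> * t ^ (DIM('a) + 2 * k - 1) * indicator {0..} t))"
    unfolding distr_norm_polar by (intro density_cong) (auto split: split_indicator)
  finally show ?thesis
    by (subst (asm) integral_density) (auto simp: sphere_moment_nonneg split: split_indicator)
qed

section \<open>Measurability of the profile of a radial function\<close>

lemma norm_vimage_measurable [measurable]:
  "N \<in> sets borel \<Longrightarrow> (norm :: 'a::euclidean_space \<Rightarrow> real) -` N \<in> sets borel"
  using measurable_sets[of "norm :: 'a \<Rightarrow> real" borel borel N] by simp

text \<open>Polar integration with \<open>\<xi> = 0\<close> and \<open>k = 0\<close>, where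
  \<open>0 ^ 0 = 1\<close> makes the moment weight constantly 1. The density c t^(d-1) is positive
  for t > 0 and the point 0 is null, so null sets correspond in both directions.\<close>

lemma norm_vimage_null_iff:
  assumes [measurable]: "N \<in> sets borel" and "N \<subseteq> {0..}"
  shows "(norm :: 'a::euclidean_space \<Rightarrow> real) -` N \<in> null_sets lborel \<longleftrightarrow> N \<in> null_sets lborel"
proof -
  let ?c = "sphere_moment 0 (0::'a)"
  have c: "?c > 0" unfolding sphere_moment_0 by (simp add: Gamma_real_pos)
  have [measurable]: "(norm :: 'a \<Rightarrow> real) -` N \<in> sets borel" by (rule norm_vimage_measurable) fact
  have "emeasure lborel ((norm :: 'a \<Rightarrow> real) -` N) = (\<integral>\<^sup>+x. ennreal (((0::'a) \<bullet> x) ^ (2 * 0)) * indicator N (norm x) \<partial>lborel)"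
    by (subst nn_integral_indicator[symmetric], simp, intro nn_integral_cong) (simp add: indicator_def)
  also have "\<dots> = (\<integral>\<^sup>+t. ennreal (?c * t ^ (DIM('a) + 2 * 0 - 1)) * indicator {0..} t * indicator N t \<partial>lborel)"
    by (rule nn_integral_polar) measurable
  finally have "emeasure lborel ((norm :: 'a \<Rightarrow> real) -` N) = 0 \<longleftrightarrow>
      (AE t in lborel. ennreal (?c * t ^ (DIM('a) + 2 * 0 - 1)) * indicator {0..} t * indicator N t = 0)"
    by (simp only:) (rule nn_integral_0_iff_AE, measurable)
  also have "\<dots> \<longleftrightarrow> (AE t in lborel. t \<notin> N)"
    (is "?L \<longleftrightarrow> ?R")
  proof
    assume ?L
    then show ?R using AE_lborel_singleton[of "0::real"]
    proof eventually_elim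
      case (elim t)
      show ?case
      proof
        assume "t \<in> N"
        with assms(2) elim(2) have "t > 0" by force
        with elim(1) \<open>t \<in> N\<close> have "ennreal (?c * t ^ (DIM('a) + 2 * 0 - 1)) = 0" by simp
        moreover have "?c * t ^ (DIM('a) + 2 * 0 - 1) > 0" using c \<open>t > 0\<close> by simp
        ultimately show False by (simp only: ennreal_eq_0_iff)
      qed
    qed
  next
    assume ?R
    then show ?L by eventually_elim simp
  qed
  also have "\<dots> \<longleftrightarrow> N \<in> null_sets lborel"
    by (rule AE_iff_null_sets[symmetric]) simp
  finally show ?thesis by (simp add: null_sets_def)
qed

text \<open>A continuous image of a Borel set need not be Borel, but continuous images of compact
  sets are compact, and an F-sigma set of a Euclidean space is a countable union of compact
  sets.\<close>

lemma norm_image_fsigma: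
  fixes C :: "'a::euclidean_space set"
  assumes "fsigma C"
  shows "norm ` C \<in> sets borel"
proof -
  obtain F :: "nat \<Rightarrow> 'a set" where F: "range F \<subseteq> Collect compact" "C = \<Union>(range F)"
    using fsigma_Union_compact assms by metis
  have "compact (norm ` F n)" for n
    using F(1) by (intro compact_continuous_image continuous_intros) auto
  then have "(\<Union>n. norm ` F n) \<in> sets borel"
    by (intro sets.countable_UN) (auto intro!: borel_closed compact_imp_closed)
  then show ?thesis by (simp add: F(2) image_UN)
qed

text \<open>
  A fiber union \<open>norm -` E\<close> is squeezed between two fiber unions over Borel sets because
  it and its complement contain almost full \<open>\<sigma>\<close>-compact sets, whose norm images are Borel.
\<close>

lemma lebesgue_norm_vimage_D:
  fixes E :: "real set"
  assumes E: "(norm :: 'a::euclidean_space \<Rightarrow> real) -` E \<in> sets lebesgue" and sub: "E \<subseteq> {0..}"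
  shows "E \<in> sets lebesgue"
proof -
  let ?n = "norm :: 'a \<Rightarrow> real"
  obtain C T where C: "fsigma C" "T \<in> null_sets lebesgue" "C \<union> T = ?n -` E"
    by (rule lebesgue_set_almost_fsigma[OF E])
  have "- (?n -` E) \<in> sets lebesgue" using E by (simp add: Compl_in_sets_lebesgue)
  from lebesgue_set_almost_fsigma[OF this] obtain D U where D: "fsigma D" "U \<in> null_sets lebesgue" "D \<union> U = - (?n -` E)"
    by metis
  \<comment> \<open>The radii whose whole sphere misses both \<open>C\<close> and \<open>D\<close>.
    Such a sphere lies in the two null remainders, so \<open>N\<close> is null. A radius outside
    \<open>N\<close> is a norm of a point of \<open>C\<close>, hence in \<open>E\<close>, or of a
    point of \<open>D\<close>, hence not in \<open>E\<close>.\<close>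
  define N where "N = {0..} - ?n ` C - ?n ` D"
  have [measurable]: "?n ` C \<in> sets borel" "?n ` D \<in> sets borel"
    using norm_image_fsigma C(1) D(1) by auto
  have Nb [measurable]: "N \<in> sets borel" unfolding N_def by measurable
  have "?n -` N \<subseteq> T \<union> U"
  proof
    fix x assume "x \<in> ?n -` N"
    then have "x \<notin> C" "x \<notin> D" by (auto simp: N_def)
    then show "x \<in> T \<union> U" using C(3) D(3) by blast
  qed
  moreover have "T \<union> U \<in> null_sets lebesgue" using C(2) D(2) by auto
  moreover have "?n -` N \<in> sets lebesgue" by (intro sets_completionI_sets) simp
  ultimately have "?n -` N \<in> null_sets lebesgue"
    by (meson null_sets_subset)
  then have "?n -` N \<in> null_sets lborel"
    by (subst (asm) null_sets_completion_iff) auto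
  then have N: "N \<in> null_sets lborel"
    by (subst (asm) norm_vimage_null_iff) (auto simp: N_def)
  have "?n ` D \<inter> E = {}" "?n ` C \<subseteq> E" using C D by auto
  then have "E = ?n ` C \<union> (E \<inter> N)" using sub by (auto simp: N_def)
  moreover have "E \<inter> N \<in> sets lebesgue"
    using N by (intro sets_completionI_sub[of N lborel]) auto
  moreover have "?n ` C \<in> sets lebesgue" by (intro sets_completionI_sets) simp
  ultimately show ?thesis by (metis sets.Un)
qed

lemma completion_ex_borel_measurable_complex:
  fixes g :: "'a \<Rightarrow> complex"
  assumes "g \<in> borel_measurable (completion M)"
  shows "\<exists>g'\<in>borel_measurable M. AE x in M. g x = g' x"
proof -
  have "(\<lambda>x. Re (g x)) \<in> borel_measurable (completion M)" "(\<lambda>x. Im (g x)) \<in> borel_measurable (completion M)"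
    using assms by auto
  from this[THEN completion_ex_borel_measurable_real]
  obtain u v where [measurable]: "u \<in> borel_measurable M" "v \<in> borel_measurable M"
    and uv: "AE x in M. Re (g x) = u x" "AE x in M. Im (g x) = v x"
    by auto
  show ?thesis
  proof
    show "AE x in M. g x = Complex (u x) (v x)" using uv by eventually_elim (simp add: complex_eq_iff)
    have "(\<lambda>x. of_real (u x) + \<i> * of_real (v x)) \<in> borel_measurable M" by measurable
    then show "(\<lambda>x. Complex (u x) (v x)) \<in> borel_measurable M" by (simp add: Complex_eq)
  qed
qed

lemma AE_norm_I:
  assumes "AE t in lborel. t \<ge> 0 \<longrightarrow> P t"
  shows "AE x in (lborel :: 'a::euclidean_space measure). P (norm x)"
proof -
  from assms obtain N where N: "N \<in> null_sets lborel" "{t. \<not> (t \<ge> 0 \<longrightarrow> P t)} \<subseteq> N"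
    by (auto simp: eventually_ae_filter)
  have "N \<inter> {0..} \<in> null_sets lborel" using N(1) by (intro null_set_Int2) auto
  then have "(norm :: 'a \<Rightarrow> real) -` (N \<inter> {0..}) \<in> null_sets lborel"
    using N(1) by (subst norm_vimage_null_iff) auto
  then show ?thesis
    by (rule AE_I') (use N(2) norm_ge_zero in blast)
qed

text \<open>Polar integration wants a Borel function of one variable, whereas the assumption speaks
  of Lebesgue measurability on the space. The new profile vanishes off [0, \<rho>] everywhere, not
  just almost everywhere, so later estimates may use the support pointwise.\<close>

lemma radial_borel_version:
  fixes \<phi> :: "real \<Rightarrow> complex"
  assumes meas: "(\<lambda>x::'a::euclidean_space. \<phi> (norm x)) \<in> borel_measurable lebesgue"
    and supp: "\<And>t. t > \<rho> \<Longrightarrow> \<phi> t = 0"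
  obtains \<psi> where "\<psi> \<in> borel_measurable borel" "\<And>t. t < 0 \<or> t > \<rho> \<Longrightarrow> \<psi> t = 0"
    "AE t in lborel. t \<ge> 0 \<longrightarrow> \<phi> t = \<psi> t" "AE x in (lborel :: 'a measure). \<phi> (norm x) = \<psi> (norm x)"
proof -
  \<comment> \<open>The values of \<open>\<phi>\<close> at negative arguments are arbitrary and are
    replaced by 0 before measurability is examined.\<close>
  define g where "g t = (if t \<ge> 0 then \<phi> t else 0)" for t
  have "g \<in> borel_measurable lebesgue"
  proof (rule borel_measurableI)
    fix S :: "complex set" assume "open S"
    let ?E = "\<phi> -` S \<inter> {0..}"
    have "(norm :: 'a \<Rightarrow> real) -` ?E = (\<lambda>x. \<phi> (norm x)) -` S \<inter> space lebesgue" by auto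
    also have "\<dots> \<in> sets lebesgue"
      using meas \<open>open S\<close> by (meson borel_open measurable_sets)
    finally have "?E \<in> sets lebesgue"
      by (rule lebesgue_norm_vimage_D) auto
    moreover have "g -` S \<inter> space lebesgue = ?E \<union> (if 0 \<in> S then {..<0} else {})"
      by (auto simp: g_def split: if_splits)
    moreover have "{..<0::real} \<in> sets lebesgue" by (intro sets_completionI_sets) simp
    ultimately show "g -` S \<inter> space lebesgue \<in> sets lebesgue" by auto
  qed
  then obtain h where [measurable]: "h \<in> borel_measurable borel" and h: "AE t in lborel. g t = h t"
    using completion_ex_borel_measurable_complex[of g lborel] by auto
  define \<psi> where "\<psi> t = indicator {0..\<rho>} t *\<^sub>R h t" for t
  have ae: "AE t in lborel. t \<ge> 0 \<longrightarrow> \<phi> t = \<psi> t"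
    using h by eventually_elim (auto simp: g_def \<psi>_def indicator_def supp)
  show ?thesis
  proof (rule that)
    show "\<psi> \<in> borel_measurable borel" unfolding \<psi>_def by measurable
  qed (use ae AE_norm_I[OF ae] in \<open>auto simp: \<psi>_def\<close>)
qed

section \<open>Fourier transforms of radial functions\<close>

text \<open>The expansions to be compared are known for nonnegative arguments only. Once the
  coefficients below n agree, dividing the difference by z^n and letting z tend to 0 from the right
  isolates the coefficient of index n.\<close>

lemma powser_eq_on_nonneg_imp_eq:
  fixes a b :: "nat \<Rightarrow> real"
  assumes "\<And>z. z \<ge> 0 \<Longrightarrow> (\<lambda>n. a n * z ^ n) sums f z" "\<And>z. z \<ge> 0 \<Longrightarrow> (\<lambda>n. b n * z ^ n) sums f z"
  shows "a = b"
proof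
  define c where "c n = a n - b n" for n
  have c: "(\<lambda>n. c n * z ^ n) sums 0" if "z \<ge> 0" for z
    using sums_diff[OF assms[OF that]] by (simp add: c_def left_diff_distrib)
  fix n
  have "c n = 0"
  proof (induction n rule: less_induct)
    case (less n)
    have shift: "(\<lambda>k. c (k + n) * z ^ k) sums 0" if "z > 0" for z
    proof -
      have "(\<lambda>k. c (k + n) * z ^ (k + n)) sums (0 - (\<Sum>i<n. c i * z ^ i))"
        using c[of z] that by (intro sums_split_initial_segment) auto
      then have "(\<lambda>k. c (k + n) * z ^ (k + n) / z ^ n) sums (0 / z ^ n)"
        using less by (intro sums_divide) simp
      then show ?thesis using that by (simp add: power_add)
    qed
    define G where "G z = (\<Sum>k. c (k + n) * z ^ k)" for z
    have "(G \<longlongrightarrow> c (0 + n)) (at 0)"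
    proof (rule powser_limit_0)
      fix z :: real assume "norm z < 1"
      then show "(\<lambda>k. c (k + n) * z ^ k) sums G z"
        unfolding G_def using powser_inside[of "\<lambda>k. c (k + n)" 1 z] sums_summable[OF shift[of 1]]
        by (simp add: summable_sums)
    qed simp
    then have "(G \<longlongrightarrow> c n) (at_right 0)" by (simp add: filterlim_at_split)
    moreover have "\<forall>\<^sub>F z in at_right 0. G z = 0"
      using eventually_at_right_less[of "0::real"]
      by eventually_elim (auto simp: G_def sums_iff dest: shift)
    then have "(G \<longlongrightarrow> 0) (at_right 0)" by (rule tendsto_eventually)
    ultimately show ?case by (intro tendsto_unique[of "at_right (0::real)" G]) auto
  qed
  then show "a n = b n" by (simp add: c_def)
qed

section \<open>Gaussian moments and the constants of polar integration\<close>

lemma gaussian_radial_moment: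
  "(\<integral>\<^sup>+t. ennreal (t ^ n) * indicator {0..} t * ennreal (exp (- t\<^sup>2)) \<partial>lborel) = ennreal (Gamma ((real n + 1) / 2) / 2)"
proof -
  have *: "(\<integral>\<^sup>+t. ennreal (t ^ n) * indicator {0..} t * ennreal (exp (- t\<^sup>2)) \<partial>lborel) = ennreal I"
    if "has_bochner_integral lborel (\<lambda>x::real. indicator {0..} x *\<^sub>R (exp (- x\<^sup>2) * x ^ n)) I" for I
  proof -
    have "(\<integral>\<^sup>+t. ennreal (t ^ n) * indicator {0..} t * ennreal (exp (- t\<^sup>2)) \<partial>lborel)
      = (\<integral>\<^sup>+t. ennreal (indicator {0..} t *\<^sub>R (exp (- t\<^sup>2) * t ^ n)) \<partial>lborel)"
      by (intro nn_integral_cong) (auto split: split_indicator simp: ennreal_mult mult.commute)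
    also have "\<dots> = ennreal I"
      using that by (subst nn_integral_eq_integral)
        (auto simp: has_bochner_integral_iff split: split_indicator)
    finally show ?thesis .
  qed
  show ?thesis
  \<comment> \<open>The Gaussian moments are known in terms of factorials, separately for each
    parity: even n leads to Gamma at k + 1/2, odd n to Gamma at k + 1.\<close>
  proof (cases "even n")
    case True
    then obtain k where n: "n = 2 * k" by blast
    have "sqrt pi * (fact (2 * k) / (2 ^ (2 * k) * fact k)) = Gamma (real k + 1 / 2)"
    proof (induction k)
      case 0
      then show ?case by (simp add: Gamma_one_half_real)
    next
      case (Suc k)
      have "Gamma (real k + 1 / 2 + 1) = (real k + 1 / 2) * Gamma (real k + 1 / 2)"
        by (rule Gamma_plus1) (auto simp: nonpos_Ints_def dest!: arg_cong[where f="\<lambda>x. x \<le> 0"])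
      moreover have "sqrt pi * (fact (2 * Suc k) / (2 ^ (2 * Suc k) * fact (Suc k)))
          = (real k + 1 / 2) * (sqrt pi * (fact (2 * k) / (2 ^ (2 * k) * fact k)))"
      proof -
        have "(2 * x + 2) * (2 * x + 1) * a / (4 * c * ((x + 1) * b)) = (x + 1 / 2) * (a / (c * b))" if "x \<ge> 0" for x a b c :: real
        proof -
          have "(2 * x + 2) * (2 * x + 1) * a / (4 * c * ((x + 1) * b)) = (4 * (x + 1)) * ((x + 1 / 2) * a) / ((4 * (x + 1)) * (c * b))"
            by (rule arg_cong2[where f="(/)"]) algebra+
          also have "\<dots> = (x + 1 / 2) * a / (c * b)"
            by (rule mult_divide_mult_cancel_left) (use that in auto)
          finally show ?thesis by simp
        qed
        note this[of "real k" "fact (2 * k)" "2 ^ (2 * k)" "fact k"]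
        moreover have "fact (2 * Suc k) = (2 * real k + 2) * (2 * real k + 1) * fact (2 * k)"
          by (simp add: add.commute)
        moreover have "fact (Suc k) = (real k + 1) * fact k" by simp
        moreover have "(2::real) ^ (2 * Suc k) = 4 * 2 ^ (2 * k)" by simp
        ultimately show ?thesis by (simp only: of_nat_0_le_iff simp_thms mult.left_commute)
      qed
      moreover have "real k + 1 / 2 + 1 = real (Suc k) + 1 / 2" by simp
      ultimately show ?case by (simp only: Suc.IH)
    qed
    moreover have eq: "(real n + 1) / 2 = real k + 1 / 2" by (simp add: n field_simps)
    ultimately have "Gamma ((real n + 1) / 2) / 2 = sqrt pi / 2 * (fact (2 * k) / (2 ^ (2 * k) * fact k))"
      unfolding eq by simp
    with *[of "sqrt pi / 2 * (fact (2 * k) / (2 ^ (2 * k) * fact k))"] gaussian_moment_even_pos[of k]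
    show ?thesis unfolding n by simp
  next
    case False
    then obtain k where n: "n = 2 * k + 1" by (elim oddE)
    have "(real n + 1) / 2 = 1 + real k" by (simp add: n field_simps)
    then have "Gamma ((real n + 1) / 2) = fact k" by (simp only: Gamma_fact)
    with *[of "fact k / 2"] gaussian_moment_odd_pos[of k] show ?thesis
      by (simp add: n)
  qed
qed

lemma gaussian_moment_inner:
  fixes \<xi> :: "'a::euclidean_space"
  shows "(\<integral>\<^sup>+x. ennreal ((\<xi> \<bullet> x) ^ (2 * k)) * ennreal (exp (- (norm x)\<^sup>2)) \<partial>lborel)
    = ennreal (sphere_moment k \<xi> * Gamma (real DIM('a) / 2 + real k) / 2)"
proof -
  let ?n = "DIM('a) + 2 * k - 1"
  have "(\<integral>\<^sup>+x. ennreal ((\<xi> \<bullet> x) ^ (2 * k)) * ennreal (exp (- (norm x)\<^sup>2)) \<partial>lborel)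
    = (\<integral>\<^sup>+t. ennreal (sphere_moment k \<xi> * t ^ ?n) * indicator {0..} t * ennreal (exp (- t\<^sup>2)) \<partial>lborel)"
    by (rule nn_integral_polar) measurable
  also have "\<dots> = (\<integral>\<^sup>+t. ennreal (sphere_moment k \<xi>) * (ennreal (t ^ ?n) * indicator {0..} t * ennreal (exp (- t\<^sup>2))) \<partial>lborel)"
    by (intro nn_integral_cong) (auto split: split_indicator simp: ennreal_mult sphere_moment_nonneg mult.assoc)
  also have "\<dots> = ennreal (sphere_moment k \<xi>) * ennreal (Gamma ((real ?n + 1) / 2) / 2)"
    by (subst nn_integral_cmult, measurable, simp only: gaussian_radial_moment)
  also have "(real ?n + 1) / 2 = real DIM('a) / 2 + real k"
  proof -
    have "?n + 1 = DIM('a) + 2 * k" using DIM_positive[where 'a='a] by linarith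
    then have "real ?n + 1 = real DIM('a) + 2 * real k" by linarith
    then show ?thesis by simp
  qed
  finally show ?thesis
    using ennreal_mult[OF sphere_moment_nonneg[of k \<xi>], of "Gamma (real DIM('a) / 2 + real k) / 2"]
    by (simp add: Gamma_real_pos add_pos_nonneg less_imp_le)
qed

text \<open>The moment formula for k = 0: the factor Gamma(d/2) cancels against the one in the area
  of the sphere.\<close>

lemma gaussian_nn_integral:
  "(\<integral>\<^sup>+x. ennreal (exp (- (norm x)\<^sup>2)) \<partial>(lborel :: 'a::euclidean_space measure)) = ennreal (pi powr (real DIM('a) / 2))"
proof -
  have "Gamma (real DIM('a) / 2) > 0" by (intro Gamma_real_pos) simp
  then have "Gamma (real DIM('a) / 2) \<noteq> 0" by linarith
  then show ?thesis
    using gaussian_moment_inner[of "0::'a" 0] by (simp add: sphere_moment_0)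
qed

text \<open>Completing the square: after translation by \<open>\<xi>\<close> the exponent becomes
  |\<xi>|^2 - |x|^2.\<close>

lemma gaussian_laplace:
  fixes \<xi> :: "'a::euclidean_space"
  shows "(\<integral>\<^sup>+x. ennreal (exp (- (norm x)\<^sup>2) * exp (2 * (\<xi> \<bullet> x))) \<partial>lborel) = ennreal (pi powr (real DIM('a) / 2) * exp ((norm \<xi>)\<^sup>2))"
proof -
  have "(\<integral>\<^sup>+x. ennreal (exp (- (norm x)\<^sup>2) * exp (2 * (\<xi> \<bullet> x))) \<partial>lborel)
    = (\<integral>\<^sup>+x. ennreal (exp (- (norm (x + \<xi>))\<^sup>2) * exp (2 * (\<xi> \<bullet> (x + \<xi>)))) \<partial>lborel)"
    by (rule nn_integral_lborel_translate[symmetric]) measurable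
  also have "\<dots> = (\<integral>\<^sup>+x. ennreal (exp ((norm \<xi>)\<^sup>2)) * ennreal (exp (- (norm (x::'a))\<^sup>2)) \<partial>lborel)"
  proof (intro nn_integral_cong)
    fix x :: 'a
    have "- (norm (x + \<xi>))\<^sup>2 + 2 * (\<xi> \<bullet> (x + \<xi>)) = (norm \<xi>)\<^sup>2 - (norm x)\<^sup>2"
      by (simp add: power2_norm_eq_inner inner_simps inner_commute)
    then show "ennreal (exp (- (norm (x + \<xi>))\<^sup>2) * exp (2 * (\<xi> \<bullet> (x + \<xi>))))
       = ennreal (exp ((norm \<xi>)\<^sup>2)) * ennreal (exp (- (norm x)\<^sup>2))"
      by (simp add: ennreal_mult''[symmetric] flip: exp_add)
  qed
  also have "\<dots> = ennreal (exp ((norm \<xi>)\<^sup>2)) * ennreal (pi powr (real DIM('a) / 2))"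
    by (subst nn_integral_cmult) (auto simp: gaussian_nn_integral)
  finally show ?thesis by (simp add: ennreal_mult''[symmetric] mult.commute)
qed

lemma cosh_paired: "(\<lambda>k. x ^ (2 * k) / fact (2 * k)) sums cosh (x::real)"
proof -
  have "(\<lambda>k. (\<lambda>n. if even n then x ^ n /\<^sub>R fact n else 0) (2 * k)) sums cosh x"
    by (subst sums_mono_reindex) (auto simp: strict_mono_def intro: cosh_converges)
  then show ?thesis by (simp add: divide_inverse_commute)
qed

text \<open>Averaging over \<open>\<xi>\<close> and \<open>- \<xi>\<close> removes the odd powers.
  The remaining series has nonnegative terms, so it may be integrated term by term without an
  integrable majorant.\<close>

lemma gaussian_cosh:
  fixes \<xi> :: "'a::euclidean_space"
  shows "(\<integral>\<^sup>+x. ennreal (exp (- (norm x)\<^sup>2) * cosh (2 * (\<xi> \<bullet> x))) \<partial>lborel) = ennreal (pi powr (real DIM('a) / 2) * exp ((norm \<xi>)\<^sup>2))"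
    (is "_ = ennreal ?R")
proof -
  have "(\<integral>\<^sup>+x. ennreal (exp (- (norm x)\<^sup>2) * cosh (2 * (\<xi> \<bullet> x))) \<partial>lborel)
    = (\<integral>\<^sup>+x. ennreal (1/2) * (ennreal (exp (- (norm x)\<^sup>2) * exp (2 * (\<xi> \<bullet> x)))
         + ennreal (exp (- (norm x)\<^sup>2) * exp (2 * (- \<xi> \<bullet> x)))) \<partial>lborel)"
    by (intro nn_integral_cong, subst ennreal_plus[symmetric], simp, simp, subst ennreal_mult''[symmetric], simp)
       (simp add: cosh_def field_simps)
  also have "\<dots> = ennreal (1/2) * (ennreal ?R + ennreal ?R)"
    using gaussian_laplace[of "- \<xi>"]
    by (subst nn_integral_cmult, simp, subst nn_integral_add) (auto simp: gaussian_laplace)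
  also have "\<dots> = ennreal ?R"
  proof -
    have "ennreal ?R + ennreal ?R = ennreal (2 * ?R)"
      by (subst ennreal_plus[symmetric]) auto
    then show ?thesis using ennreal_mult[of "1/2" "2 * ?R"] by simp
  qed
  finally show ?thesis .
qed

text \<open>
  Expanding the Laplace transform of the Gaussian in powers of \<open>\<xi>\<close> evaluates the moments
  \<open>\<integral> (\<xi> \<bullet> x) ^ (2k) exp (-\<bar>x\<bar>\<^sup>2) dx\<close>, and with them the constants of \<open>distr_norm_polar\<close>.
\<close>

lemma sphere_moment_eq:
  fixes \<xi> :: "'a::euclidean_space"
  shows "sphere_moment k \<xi> = 2 * pi powr (real DIM('a) / 2) * norm \<xi> ^ (2 * k) * fact (2 * k) /
           (4 ^ k * fact k * Gamma (real DIM('a) / 2 + real k))"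
proof -
  let ?G = "\<lambda>k. Gamma (real DIM('a) / 2 + real k)"
  have G: "?G k > 0" for k by (intro Gamma_real_pos) (simp add: add_pos_nonneg)
  \<comment> \<open>\<open>a\<close> collects the Gaussian moments and \<open>b\<close> the
    coefficients of the exponential. Both expand \<open>f\<close>, the Laplace transform at u \<xi>
    as a function of z = u^2.\<close>
  define a where "a k = 4 ^ k / fact (2 * k) * (sphere_moment k \<xi> * ?G k / 2)" for k
  define b where "b k = pi powr (real DIM('a) / 2) * ((norm \<xi>)\<^sup>2) ^ k / fact k" for k
  define f where "f z = pi powr (real DIM('a) / 2) * exp (z * (norm \<xi>)\<^sup>2)" for z
  have "a = b"
  proof (rule powser_eq_on_nonneg_imp_eq)
    fix z :: real assume "z \<ge> 0"
    define u where "u = sqrt z"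
    have u: "u\<^sup>2 = z" "u \<ge> 0" using \<open>z \<ge> 0\<close> by (auto simp: u_def)
    have "ennreal (f z) = (\<integral>\<^sup>+x. ennreal (exp (- (norm x)\<^sup>2) * cosh (2 * ((u *\<^sub>R \<xi>) \<bullet> x))) \<partial>lborel)"
      unfolding gaussian_cosh f_def by (simp add: power_mult_distrib u(1))
    also have "\<dots> = (\<integral>\<^sup>+x. (\<Sum>k. ennreal (4 ^ k / fact (2 * k) * z ^ k) * (ennreal ((\<xi> \<bullet> x) ^ (2 * k)) * ennreal (exp (- (norm x)\<^sup>2)))) \<partial>lborel)"
    proof (intro nn_integral_cong)
      fix x :: 'a
      have "(\<lambda>k. exp (- (norm x)\<^sup>2) * ((2 * ((u *\<^sub>R \<xi>) \<bullet> x)) ^ (2 * k) / fact (2 * k))) sums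
         (exp (- (norm x)\<^sup>2) * cosh (2 * ((u *\<^sub>R \<xi>) \<bullet> x)))"
        by (intro sums_mult cosh_paired)
      then have "(\<Sum>k. ennreal (exp (- (norm x)\<^sup>2) * ((2 * ((u *\<^sub>R \<xi>) \<bullet> x)) ^ (2 * k) / fact (2 * k)))) =
         ennreal (exp (- (norm x)\<^sup>2) * cosh (2 * ((u *\<^sub>R \<xi>) \<bullet> x)))"
        by (intro suminf_ennreal_eq) (auto simp: power_mult)
      moreover have "ennreal (exp (- (norm x)\<^sup>2) * ((2 * ((u *\<^sub>R \<xi>) \<bullet> x)) ^ (2 * k) / fact (2 * k))) =
         ennreal (4 ^ k / fact (2 * k) * z ^ k) * (ennreal ((\<xi> \<bullet> x) ^ (2 * k)) * ennreal (exp (- (norm x)\<^sup>2)))" for k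
      proof -
        have "(2 * ((u *\<^sub>R \<xi>) \<bullet> x)) ^ (2 * k) = 4 ^ k * z ^ k * (\<xi> \<bullet> x) ^ (2 * k)"
          by (simp add: power_mult power_mult_distrib u(1))
        moreover have "(\<xi> \<bullet> x) ^ (2 * k) \<ge> 0" by simp
        then have "ennreal (4 ^ k / fact (2 * k) * z ^ k) * (ennreal ((\<xi> \<bullet> x) ^ (2 * k)) * ennreal (exp (- (norm x)\<^sup>2)))
           = ennreal ((4 ^ k / fact (2 * k) * z ^ k) * ((\<xi> \<bullet> x) ^ (2 * k) * exp (- (norm x)\<^sup>2)))"
          using \<open>z \<ge> 0\<close> by (subst (2) ennreal_mult) (simp_all add: ennreal_mult)
        ultimately show ?thesis by (simp add: mult_ac)
      qed
      ultimately show "ennreal (exp (- (norm x)\<^sup>2) * cosh (2 * ((u *\<^sub>R \<xi>) \<bullet> x))) =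
        (\<Sum>k. ennreal (4 ^ k / fact (2 * k) * z ^ k) * (ennreal ((\<xi> \<bullet> x) ^ (2 * k)) * ennreal (exp (- (norm x)\<^sup>2))))"
        by simp
    qed
    also have "\<dots> = (\<Sum>k. ennreal (4 ^ k / fact (2 * k) * z ^ k) * ennreal (sphere_moment k \<xi> * ?G k / 2))"
      by (subst nn_integral_suminf) (auto simp: nn_integral_cmult gaussian_moment_inner)
    also have "\<dots> = (\<Sum>k. ennreal (a k * z ^ k))"
    proof (intro suminf_cong)
      fix k
      have "sphere_moment k \<xi> * ?G k / 2 \<ge> 0" using G[of k] by (simp add: sphere_moment_nonneg)
      then show "ennreal (4 ^ k / fact (2 * k) * z ^ k) * ennreal (sphere_moment k \<xi> * ?G k / 2) = ennreal (a k * z ^ k)"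
        using \<open>z \<ge> 0\<close> by (subst ennreal_mult[symmetric]) (simp_all add: a_def mult_ac)
    qed
    finally have *: "(\<Sum>k. ennreal (a k * z ^ k)) = ennreal (f z)" by simp
    have nn: "a k * z ^ k \<ge> 0" for k
      using \<open>z \<ge> 0\<close> G[THEN less_imp_le] by (simp add: a_def sphere_moment_nonneg)
    have sm: "summable (\<lambda>k. a k * z ^ k)"
      by (rule summable_suminf_not_top) (use * nn in auto)
    moreover have "f z \<ge> 0" by (simp add: f_def)
    ultimately show "(\<lambda>k. a k * z ^ k) sums f z"
      using * nn by (simp add: sums_iff suminf_ennreal2 suminf_nonneg)
    have "(\<lambda>k. pi powr (real DIM('a) / 2) * ((z * (norm \<xi>)\<^sup>2) ^ k /\<^sub>R fact k)) sums f z"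
      unfolding f_def by (intro sums_mult exp_converges)
    then show "(\<lambda>k. b k * z ^ k) sums f z"
      by (simp add: b_def power_mult_distrib field_simps)
  qed
  then have "a k = b k" by simp
  then show ?thesis
    using G[of k] unfolding power_mult[of "norm \<xi>"] by (simp add: a_def b_def field_simps)
qed

section \<open>Expansion of the Fourier transform and of the profile in powers of the squared
  frequency\<close>

lemma borel_measurable_lebesgue_AE:
  fixes f g :: "'a::euclidean_space \<Rightarrow> 'b::topological_space"
  assumes g: "g \<in> borel_measurable borel" and ae: "AE x in lborel. f x = g x"
  shows "f \<in> borel_measurable lebesgue"
proof (rule measurableI)
  fix S :: "'b set" assume S: "S \<in> sets borel"
  obtain N where N: "N \<in> null_sets lborel" "{x. f x \<noteq> g x} \<subseteq> N"
    using ae by (auto simp: eventually_ae_filter)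
  have "f -` S \<inter> space lebesgue = (g -` S - N) \<union> (f -` S \<inter> N)" using N(2) by auto
  moreover have "g -` S - N \<in> sets lebesgue"
    using measurable_sets[OF g S] N(1) by (intro sets_completionI_sets) auto
  moreover have "f -` S \<inter> N \<in> sets lebesgue"
    using N(1) by (intro sets_completionI_sub[of N lborel]) auto
  ultimately show "f -` S \<inter> space lebesgue \<in> sets lebesgue" by (metis sets.Un)
qed simp

lemma
  fixes f g :: "'a::euclidean_space \<Rightarrow> 'b::{banach, second_countable_topology}"
  assumes g: "g \<in> borel_measurable borel" and ae: "AE x in lborel. f x = g x"
  shows integral_lebesgue_AE: "integral\<^sup>L lebesgue f = integral\<^sup>L lborel g"
    and integrable_lebesgue_AE: "integrable lebesgue f \<longleftrightarrow> integrable lborel g"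
proof -
  have f: "f \<in> borel_measurable lebesgue" by (rule borel_measurable_lebesgue_AE[OF assms])
  have g': "g \<in> borel_measurable lebesgue" using g by (simp add: measurable_completion)
  have ae': "AE x in lebesgue. f x = g x" using ae by (rule AE_completion)
  show "integral\<^sup>L lebesgue f = integral\<^sup>L lborel g"
    using integral_cong_AE[OF f g' ae'] integral_completion[of g lborel] g by simp
  show "integrable lebesgue f \<longleftrightarrow> integrable lborel g"
    using integrable_cong_AE[OF f g' ae'] integrable_completion[of g lborel] g by simp
qed

text \<open>Consecutive terms have ratio |X| / ((n + 1)(c + n)). Since c is at least 1/2, 2(c + n)
  is at least 1, and the ratio is at most 1/2 from n \<ge> 4|X| on.\<close>

lemma summable_bessel:
  fixes c X :: real
  assumes c: "c \<ge> 1 / 2"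
  shows "summable (\<lambda>k. X ^ k / (fact k * Gamma (c + real k)))"
proof (rule summable_ratio_test)
  let ?N = "nat \<lceil>4 * \<bar>X\<bar>\<rceil>"
  fix n assume n: "n \<ge> ?N"
  have G: "Gamma (c + real n) > 0" using c by (intro Gamma_real_pos) auto
  have "Gamma (c + real n + 1) = (c + real n) * Gamma (c + real n)"
    using c by (intro Gamma_plus1) (auto simp: nonpos_Ints_def dest!: arg_cong[where f="\<lambda>x. x \<le> 0"])
  then have G1: "Gamma (c + real (Suc n)) = (c + real n) * Gamma (c + real n)" by (simp add: add_ac)
  have "norm (X ^ Suc n / (fact (Suc n) * Gamma (c + real (Suc n))))
    = \<bar>X\<bar> / ((real n + 1) * (c + real n)) * norm (X ^ n / (fact n * Gamma (c + real n)))"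
    using G c unfolding G1 by (simp add: abs_mult power_abs field_simps)
  also have "\<dots> \<le> 1 / 2 * norm (X ^ n / (fact n * Gamma (c + real n)))"
  proof (rule mult_right_mono)
    have pos: "(real n + 1) * (c + real n) > 0" using c by (intro mult_pos_pos) auto
    have "4 * \<bar>X\<bar> \<le> real n" using n by linarith
    then have "4 * \<bar>X\<bar> \<le> (real n + 1) * 1" by simp
    also have "\<dots> \<le> (real n + 1) * (2 * (c + real n))" using c by (intro mult_left_mono) auto
    also have "\<dots> = 2 * ((real n + 1) * (c + real n))" by (rule mult.left_commute)
    finally show "\<bar>X\<bar> / ((real n + 1) * (c + real n)) \<le> 1 / 2"
      using pos by (simp add: pos_divide_le_eq mult.commute)
  qed simp
  finally show "norm (X ^ Suc n / (fact (Suc n) * Gamma (c + real (Suc n))))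
    \<le> 1 / 2 * norm (X ^ n / (fact n * Gamma (c + real n)))" .
qed simp

definition radial_moment :: "nat \<Rightarrow> (real \<Rightarrow> complex) \<Rightarrow> complex" where
  "radial_moment n \<psi> = (\<integral>t. (t ^ n * indicator {0..} t) *\<^sub>R \<psi> t \<partial>lborel)"

text \<open>The factor in front is the cosine coefficient (-1)^k (2 pi)^(2k) / (2k)! times
  \<open>sphere_moment\<close> at a unit vector, after (2k)! and 4^k have cancelled.\<close>

definition profile_coeff :: "nat \<Rightarrow> (real \<Rightarrow> complex) \<Rightarrow> nat \<Rightarrow> complex" where
  "profile_coeff d \<psi> k = of_real ((- 1) ^ k * 2 * pi powr (real d / 2) * pi ^ (2 * k) /
     (fact k * Gamma (real d / 2 + real k))) * radial_moment (d + 2 * k - 1) \<psi>"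

text \<open>The \<open>itself\<close> argument fixes the Euclidean space: \<open>\<psi>\<close>,
  \<open>\<rho>\<close> and \<open>d\<close> do not mention its type, and neither do the statements
  about the one-dimensional moments.\<close>

locale radial_function =
  fixes \<psi> :: "real \<Rightarrow> complex" and \<rho> :: real and d :: nat and domain_type :: "'a::euclidean_space itself"
  assumes measurable_psi [measurable]: "\<psi> \<in> borel_measurable borel"
    and supp: "\<And>t. t < 0 \<or> t > \<rho> \<Longrightarrow> \<psi> t = 0"
    and integrable_psi: "integrable lborel (\<lambda>x::'a. \<psi> (norm x))"
    and rho_pos: "\<rho> > 0"
    and dim: "d = DIM('a)"
begin

lemma dim_pos: "d > 0" by (simp add: dim)

text \<open>Polar integration for k = 0 identifies the L1 norm of the radial function with a
  positive multiple of the integral needed here.\<close>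

lemma integrable_moment_0: "integrable lborel (\<lambda>t. (t ^ (d - 1) * indicator {0..} t) *\<^sub>R \<psi> t)"
proof (rule integrableI_bounded)
  let ?c = "sphere_moment 0 (0::'a)"
  have c: "?c > 0" unfolding sphere_moment_0 by (simp add: Gamma_real_pos)
  have "(\<integral>\<^sup>+t. ennreal (norm ((t ^ (d - 1) * indicator {0..} t) *\<^sub>R \<psi> t)) \<partial>lborel)
    = (\<integral>\<^sup>+t. ennreal (1 / ?c) * (ennreal (?c * t ^ (DIM('a) + 2 * 0 - 1)) * indicator {0..} t * ennreal (norm (\<psi> t))) \<partial>lborel)"
    using c by (intro nn_integral_cong)
      (auto split: split_indicator simp: dim ennreal_mult''[symmetric] ennreal_mult'[symmetric] abs_mult)
  also have "\<dots> = ennreal (1 / ?c) * (\<integral>\<^sup>+x. ennreal (((0::'a) \<bullet> x) ^ (2 * 0)) * ennreal (norm (\<psi> (norm x))) \<partial>lborel)"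
    by (subst nn_integral_polar, measurable, subst nn_integral_cmult) auto
  also have "\<dots> < \<infinity>"
    using integrable_psi by (auto simp: integrable_iff_bounded ennreal_mult_less_top)
  finally show "(\<integral>\<^sup>+t. ennreal (norm ((t ^ (d - 1) * indicator {0..} t) *\<^sub>R \<psi> t)) \<partial>lborel) < \<infinity>" .
qed measurable

text \<open>On the support t is at most \<open>\<rho>\<close>, so two extra powers of t cost at most
  the factor \<rho>^2. All moments are thus controlled by the one of lowest order.\<close>

lemma norm_moment_le:
  "norm ((t ^ (d + 2 * k - 1) * indicator {0..} t) *\<^sub>R \<psi> t)
     \<le> \<rho> ^ (2 * k) * norm ((t ^ (d - 1) * indicator {0..} t) *\<^sub>R \<psi> t)"
proof (cases "0 \<le> t \<and> t \<le> \<rho>")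
  case True
  have "d + 2 * k - 1 = (d - 1) + 2 * k" using dim_pos by simp
  then have "t ^ (d + 2 * k - 1) = t ^ (2 * k) * t ^ (d - 1)" by (simp add: power_add)
  moreover have "t ^ (2 * k) \<le> \<rho> ^ (2 * k)" using True by (intro power_mono) auto
  ultimately show ?thesis using True
    by (simp add: abs_mult mult.assoc) (intro mult_right_mono, auto)
next
  case False
  then show ?thesis using supp[of t] by auto
qed

lemma integrable_moment: "integrable lborel (\<lambda>t. (t ^ (d + 2 * k - 1) * indicator {0..} t) *\<^sub>R \<psi> t)"
  by (rule Bochner_Integration.integrable_bound[OF integrable_mult_right[OF integrable_norm[OF integrable_moment_0], of "\<rho> ^ (2 * k)"]])
     (use norm_moment_le[of _ k] rho_pos in \<open>auto simp: abs_mult\<close>)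

definition M0 :: real where "M0 = (\<integral>t. norm ((t ^ (d - 1) * indicator {0..} t) *\<^sub>R \<psi> t) \<partial>lborel)"

lemma integral_norm_moment_le:
  "(\<integral>t. norm ((t ^ (d + 2 * k - 1) * indicator {0..} t) *\<^sub>R \<psi> t) \<partial>lborel) \<le> \<rho> ^ (2 * k) * M0"
proof -
  have "(\<integral>t. norm ((t ^ (d + 2 * k - 1) * indicator {0..} t) *\<^sub>R \<psi> t) \<partial>lborel)
    \<le> (\<integral>t. \<rho> ^ (2 * k) * norm ((t ^ (d - 1) * indicator {0..} t) *\<^sub>R \<psi> t) \<partial>lborel)"
    by (intro integral_mono integrable_norm integrable_moment integrable_mult_right integrable_moment_0 norm_moment_le)
  then show ?thesis by (simp add: M0_def)
qed

lemma norm_radial_moment_le: "norm (radial_moment (d + 2 * k - 1) \<psi>) \<le> \<rho> ^ (2 * k) * M0"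
  unfolding radial_moment_def by (rule order_trans[OF integral_norm_bound integral_norm_moment_le])

lemma half_dim: "real d / 2 \<ge> 1 / 2" using dim_pos by simp

lemma Gamma_half_dim_pos: "Gamma (real d / 2 + real k) > 0"
  using half_dim by (intro Gamma_real_pos) linarith

text \<open>The moments grow at most like \<rho>^(2k), while k! Gamma(d/2 + k) outgrows every
  geometric sequence. Convergence on the whole complex plane is what makes the profile extend to an
  entire function.\<close>

lemma summable_profile: "summable (\<lambda>k. profile_coeff d \<psi> k * z ^ k)" for z :: complex
proof (rule summable_comparison_test')
  have "summable (\<lambda>k. 2 * pi powr (real d / 2) * M0 * ((pi\<^sup>2 * \<rho>\<^sup>2 * norm z) ^ k / (fact k * Gamma (real d / 2 + real k))))"
    by (intro summable_mult summable_bessel half_dim)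
  then show "summable (\<lambda>k. 2 * pi powr (real d / 2) * M0 * (pi\<^sup>2 * \<rho>\<^sup>2 * norm z) ^ k / (fact k * Gamma (real d / 2 + real k)))"
    by simp
  fix k
  have "norm (profile_coeff d \<psi> k * z ^ k) = (2 * pi powr (real d / 2) * pi ^ (2 * k) /
     (fact k * Gamma (real d / 2 + real k))) * norm z ^ k * norm (radial_moment (d + 2 * k - 1) \<psi>)"
    using Gamma_half_dim_pos[of k] by (simp add: profile_coeff_def norm_mult norm_power abs_mult norm_divide)
  also have "\<dots> \<le> (2 * pi powr (real d / 2) * pi ^ (2 * k) /
     (fact k * Gamma (real d / 2 + real k))) * norm z ^ k * (\<rho> ^ (2 * k) * M0)"
    using Gamma_half_dim_pos[of k] by (intro mult_left_mono norm_radial_moment_le) auto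
  also have "\<dots> = 2 * pi powr (real d / 2) * M0 * (pi\<^sup>2 * \<rho>\<^sup>2 * norm z) ^ k / (fact k * Gamma (real d / 2 + real k))"
    by (simp add: power_mult power_mult_distrib)
  finally show "norm (profile_coeff d \<psi> k * z ^ k) \<le>
     2 * pi powr (real d / 2) * M0 * (pi\<^sup>2 * \<rho>\<^sup>2 * norm z) ^ k / (fact k * Gamma (real d / 2 + real k))" .
qed

text \<open>The reflection x -> -x replaces the exponential by a cosine. Its power series is
  integrated term by term, and polar integration turns each even power of the inner product into a
  multiple of |\<xi>|^(2k).\<close>

lemma fourier_radial:
  fixes \<xi> :: 'a
  shows "(\<lambda>k. profile_coeff d \<psi> k * of_real ((norm \<xi>)\<^sup>2) ^ k) sums
    (\<integral>x. \<psi> (norm x) * cis (- 2 * pi * (\<xi> \<bullet> x)) \<partial>lborel)"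
proof -
  let ?I = "\<integral>x. \<psi> (norm x) * cis (- 2 * pi * (\<xi> \<bullet> x)) \<partial>lborel"
  let ?I' = "\<integral>x. \<psi> (norm x) * cis (2 * pi * (\<xi> \<bullet> x)) \<partial>lborel"
  have int: "integrable lborel (\<lambda>x. \<psi> (norm x) * cis (c * (\<xi> \<bullet> x)))" for c
    by (rule Bochner_Integration.integrable_bound[OF integrable_psi]) (auto simp: norm_mult)
  have "?I = (\<integral>x. \<psi> (norm (- x)) * cis (- 2 * pi * (\<xi> \<bullet> (- x))) \<partial>lborel)"
    by (rule integral_lborel_uminus[symmetric]) measurable
  then have "?I = ?I'" by simp
  then have "2 * ?I = ?I + ?I'" by simp
  also have "\<dots> = (\<integral>x. 2 * (of_real (cos (2 * pi * (\<xi> \<bullet> x))) * \<psi> (norm x)) \<partial>lborel)"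
  proof -
    have "\<psi> (norm x) * cis (- 2 * pi * (\<xi> \<bullet> x)) + \<psi> (norm x) * cis (2 * pi * (\<xi> \<bullet> x))
      = 2 * (of_real (cos (2 * pi * (\<xi> \<bullet> x))) * \<psi> (norm x))" for x
      by (simp add: complex_eq_iff algebra_simps)
    then show ?thesis
      by (subst Bochner_Integration.integral_add[OF int int, symmetric]) (simp only:)
  qed
  also have "\<dots> = 2 * (\<integral>x. of_real (cos (2 * pi * (\<xi> \<bullet> x))) * \<psi> (norm x) \<partial>lborel)"
    by simp
  finally have I: "?I = (\<integral>x. of_real (cos (2 * pi * (\<xi> \<bullet> x))) * \<psi> (norm x) \<partial>lborel)" by simp
  define c where "c k = (- 1) ^ k / fact (2 * k) * (2 * pi) ^ (2 * k)" for k
  define f where "f k x = c k *\<^sub>R ((\<xi> \<bullet> x) ^ (2 * k) *\<^sub>R \<psi> (norm x))" for k x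
  have f_sums: "(\<lambda>k. f k x) sums (of_real (cos (2 * pi * (\<xi> \<bullet> x))) * \<psi> (norm x))" for x
  proof -
    have "(\<lambda>k. of_real ((- 1) ^ k / fact (2 * k) * (2 * pi * (\<xi> \<bullet> x)) ^ (2 * k)) * \<psi> (norm x)) sums
       (of_real (cos (2 * pi * (\<xi> \<bullet> x))) * \<psi> (norm x))"
      by (intro sums_mult2 sums_of_real cos_paired)
    then show ?thesis by (simp add: f_def c_def scaleR_conv_of_real power_mult_distrib mult_ac)
  qed
  \<comment> \<open>These bounds sum to cosh(2 pi |\<xi>| \<rho>) times the norm of the radial
    function, an integrable majorant for exchanging sum and integral.\<close>
  have bound: "norm (f k x) \<le> (2 * pi * norm \<xi> * \<rho>) ^ (2 * k) / fact (2 * k) * norm (\<psi> (norm x))" for k x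
  proof (cases "norm x \<le> \<rho>")
    case True
    have "\<bar>\<xi> \<bullet> x\<bar> \<le> norm \<xi> * \<rho>"
      using Cauchy_Schwarz_ineq2[of \<xi> x] mult_left_mono[OF True, of "norm \<xi>"] by simp
    then have "\<bar>\<xi> \<bullet> x\<bar> ^ (2 * k) \<le> (norm \<xi> * \<rho>) ^ (2 * k)" by (intro power_mono) auto
    then have "(2 * pi) ^ (2 * k) / fact (2 * k) * \<bar>\<xi> \<bullet> x\<bar> ^ (2 * k) \<le> (2 * pi) ^ (2 * k) / fact (2 * k) * (norm \<xi> * \<rho>) ^ (2 * k)"
      by (intro mult_left_mono) auto
    from mult_right_mono[OF this, of "norm (\<psi> (norm x))"] show ?thesis
      by (simp add: f_def c_def abs_mult power_mult_distrib mult_ac power_abs)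
  next
    case False
    then show ?thesis using supp[of "norm x"] by (simp add: f_def)
  qed
  have intf: "integrable lborel (f k)" for k
  proof (rule Bochner_Integration.integrable_bound)
    show "integrable lborel (\<lambda>x::'a. (2 * pi * norm \<xi> * \<rho>) ^ (2 * k) / fact (2 * k) * norm (\<psi> (norm x)))"
      by (intro integrable_mult_right integrable_norm integrable_psi)
    show "f k \<in> borel_measurable lborel" unfolding f_def by measurable
    show "AE x in lborel. norm (f k x) \<le> norm ((2 * pi * norm \<xi> * \<rho>) ^ (2 * k) / fact (2 * k) * norm (\<psi> (norm x)))"
      unfolding real_norm_def by (intro AE_I2 order_trans[OF bound abs_ge_self])
  qed
  have sm: "summable (\<lambda>k. (2 * pi * norm \<xi> * \<rho>) ^ (2 * k) / fact (2 * k) * y)" for y :: real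
    by (intro summable_mult2 sums_summable[OF cosh_paired])
  have "(\<lambda>k. integral\<^sup>L lborel (f k)) sums (\<integral>x. (\<Sum>k. f k x) \<partial>lborel)"
  proof (rule sums_integral)
    show "AE x in lborel. summable (\<lambda>k. norm (f k x))"
      by (intro AE_I2 summable_comparison_test'[OF sm]) (use bound in auto)
    show "summable (\<lambda>k. \<integral>x. norm (f k x) \<partial>lborel)"
    proof (rule summable_comparison_test'[OF sm])
      fix k
      have "(\<integral>x. norm (f k x) \<partial>lborel) \<le> (\<integral>x. (2 * pi * norm \<xi> * \<rho>) ^ (2 * k) / fact (2 * k) * norm (\<psi> (norm (x::'a))) \<partial>lborel)"
        by (intro integral_mono integrable_norm intf integrable_mult_right integrable_psi bound)
      then show "norm (\<integral>x. norm (f k x) \<partial>lborel) \<le> (2 * pi * norm \<xi> * \<rho>) ^ (2 * k) / fact (2 * k) * (\<integral>x. norm (\<psi> (norm (x::'a))) \<partial>lborel)"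
        by simp
    qed
  qed (rule intf)
  moreover have "(\<integral>x. (\<Sum>k. f k x) \<partial>lborel) = ?I"
    unfolding I using f_sums by (simp add: sums_iff)
  moreover have "integral\<^sup>L lborel (f k) = profile_coeff d \<psi> k * of_real ((norm \<xi>)\<^sup>2) ^ k" for k
  proof -
    have "integral\<^sup>L lborel (f k) = c k *\<^sub>R (\<integral>x. (\<xi> \<bullet> x) ^ (2 * k) *\<^sub>R \<psi> (norm x) \<partial>lborel)"
      unfolding f_def by (rule integral_scaleR_right)
    also have "\<dots> = c k *\<^sub>R (\<integral>t. (sphere_moment k \<xi> * t ^ (DIM('a) + 2 * k - 1) * indicator {0..} t) *\<^sub>R \<psi> t \<partial>lborel)"
      by (subst integral_polar) auto
    also have "(\<integral>t. (sphere_moment k \<xi> * t ^ (DIM('a) + 2 * k - 1) * indicator {0..} t) *\<^sub>R \<psi> t \<partial>lborel)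
       = sphere_moment k \<xi> *\<^sub>R radial_moment (d + 2 * k - 1) \<psi>"
      unfolding radial_moment_def dim
      by (subst integral_scaleR_right[symmetric]) (auto simp: mult.assoc)
    also have "c k *\<^sub>R \<dots> = of_real (c k * sphere_moment k \<xi>) * radial_moment (d + 2 * k - 1) \<psi>"
      by (simp add: scaleR_conv_of_real)
    also have "c k * sphere_moment k \<xi> = ((- 1) ^ k * 2 * pi powr (real d / 2) * pi ^ (2 * k) /
     (fact k * Gamma (real d / 2 + real k))) * ((norm \<xi>)\<^sup>2) ^ k"
    proof -
      have "(2 * pi) ^ (2 * k) = 4 ^ k * pi ^ (2 * k)" by (simp add: power_mult power_mult_distrib)
      then show ?thesis
        using Gamma_half_dim_pos[of k]
        unfolding c_def sphere_moment_eq dim[symmetric] power_mult[of "norm \<xi>"] by simp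
    qed
    finally show ?thesis by (simp add: profile_coeff_def)
  qed
  ultimately show ?thesis by simp
qed

end

context radial_function
begin

text \<open>With \<nu> = d/2 - 1, the division by s^(\<nu>/2) cancels the power of s in front of the
  Bessel series, and the powers of t combine to \<nu> + d/2 = d - 1. What remains is a series in s
  whose constant term is the value prescribed at s = 0.\<close>

lemma bessel_Lambda_series:
  assumes t: "t > 0" and s: "s \<ge> 0"
  shows "bessel_Lambda (real d / 2 - 1) t s * t powr (real d / 2) =
    (\<Sum>k. (- 1) ^ k * pi powr (real d / 2 - 1) * pi ^ (2 * k) / (fact k * Gamma (real d / 2 + real k)) * s ^ k * t ^ (d + 2 * k - 1))"
proof -
  let ?\<nu> = "real d / 2 - 1"
  define g where "g k = (- 1) ^ k / (fact k * Gamma (real d / 2 + real k))" for k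
  have G: "Gamma (real k + ?\<nu> + 1) = Gamma (real d / 2 + real k)" for k by (simp add: add.commute)
  \<comment> \<open>\<open>rpow\<close> and \<open>powr\<close> differ only at base 0 with exponent
    0, an exponent that occurs for d = 2; a positive base avoids the difference.\<close>
  have rp: "rpow y ?\<nu> = y powr ?\<nu>" if "y > 0" for y using that by (simp add: rpow_def)
  have pow: "(pi * t) powr ?\<nu> * t powr (real d / 2) = pi powr ?\<nu> * t ^ (d - 1)"
  proof -
    have "t powr ?\<nu> * t powr (real d / 2) = t powr real (d - 1)"
      using dim_pos by (subst powr_add[symmetric]) (simp add: of_nat_diff)
    then show ?thesis using t by (simp add: powr_mult powr_realpow)
  qed
  have sm: "summable (\<lambda>k. g k * X ^ k)" for X
  proof -
    have "g k * X ^ k = (- X) ^ k / (fact k * Gamma (real d / 2 + real k))" for k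
      by (simp add: g_def power_minus[of X])
    then show ?thesis using summable_bessel[OF half_dim, of "- X"] by simp
  qed
  have L: "bessel_Lambda ?\<nu> t s = (pi * t) powr ?\<nu> * (\<Sum>k. g k * (pi\<^sup>2 * t\<^sup>2 * s) ^ k)"
  proof (cases "s = 0")
    case True
    have "(\<Sum>k. g k * (pi\<^sup>2 * t\<^sup>2 * s) ^ k) = (\<Sum>k\<in>{0}. g k * (pi\<^sup>2 * t\<^sup>2 * s) ^ k)"
      by (intro suminf_finite) (auto simp: True)
    also have "\<dots> = 1 / Gamma (?\<nu> + 1)" using G[of 0] by (simp add: g_def)
    finally show ?thesis using True t by (simp add: bessel_Lambda_def rp)
  next
    case False
    with s have "s > 0" by simp
    have half: "2 * pi * t * sqrt s / 2 = pi * t * sqrt s" by simp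
    have "(pi * t * sqrt s) ^ (2 * k) = (pi\<^sup>2 * t\<^sup>2 * s) ^ k" for k
      using \<open>s > 0\<close> by (simp add: power_mult power_mult_distrib)
    then have "bessel_J ?\<nu> (2 * pi * t * sqrt s) = (pi * t * sqrt s) powr ?\<nu> * (\<Sum>k. g k * (pi\<^sup>2 * t\<^sup>2 * s) ^ k)"
      unfolding bessel_J_def half G using t \<open>s > 0\<close> by (simp add: rp g_def)
    moreover have "(pi * t * sqrt s) powr ?\<nu> = (pi * t) powr ?\<nu> * s powr (?\<nu> / 2)"
      using t \<open>s > 0\<close> by (simp add: powr_mult powr_half_sqrt[symmetric] powr_powr)
    ultimately show ?thesis using \<open>s > 0\<close> by (simp add: bessel_Lambda_def)
  qed
  have "bessel_Lambda ?\<nu> t s * t powr (real d / 2) = (\<Sum>k. g k * (pi\<^sup>2 * t\<^sup>2 * s) ^ k) * (pi powr ?\<nu> * t ^ (d - 1))"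
    unfolding L pow[symmetric] by (simp add: mult_ac)
  also have "\<dots> = (\<Sum>k. g k * (pi\<^sup>2 * t\<^sup>2 * s) ^ k * (pi powr ?\<nu> * t ^ (d - 1)))"
    by (rule suminf_mult2[OF sm])
  also have "\<dots> = (\<Sum>k. (- 1) ^ k * pi powr ?\<nu> * pi ^ (2 * k) / (fact k * Gamma (real d / 2 + real k)) * s ^ k * t ^ (d + 2 * k - 1))"
  proof (intro suminf_cong)
    fix k
    have "d + 2 * k - 1 = (d - 1) + 2 * k" using dim_pos by simp
    then have "t ^ (d + 2 * k - 1) = (t\<^sup>2) ^ k * t ^ (d - 1)" by (simp only: power_add power_mult mult.commute[of "t ^ (d - 1)"])
    then show "g k * (pi\<^sup>2 * t\<^sup>2 * s) ^ k * (pi powr ?\<nu> * t ^ (d - 1)) =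
      (- 1) ^ k * pi powr ?\<nu> * pi ^ (2 * k) / (fact k * Gamma (real d / 2 + real k)) * s ^ k * t ^ (d + 2 * k - 1)"
      by (simp add: g_def power_mult_distrib power_mult)
  qed
  finally show ?thesis .
qed

text \<open>Expanding the Bessel kernel in powers of s gives the coefficients already found for the
  Fourier transform in powers of |\<xi>|^2. The identity of transform and profile is thus a
  comparison of coefficients.\<close>

lemma radial_profile_sums:
  assumes s: "s \<ge> 0" and ae: "AE t in lborel. t \<ge> 0 \<longrightarrow> \<phi> t = \<psi> t"
  shows "(\<lambda>k. profile_coeff d \<psi> k * of_real s ^ k) sums radial_profile d \<phi> s"
proof -
  define b where "b k = (- 1) ^ k * pi powr (real d / 2 - 1) * pi ^ (2 * k) / (fact k * Gamma (real d / 2 + real k)) * s ^ k" for k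
  define C where "C k = pi powr (real d / 2 - 1) * (pi\<^sup>2 * \<rho>\<^sup>2 * s) ^ k / (fact k * Gamma (real d / 2 + real k))" for k
  let ?w = "\<lambda>n t. (t ^ n * indicator {0..} t) *\<^sub>R \<psi> t"
  define f where "f k t = b k *\<^sub>R ?w (d + 2 * k - 1) t" for k t
  have smC: "summable (\<lambda>k. C k * y)" for y
  proof -
    have "summable (\<lambda>k. pi powr (real d / 2 - 1) * ((pi\<^sup>2 * \<rho>\<^sup>2 * s) ^ k / (fact k * Gamma (real d / 2 + real k))) * y)"
      by (intro summable_mult summable_mult2 summable_bessel half_dim)
    then show ?thesis by (simp add: C_def)
  qed
  have bC: "\<bar>b k\<bar> * \<rho> ^ (2 * k) = C k" for k
    using s Gamma_half_dim_pos[of k] by (simp add: b_def C_def abs_mult power_mult power_mult_distrib)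
  have bound: "norm (f k t) \<le> C k * norm (?w (d - 1) t)" for k t
  proof -
    have "norm (f k t) \<le> \<bar>b k\<bar> * (\<rho> ^ (2 * k) * norm (?w (d - 1) t))"
      unfolding f_def norm_scaleR[of "b k"] by (intro mult_left_mono norm_moment_le) auto
    then show ?thesis by (simp add: bC[symmetric] mult.assoc)
  qed
  have intf: "integrable lborel (f k)" for k
    unfolding f_def by (intro integrable_scaleR_right integrable_moment)
  have f_ae: "AE t in lborel. indicator {0..} t *\<^sub>R (\<phi> t * of_real (bessel_Lambda (real d / 2 - 1) t s * t powr (real d / 2))) = (\<Sum>k. f k t)"
    \<comment> \<open>The point t = 0 is removed because the series formula holds for t > 0 and
      \<open>bessel_Lambda\<close> may take a junk value at 0.\<close>
    using ae AE_lborel_singleton[of "0::real"]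
  proof eventually_elim
    case (elim t)
    show ?case
    proof (cases "t > 0")
      case True
      have sm: "summable (\<lambda>k. b k * t ^ (d + 2 * k - 1))"
      proof (rule summable_comparison_test'[OF summable_mult2[OF summable_mult[OF summable_bessel[OF half_dim, of "pi\<^sup>2 * t\<^sup>2 * s"]], of "pi powr (real d / 2 - 1)" "t ^ (d - 1)"]])
        fix k
        have "d + 2 * k - 1 = (d - 1) + 2 * k" using dim_pos by simp
        then have "t ^ (d + 2 * k - 1) = (t\<^sup>2) ^ k * t ^ (d - 1)" by (simp only: power_add power_mult mult.commute[of "t ^ (d - 1)"])
        then show "norm (b k * t ^ (d + 2 * k - 1)) \<le> pi powr (real d / 2 - 1) * ((pi\<^sup>2 * t\<^sup>2 * s) ^ k / (fact k * Gamma (real d / 2 + real k))) * t ^ (d - 1)"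
          using True s Gamma_half_dim_pos[of k] unfolding b_def power_mult[of pi]
          by (simp add: abs_mult power_mult_distrib mult_ac)
      qed
      have "(\<Sum>k. f k t) = (\<Sum>k. of_real (b k * t ^ (d + 2 * k - 1)) * \<psi> t)"
        using True by (intro suminf_cong) (simp add: f_def scaleR_conv_of_real)
      also have "\<dots> = of_real (\<Sum>k. b k * t ^ (d + 2 * k - 1)) * \<psi> t"
        by (intro sums_unique[symmetric] sums_mult2 sums_of_real summable_sums sm)
      also have "(\<Sum>k. b k * t ^ (d + 2 * k - 1)) = bessel_Lambda (real d / 2 - 1) t s * t powr (real d / 2)"
        unfolding bessel_Lambda_series[OF True s] b_def ..
      finally show ?thesis using True elim by simp
    next
      case False
      with elim have "t < 0" by simp
      then show ?thesis by (simp add: f_def)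
    qed
  qed
  have meas: "(\<lambda>t. \<Sum>k. f k t) \<in> borel_measurable borel"
    unfolding f_def by measurable
  have "radial_profile d \<phi> s = 2 * of_real pi * (\<integral>t. (\<Sum>k. f k t) \<partial>lborel)"
    unfolding radial_profile_def set_lebesgue_integral_def integral_lebesgue_AE[OF meas f_ae] ..
  moreover have "(\<lambda>k. integral\<^sup>L lborel (f k)) sums (\<integral>t. (\<Sum>k. f k t) \<partial>lborel)"
  proof (rule sums_integral)
    show "AE t in lborel. summable (\<lambda>k. norm (f k t))"
      by (intro AE_I2 summable_comparison_test'[OF smC]) (use bound in auto)
    show "summable (\<lambda>k. \<integral>t. norm (f k t) \<partial>lborel)"
    proof (rule summable_comparison_test'[OF smC])
      fix k
      have "(\<integral>t. norm (f k t) \<partial>lborel) \<le> (\<integral>t. C k * norm (?w (d - 1) t) \<partial>lborel)"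
        by (intro integral_mono integrable_norm intf integrable_mult_right integrable_moment_0 bound)
      then show "norm (\<integral>t. norm (f k t) \<partial>lborel) \<le> C k * (\<integral>t. norm (?w (d - 1) t) \<partial>lborel)"
        by simp
    qed
  qed (rule intf)
  ultimately have "(\<lambda>k. 2 * of_real pi * integral\<^sup>L lborel (f k)) sums radial_profile d \<phi> s"
    by (simp add: sums_mult)
  moreover have "2 * of_real pi * integral\<^sup>L lborel (f k) = profile_coeff d \<psi> k * of_real s ^ k" for k
  proof -
    have "integral\<^sup>L lborel (f k) = b k *\<^sub>R radial_moment (d + 2 * k - 1) \<psi>"
      unfolding f_def radial_moment_def by (rule integral_scaleR_right)
    then have "2 * of_real pi * integral\<^sup>L lborel (f k) = of_real (2 * pi * b k) * radial_moment (d + 2 * k - 1) \<psi>"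
      by (simp add: scaleR_conv_of_real)
    \<comment> \<open>The Bessel order d/2 - 1 leaves one power of pi missing; the factor 2 pi in
      front of the profile supplies it.\<close>
    also have "pi powr (real d / 2) = pi * pi powr (real d / 2 - 1)"
      by (subst powr_mult_base[of pi]) simp_all
    then have "2 * pi * b k = ((- 1) ^ k * 2 * pi powr (real d / 2) * pi ^ (2 * k) / (fact k * Gamma (real d / 2 + real k))) * s ^ k"
      by (simp add: b_def)
    finally show ?thesis by (simp add: profile_coeff_def mult_ac)
  qed
  ultimately show ?thesis by simp
qed

end

section \<open>The profile as an entire function and its derivatives\<close>

definition entire_deriv :: "(nat \<Rightarrow> complex) \<Rightarrow> nat \<Rightarrow> real \<Rightarrow> complex" where
  "entire_deriv a j s = (\<Sum>k. (diffs ^^ j) a k * of_real s ^ k)"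

lemma summable_diffs_funpow:
  fixes a :: "nat \<Rightarrow> complex"
  assumes "\<And>z. summable (\<lambda>k. a k * z ^ k)"
  shows "summable (\<lambda>k. (diffs ^^ j) a k * z ^ k)"
proof (induction j arbitrary: z)
  case (Suc j)
  then show ?case using termdiff_converges_all[of "(diffs ^^ j) a" z] by simp
qed (use assms in simp)

lemma entire_deriv_has_vector_derivative:
  assumes "\<And>z. summable (\<lambda>k. a k * z ^ k)"
  shows "(entire_deriv a j has_vector_derivative entire_deriv a (Suc j) s) (at s within S)"
proof -
  have "((\<lambda>z. \<Sum>k. (diffs ^^ j) a k * z ^ k) has_field_derivative (\<Sum>k. diffs ((diffs ^^ j) a) k * of_real s ^ k)) (at (of_real s))"
    by (intro termdiffs_strong_converges_everywhere summable_diffs_funpow assms)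
  then have "(entire_deriv a j has_vector_derivative entire_deriv a (Suc j) s) (at s)"
    unfolding entire_deriv_def by (auto dest: has_vector_derivative_real_field)
  then show ?thesis by (rule has_vector_derivative_at_within)
qed

text \<open>By induction the iterated derivative coincides on the half-line with an entire function,
  whose two-sided derivative is also the one-sided one. Values of \<open>g\<close> at negative
  arguments never enter.\<close>

lemma nth_deriv_halfline_entire:
  assumes a: "\<And>z. summable (\<lambda>k. a k * z ^ k)" and g: "\<And>s. s \<ge> 0 \<Longrightarrow> g s = entire_deriv a 0 s" and "s \<ge> 0"
  shows "nth_deriv_halfline j g s = entire_deriv a j s"
  using \<open>s \<ge> 0\<close>
proof (induction j arbitrary: s)
  case 0
  then show ?case by (simp add: nth_deriv_halfline_def g)
next
  case (Suc j)
  have "(nth_deriv_halfline j g has_vector_derivative entire_deriv a (Suc j) s) (at s within {0..})"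
    by (rule has_vector_derivative_transform[OF _ _ entire_deriv_has_vector_derivative[OF a]])
       (use Suc in auto)
  \<comment> \<open>At s = 0 only a right neighborhood is available; that it is nontrivial is what
    makes the one-sided derivative unique.\<close>
  moreover have "at s within {0..} \<noteq> bot"
  proof -
    have "at_right s \<le> at s within {0..}" using Suc.prems by (intro at_le) auto
    then show ?thesis by (metis bot.extremum_uniqueI trivial_limit_at_right_real)
  qed
  ultimately show ?case
    by (auto simp: nth_deriv_halfline_def vector_derivative_within)
qed

section \<open>The integer lattice and its fundamental cell\<close>

text \<open>The inner product is symmetric, so either argument may be read as the frequency; both
  readings occur below.\<close>

definition wave :: "real ^ 'n \<Rightarrow> real ^ 'n \<Rightarrow> complex" where
  "wave y x = cis (2 * pi * (y \<bullet> x))"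

lemma cnj_measurable [measurable]: "cnj \<in> borel_measurable borel"
  by (intro borel_measurable_continuous_onI continuous_intros)

lemma wave_measurable [measurable]: "wave y \<in> borel_measurable borel"
  unfolding wave_def by measurable

lemma continuous_on_wave [continuous_intros]: "continuous_on S (wave y)"
  unfolding wave_def by (intro continuous_intros)

lemma norm_wave [simp]: "norm (wave y x) = 1"
  by (simp add: wave_def)

lemma wave_0 [simp]: "wave 0 x = 1" "wave x 0 = 1"
  by (simp_all add: wave_def)

lemma wave_add: "wave (y + z) x = wave y x * wave z x" "wave y (x + u) = wave y x * wave y u"
  by (simp_all add: wave_def inner_simps cis_mult algebra_simps)

lemma wave_minus: "wave (- y) x = cnj (wave y x)" "wave y (- x) = cnj (wave y x)"
  by (simp_all add: wave_def cis_cnj)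

lemma wave_cnj_mult [simp]: "wave y x * cnj (wave y x) = 1"
  by (simp add: wave_def cis_cnj cis_mult)

lemma int_lattice_add: "m \<in> int_lattice \<Longrightarrow> n \<in> int_lattice \<Longrightarrow> m + n \<in> int_lattice"
  and int_lattice_diff: "m \<in> int_lattice \<Longrightarrow> n \<in> int_lattice \<Longrightarrow> m - n \<in> int_lattice"
  and int_lattice_uminus: "m \<in> int_lattice \<Longrightarrow> - m \<in> int_lattice"
  and int_lattice_0: "0 \<in> int_lattice"
  by (auto simp: int_lattice_def)

lemma int_lattice_axis: "axis i 1 \<in> int_lattice"
  by (auto simp: int_lattice_def axis_def)

lemma wave_int_lattice: "m \<in> int_lattice \<Longrightarrow> n \<in> int_lattice \<Longrightarrow> wave m n = 1"
proof -
  assume "m \<in> int_lattice" "n \<in> int_lattice"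
  then have "m \<bullet> n \<in> \<int>" by (auto simp: inner_vec_def int_lattice_def)
  then show ?thesis by (auto simp: wave_def cis.ctr complex_eq_iff sin_integer_2pi cos_integer_2pi elim!: Ints_cases)
qed

lemma finite_vec_coordinates: "finite S \<Longrightarrow> finite {v :: 'a ^ 'n. \<forall>i. v $ i \<in> S}"
proof -
  assume "finite S"
  have "{v :: 'a ^ 'n. \<forall>i. v $ i \<in> S} \<subseteq> (\<lambda>f. \<chi> i. f i) ` (PiE UNIV (\<lambda>_. S))"
  proof
    fix v :: "'a ^ 'n" assume "v \<in> {v. \<forall>i. v $ i \<in> S}"
    then show "v \<in> (\<lambda>f. \<chi> i. f i) ` (PiE UNIV (\<lambda>_. S))"
      by (intro image_eqI[of _ _ "\<lambda>i. v $ i"]) auto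
  qed
  then show ?thesis by (rule finite_subset) (simp add: finite_PiE \<open>finite S\<close>)
qed

lemma finite_int_lattice_norm_le: "finite {m \<in> (int_lattice :: (real ^ 'n) set). norm m \<le> r}"
proof (rule finite_subset)
  let ?S = "real_of_int ` {- \<lceil>r\<rceil>..\<lceil>r\<rceil>}"
  show "{m \<in> (int_lattice :: (real ^ 'n) set). norm m \<le> r} \<subseteq> {v. \<forall>i. v $ i \<in> ?S}"
  proof clarify
    fix m :: "real ^ 'n" and i
    assume m: "m \<in> int_lattice" "norm m \<le> r"
    then obtain k where k: "m $ i = real_of_int k" by (auto simp: int_lattice_def elim!: Ints_cases)
    have "\<bar>real_of_int k\<bar> \<le> r" using component_le_norm_cart[of m i] m k by simp
    then have "k \<in> {- \<lceil>r\<rceil>..\<lceil>r\<rceil>}" by (auto simp: abs_le_iff) linarith+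
    then show "m $ i \<in> ?S" using k by simp
  qed
qed (intro finite_vec_coordinates, simp)

text \<open>A crude radius of the cell. It is the origin of the summand \<open>CARD('n)\<close> in
  the radii of the finite lattice sums below.\<close>

lemma norm_torus_le: "x \<in> torus \<Longrightarrow> norm (x :: real ^ 'n) \<le> real CARD('n)"
proof -
  assume x: "x \<in> torus"
  have "norm x \<le> (\<Sum>i\<in>UNIV. \<bar>x $ i\<bar>)" by (rule norm_le_l1_cart)
  also have "\<dots> \<le> (\<Sum>i\<in>(UNIV :: 'n set). 1)"
  proof (rule sum_mono)
    fix i
    have "- 1 / 2 < x $ i" "x $ i \<le> 1 / 2" using x by (auto simp: torus_def)
    then show "\<bar>x $ i\<bar> \<le> 1" by linarith
  qed
  finally show ?thesis by simp
qed

lemma torus_measurable [measurable]: "(torus :: (real ^ 'n) set) \<in> sets borel"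
proof -
  have "(torus :: (real ^ 'n) set) = (\<Inter>i. {x. - 1 / 2 < x $ i \<and> x $ i \<le> 1 / 2})"
    by (auto simp: torus_def)
  also have "\<dots> \<in> sets borel"
    by (intro sets.countable_INT'') (auto intro!: countable_finite)
  finally show ?thesis .
qed

text \<open>The half-open cell lies between an open and a closed cube of volume 1.\<close>

lemma emeasure_torus: "emeasure lborel (torus :: (real ^ 'n) set) = 1"
proof -
  let ?a = "(\<chi> i. - (1 / 2)) :: real ^ 'n" and ?b = "(\<chi> i. 1 / 2) :: real ^ 'n"
  have le: "?a \<bullet> j \<le> ?b \<bullet> j" if "j \<in> Basis" for j
    using that by (auto simp: Basis_vec_def inner_axis)
  have prod: "(\<Prod>j\<in>Basis. (?b - ?a) \<bullet> j) = 1"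
    by (rule prod.neutral) (auto simp: Basis_vec_def inner_axis inner_simps)
  have "emeasure lborel (box ?a ?b) = 1" using prod by (subst emeasure_lborel_box) (auto simp: le)
  moreover have "emeasure lborel (cbox ?a ?b) = 1" using prod by (subst emeasure_lborel_cbox) (auto simp: le)
  moreover have "box ?a ?b \<subseteq> torus" "torus \<subseteq> cbox ?a ?b"
    by (auto simp: torus_def box_def cbox_def Basis_vec_def inner_axis less_imp_le)
  ultimately show ?thesis
    by (metis antisym emeasure_mono sets_lborel torus_measurable borel_closed closed_cbox)
qed

text \<open>A finite substitute for the whole lattice in sums of translates of a function with
  bounded support.\<close>

definition lattice_ball :: "real \<Rightarrow> (real ^ 'n) set" where
  "lattice_ball r = {m \<in> int_lattice. norm m \<le> r}"

lemma finite_lattice_ball [simp]: "finite (lattice_ball r)"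
  unfolding lattice_ball_def by (rule finite_int_lattice_norm_le)

lemma torus_tile_exists:
  fixes x :: "real ^ 'n"
  obtains n where "n \<in> int_lattice" "x - n \<in> torus"
proof
  \<comment> \<open>The ceiling and not the floor, because the cell contains its upper faces and not
    its lower ones.\<close>
  let ?n = "(\<chi> i. real_of_int \<lceil>x $ i - 1 / 2\<rceil>) :: real ^ 'n"
  show "?n \<in> int_lattice" by (auto simp: int_lattice_def)
  have "- 1 / 2 < x $ i - real_of_int \<lceil>x $ i - 1 / 2\<rceil> \<and> x $ i - real_of_int \<lceil>x $ i - 1 / 2\<rceil> \<le> 1 / 2" for i
    by linarith
  then show "x - ?n \<in> torus" by (simp add: torus_def)
qed

lemma torus_tile_unique:
  assumes "n \<in> int_lattice" "n' \<in> int_lattice" "x - n \<in> torus" "x - n' \<in> torus"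
  shows "n = n'"
proof -
  have "n $ i = n' $ i" for i
  proof -
    have "n $ i \<in> \<int>" "n' $ i \<in> \<int>" using assms by (auto simp: int_lattice_def)
    then obtain k k' where k: "n $ i = of_int k" "n' $ i = of_int k'" by (elim Ints_cases)
    have "- 1 / 2 < x $ i - n $ i" "x $ i - n $ i \<le> 1 / 2" "- 1 / 2 < x $ i - n' $ i" "x $ i - n' $ i \<le> 1 / 2"
      using assms by (auto simp: torus_def)
    then have "k = k'" unfolding k by linarith
    then show ?thesis unfolding k by simp
  qed
  then show ?thesis by (simp add: vec_eq_iff)
qed

lemma torus_tile_sum:
  fixes x :: "real ^ 'n"
  assumes "finite N" "N \<subseteq> int_lattice" "\<And>n. n \<in> int_lattice \<Longrightarrow> x - n \<in> torus \<Longrightarrow> n \<in> N"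
  shows "(\<Sum>n\<in>N. indicator torus (x - n)) = (1 :: real)"
proof -
  obtain m where m: "m \<in> int_lattice" "x - m \<in> torus" using torus_tile_exists .
  have "(\<Sum>n\<in>N. indicator torus (x - n)) = (\<Sum>n\<in>N. if n = m then 1 else (0::real))"
    using m assms(2) torus_tile_unique by (intro sum.cong) (auto simp: indicator_def)
  then show ?thesis using m assms by simp
qed

text \<open>The translated cells tile the space. Each piece of \<open>h\<close> cut out by a cell is
  moved back to the cell at the origin; the bounded support leaves finitely many pieces, so no
  question of convergence arises.\<close>

lemma integral_unfold_torus:
  fixes h :: "real ^ 'n \<Rightarrow> 'b::{banach, second_countable_topology}"
  assumes h: "integrable lborel h" and supp: "\<And>x. norm x > r \<Longrightarrow> h x = 0"
  shows "(\<integral>x. h x \<partial>lborel) = (\<integral>x. indicator torus x *\<^sub>R (\<Sum>n\<in>lattice_ball (r + real CARD('n)). h (x + n)) \<partial>lborel)"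
proof -
  let ?N = "lattice_ball (r + real CARD('n)) :: (real ^ 'n) set"
  have [measurable]: "h \<in> borel_measurable borel" using h by auto
  have h_int: "integrable lborel (\<lambda>x. indicator torus (x - n) *\<^sub>R h x)" for n
    by (rule Bochner_Integration.integrable_bound[OF h]) (auto simp: indicator_def)
  have int_shift: "(\<integral>x. indicator torus (x - n) *\<^sub>R h x \<partial>lborel) = (\<integral>x. indicator torus x *\<^sub>R h (x + n) \<partial>lborel)" for n
    using integral_lborel_translate[of "\<lambda>x. indicator torus (x - n) *\<^sub>R h x" n] by simp
  have h_int': "integrable lborel (\<lambda>x. indicator torus x *\<^sub>R h (x + n))" for n
  proof -
    have "integrable (distr lborel borel ((+) n)) (\<lambda>x. indicator torus (x - n) *\<^sub>R h x)"
      using h_int[of n] by (simp add: lborel_distr_plus)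
    then show ?thesis by (subst (asm) integrable_distr_eq) (auto simp: add.commute)
  qed
  have "h x = (\<Sum>n\<in>?N. indicator torus (x - n) *\<^sub>R h x)" for x
  proof (cases "norm x > r")
    case False
    have "n \<in> ?N" if n: "n \<in> int_lattice" "x - n \<in> torus" for n
    proof -
      have "norm n \<le> norm x + norm (x - n)" by (metis norm_minus_commute norm_triangle_sub)
      then show ?thesis using False norm_torus_le[OF n(2)] n(1) by (simp add: lattice_ball_def)
    qed
    then have "(\<Sum>n\<in>?N. indicator torus (x - n)) = (1 :: real)"
      by (intro torus_tile_sum) (auto simp: lattice_ball_def finite_int_lattice_norm_le)
    then show ?thesis by (simp flip: scaleR_sum_left)
  qed (simp add: supp)
  then have "(\<integral>x. h x \<partial>lborel) = (\<integral>x. (\<Sum>n\<in>?N. indicator torus (x - n) *\<^sub>R h x) \<partial>lborel)" by simp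
  also have "\<dots> = (\<Sum>n\<in>?N. \<integral>x. indicator torus x *\<^sub>R h (x + n) \<partial>lborel)"
    by (subst Bochner_Integration.integral_sum) (auto simp: h_int int_shift)
  also have "\<dots> = (\<integral>x. (\<Sum>n\<in>?N. indicator torus x *\<^sub>R h (x + n)) \<partial>lborel)"
    by (subst Bochner_Integration.integral_sum) (auto simp: h_int')
  finally show ?thesis by (simp add: scaleR_sum_right)
qed

section \<open>Orthogonality of characters and Bessel's inequality\<close>

lemma integrable_torus_bounded:
  fixes g :: "real ^ 'n \<Rightarrow> 'b::{banach, second_countable_topology}"
  assumes "g \<in> borel_measurable borel" and "\<And>x. x \<in> torus \<Longrightarrow> norm (g x) \<le> B"
  shows "integrable lborel (\<lambda>x. indicator torus x *\<^sub>R g x)"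
  by (rule integrableI_bounded_set_indicator[of _ _ _ B]) (use assms in \<open>auto simp: emeasure_torus\<close>)

lemma integral_torus_1: "(\<integral>x. indicator torus x \<partial>(lborel :: (real ^ 'n) measure)) = (1 :: real)"
  by (simp add: measure_def emeasure_torus)

text \<open>
  The integral over the unit cell does not change when a character is translated,
  whereas a translation by half a period changes its sign.
\<close>

lemma integral_torus_wave:
  fixes m :: "real ^ 'n"
  assumes m: "m \<in> int_lattice" "m \<noteq> 0"
  shows "(\<integral>x. indicator torus x *\<^sub>R wave m x \<partial>lborel) = 0"
proof -
  let ?I = "\<integral>x. indicator torus x *\<^sub>R wave m x \<partial>lborel"
  obtain i where i: "m $ i \<noteq> 0" using m(2) by (auto simp: vec_eq_iff)
  \<comment> \<open>Half a period of the character in direction i: the inner product of m and a is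
    1/2.\<close>
  define a :: "real ^ 'n" where "a = axis i (1 / (2 * m $ i))"
  have "wave m a = -1" using i by (simp add: wave_def a_def inner_axis)
  define h where "h x = indicator torus (x - a) *\<^sub>R wave m x" for x
  have supp: "h x = 0" if "norm x > norm a + real CARD('n)" for x
  proof -
    have "norm x \<le> norm a + norm (x - a)" by (metis norm_triangle_sub)
    then show ?thesis using that norm_torus_le[of "x - a"] by (auto simp: h_def indicator_def)
  qed
  have [measurable]: "h \<in> borel_measurable borel" unfolding h_def by measurable
  have "(\<integral>x. h x \<partial>lborel) = (\<integral>x. h (x + a) \<partial>lborel)" by (rule integral_lborel_translate[symmetric]) simp
  also have "\<dots> = - ?I" using \<open>wave m a = -1\<close> by (simp add: h_def wave_add)
  finally have 1: "(\<integral>x. h x \<partial>lborel) = - ?I" .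
  have "integrable lborel h"
    by (rule integrableI_bounded_set[of "cball 0 (norm a + real CARD('n))" _ _ 1])
       (auto simp: emeasure_cball h_def indicator_def not_le intro!: AE_I2 dest: supp)
  then have "(\<integral>x. h x \<partial>lborel) = (\<integral>x. indicator torus x *\<^sub>R (\<Sum>n\<in>lattice_ball (norm a + real CARD('n) + real CARD('n)). h (x + n)) \<partial>lborel)"
    (is "_ = (\<integral>x. indicator torus x *\<^sub>R (\<Sum>n\<in>?N. h (x + n)) \<partial>lborel)")
    using supp by (rule integral_unfold_torus)
  also have "\<dots> = ?I"
  proof (intro Bochner_Integration.integral_cong refl)
    fix x :: "real ^ 'n"
    show "indicator torus x *\<^sub>R (\<Sum>n\<in>?N. h (x + n)) = indicator torus x *\<^sub>R wave m x"
    proof (cases "x \<in> torus")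
      case True
      have "(\<Sum>n\<in>?N. h (x + n)) = (\<Sum>n\<in>?N. indicator torus ((x - a) - - n) *\<^sub>R wave m x)"
        by (intro sum.cong) (auto simp: h_def wave_add lattice_ball_def wave_int_lattice[OF m(1)] algebra_simps)
      \<comment> \<open>The indices are negated to match \<open>torus_tile_sum\<close>, which
        subtracts lattice vectors.\<close>
      also have "\<dots> = (\<Sum>n\<in>uminus ` ?N. indicator torus ((x - a) - n) *\<^sub>R wave m x)"
        by (subst sum.reindex) (auto simp: inj_on_def)
      also have "\<dots> = (\<Sum>n\<in>uminus ` ?N. indicator torus ((x - a) - n)) *\<^sub>R wave m x"
        by (simp add: scaleR_sum_left)
      also have "(\<Sum>n\<in>uminus ` ?N. indicator torus ((x - a) - n)) = (1 :: real)"
      proof (rule torus_tile_sum)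
        fix n assume n: "n \<in> int_lattice" "x - a - n \<in> torus"
        have "norm n = norm (x - a - (x - a - n))" by simp
        also have "\<dots> \<le> norm x + norm a + norm (x - a - n)"
          by (meson norm_triangle_ineq4 order_trans add_right_mono)
        finally have "norm (- n) \<le> norm a + real CARD('n) + real CARD('n)"
          using norm_torus_le[OF True] norm_torus_le[OF n(2)] by simp
        then have "- n \<in> ?N" using n int_lattice_uminus by (simp add: lattice_ball_def)
        then show "n \<in> uminus ` ?N" by force
      next
        show "finite (uminus ` ?N)" by simp
        show "uminus ` ?N \<subseteq> int_lattice" by (auto simp: lattice_ball_def int_lattice_uminus)
      qed
      finally show ?thesis by simp
    qed simp
  qed
  finally have "- ?I = ?I" using 1 by simp
  then show ?thesis by simp
qed

lemma integrable_bounded_support: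
  fixes f :: "'a::euclidean_space \<Rightarrow> 'b::{banach, second_countable_topology}"
  assumes "f \<in> borel_measurable borel" and "\<And>x. norm (f x) \<le> B" and "\<And>x. norm x > r \<Longrightarrow> f x = 0"
  shows "integrable lborel f"
proof (rule integrableI_bounded_set[of "cball 0 r" _ _ B])
  show "emeasure lborel (cball (0::'a) r) < \<infinity>" by (rule emeasure_lborel_cball_finite)
qed (use assms in auto)

lemma integral_torus_const:
  fixes c :: "'b::{banach, second_countable_topology}"
  shows "(\<integral>x. indicator torus x *\<^sub>R c \<partial>(lborel :: (real ^ 'n) measure)) = c"
proof -
  have "integrable lborel (indicator torus :: real ^ 'n \<Rightarrow> real)"
    by (rule integrable_real_indicator) (auto simp: emeasure_torus)
  then show ?thesis by (simp add: measure_def emeasure_torus)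
qed

text \<open>A character of lattice frequency is invariant under lattice translations, so unfolding
  pulls it out of the sum. This is how the Fourier transform at m becomes a Fourier coefficient of
  the periodization.\<close>

lemma lattice_sum_integral:
  fixes f :: "real ^ 'n \<Rightarrow> complex"
  assumes f: "integrable lborel f" and supp: "\<And>x. norm x > r \<Longrightarrow> f x = 0" and m: "m \<in> int_lattice"
  shows "(\<integral>x. f x * wave (- m) x \<partial>lborel)
    = (\<integral>x. indicator torus x *\<^sub>R ((\<Sum>n\<in>lattice_ball (r + real CARD('n)). f (x + n)) * wave (- m) x) \<partial>lborel)"
proof -
  have "(\<integral>x. f x * wave (- m) x \<partial>lborel)
    = (\<integral>x. indicator torus x *\<^sub>R (\<Sum>n\<in>lattice_ball (r + real CARD('n)). f (x + n) * wave (- m) (x + n)) \<partial>lborel)"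
  proof (rule integral_unfold_torus)
    have [measurable]: "f \<in> borel_measurable borel" using f by auto
    show "integrable lborel (\<lambda>x. f x * wave (- m) x)"
      by (rule Bochner_Integration.integrable_bound[OF f]) (auto simp: norm_mult)
  qed (simp add: supp)
  also have "\<dots> = (\<integral>x. indicator torus x *\<^sub>R ((\<Sum>n\<in>lattice_ball (r + real CARD('n)). f (x + n)) * wave (- m) x) \<partial>lborel)"
    using m by (intro Bochner_Integration.integral_cong refl)
      (auto simp: wave_add wave_int_lattice int_lattice_uminus lattice_ball_def sum_distrib_right intro!: sum.cong)
  finally show ?thesis .
qed

text \<open>The integrals are the Fourier coefficients of the bounded periodization
  \<open>p\<close>. For a partial Fourier sum \<open>s\<close>, the pointwise inequality 2 Re(p
  cnj(s)) - |s|^2 \<le> |p|^2 \<le> P^2 is integrated over the cell of measure 1, which gives a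
  bound independent of the finite set.\<close>

lemma bessel_inequality_lattice:
  fixes f :: "real ^ 'n \<Rightarrow> complex"
  assumes [measurable]: "f \<in> borel_measurable borel" and B: "\<And>x. norm (f x) \<le> B"
    and supp: "\<And>x. norm x > r \<Longrightarrow> f x = 0"
  shows "\<exists>C. \<forall>F. finite F \<and> F \<subseteq> int_lattice \<longrightarrow> (\<Sum>m\<in>F. (norm (\<integral>x. f x * wave (- m) x \<partial>lborel))\<^sup>2) \<le> C"
proof -
  let ?N = "lattice_ball (r + real CARD('n)) :: (real ^ 'n) set"
  define p where "p x = (\<Sum>n\<in>?N. f (x + n))" for x
  have [measurable]: "p \<in> borel_measurable borel" unfolding p_def by measurable
  define P where "P = real (card ?N) * B"
  have P: "norm (p x) \<le> P" for x
    unfolding p_def P_def by (rule sum_norm_bound) (rule B)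
  define c where "c m = (\<integral>x. f x * wave (- m) x \<partial>lborel)" for m
  have f_int: "integrable lborel f"
    by (rule integrable_bounded_support[OF _ B supp]) auto
  have c: "c m = (\<integral>x. indicator torus x *\<^sub>R (p x * wave (- m) x) \<partial>lborel)" if "m \<in> int_lattice" for m
    unfolding c_def p_def by (rule lattice_sum_integral[OF f_int supp that])
  have int1: "integrable lborel (\<lambda>x. indicator torus x *\<^sub>R (p x * g x))"
    if "g \<in> borel_measurable borel" "\<And>x. norm (g x) \<le> G" for g and G :: real
    by (rule integrable_torus_bounded[of _ "P * G"])
       (use that P in \<open>auto simp: norm_mult intro!: mult_mono order_trans[OF norm_ge_zero P]\<close>)
  have "(\<Sum>m\<in>F. (norm (c m))\<^sup>2) \<le> P\<^sup>2" if F: "finite F" "F \<subseteq> int_lattice" for F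
  proof -
    define s where "s x = (\<Sum>m\<in>F. c m * wave m x)" for x
    have [measurable]: "s \<in> borel_measurable borel" unfolding s_def by measurable
    have s_bd: "norm (s x) \<le> (\<Sum>m\<in>F. norm (c m))" for x
      unfolding s_def by (rule order_trans[OF norm_sum]) (simp add: norm_mult)
    have ps: "(\<integral>x. indicator torus x *\<^sub>R (p x * cnj (s x)) \<partial>lborel) = of_real (\<Sum>m\<in>F. (norm (c m))\<^sup>2)"
    proof -
      have "(\<integral>x. indicator torus x *\<^sub>R (p x * cnj (s x)) \<partial>lborel)
        = (\<integral>x. (\<Sum>m\<in>F. cnj (c m) * (indicator torus x *\<^sub>R (p x * wave (- m) x))) \<partial>lborel)"
        by (intro Bochner_Integration.integral_cong refl)
           (simp add: s_def sum_distrib_left scaleR_sum_right wave_minus scaleR_conv_of_real mult_ac)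
      also have "\<dots> = (\<Sum>m\<in>F. cnj (c m) * c m)"
      proof -
        have iw: "integrable lborel (\<lambda>x. indicator torus x *\<^sub>R (p x * wave (- m) x))" for m
          by (rule int1[of _ 1]) auto
        show ?thesis
          by (subst Bochner_Integration.integral_sum, intro integrable_mult_right iw, intro sum.cong refl)
             (simp only: integral_mult_right_zero c[OF subsetD[OF F(2)]])
      qed
      finally show ?thesis by (simp add: complex_norm_square mult.commute del: of_real_power)
    qed
    have orth: "(\<integral>x. indicator torus x *\<^sub>R (wave m x * cnj (wave n x)) \<partial>lborel) = (if m = n then 1 else 0)"
      if "m \<in> F" "n \<in> F" for m n
    proof (cases "m = n")
      case True
      then show ?thesis using integral_torus_const[of "1::complex"] by simp
    next
      case False
      have "wave m x * cnj (wave n x) = wave (m - n) x" for x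
        using wave_add(1)[of m "- n" x] by (simp add: wave_minus)
      then show ?thesis using False F that integral_torus_wave[of "m - n"] by (auto simp: int_lattice_diff subset_iff)
    qed
    have ss: "(\<integral>x. indicator torus x *\<^sub>R (s x * cnj (s x)) \<partial>lborel) = of_real (\<Sum>m\<in>F. (norm (c m))\<^sup>2)"
    proof -
      have "(\<integral>x. indicator torus x *\<^sub>R (s x * cnj (s x)) \<partial>lborel)
        = (\<integral>x. (\<Sum>m\<in>F. \<Sum>n\<in>F. (c m * cnj (c n)) * (indicator torus x *\<^sub>R (wave m x * cnj (wave n x)))) \<partial>lborel)"
        by (intro Bochner_Integration.integral_cong refl)
           (simp add: s_def sum_product sum_distrib_left scaleR_conv_of_real mult_ac, rule sum.swap)
      also have "\<dots> = (\<Sum>m\<in>F. \<Sum>n\<in>F. (c m * cnj (c n)) * (if m = n then 1 else 0))"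
      proof -
        have int2: "integrable lborel (\<lambda>x. indicator torus x *\<^sub>R (wave m x * cnj (wave n x)))" for m n :: "real ^ 'n"
          by (rule integrable_torus_bounded[of _ 1]) (auto simp: norm_mult)
        show ?thesis
          by (subst Bochner_Integration.integral_sum, intro Bochner_Integration.integrable_sum integrable_mult_right int2,
              intro sum.cong refl, subst Bochner_Integration.integral_sum, intro integrable_mult_right int2,
              intro sum.cong refl, simp only: integral_mult_right_zero orth)
      qed
      also have "\<dots> = (\<Sum>m\<in>F. c m * cnj (c m))" using F by (simp add: sum.delta if_distrib cong: if_cong)
      finally show ?thesis by (simp add: complex_norm_square del: of_real_power)
    qed
    let ?S = "\<Sum>m\<in>F. (norm (c m))\<^sup>2"
    have ints: "integrable lborel (\<lambda>x. indicator torus x *\<^sub>R (s x * cnj (s x)))"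
      by (rule integrable_torus_bounded[of _ "(\<Sum>m\<in>F. norm (c m)) * (\<Sum>m\<in>F. norm (c m))"])
         (auto simp: norm_mult intro!: mult_mono s_bd sum_nonneg)
    have intp: "integrable lborel (\<lambda>x. indicator torus x *\<^sub>R (p x * cnj (s x)))"
      by (rule int1[of _ "\<Sum>m\<in>F. norm (c m)"]) (auto simp: s_bd)
    have "(\<integral>x. indicator torus x *\<^sub>R (norm (s x))\<^sup>2 \<partial>lborel) = Re (\<integral>x. indicator torus x *\<^sub>R (s x * cnj (s x)) \<partial>lborel)"
      by (subst integral_Re[OF ints, symmetric]) (simp add: complex_mult_cnj cmod_power2)
    also have "\<dots> = ?S" unfolding ss by simp
    finally have 1: "(\<integral>x. indicator torus x *\<^sub>R (norm (s x))\<^sup>2 \<partial>lborel) = ?S" .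
    have 2: "(\<integral>x. indicator torus x *\<^sub>R Re (p x * cnj (s x)) \<partial>lborel) = ?S"
      using integral_Re[OF intp] unfolding ps by simp
    have ints': "integrable lborel (\<lambda>x. indicator torus x *\<^sub>R (norm (s x))\<^sup>2)"
      using integrable_Re[OF ints] by (simp add: complex_mult_cnj cmod_power2)
    have intp': "integrable lborel (\<lambda>x. indicator torus x *\<^sub>R Re (p x * cnj (s x)))"
      using integrable_Re[OF intp] by simp
    \<comment> \<open>Orthogonality gives the two integrals the same value, so the left-hand side is
      again the sum of squares.\<close>
    have "2 * ?S - ?S = (\<integral>x. 2 * (indicator torus x *\<^sub>R Re (p x * cnj (s x))) - indicator torus x *\<^sub>R (norm (s x))\<^sup>2 \<partial>lborel)"
      by (subst Bochner_Integration.integral_diff) (auto simp only: 1 2 integral_mult_right_zero ints' intro!: intp' integrable_mult_right)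
    also have "\<dots> \<le> (\<integral>x. indicator torus x *\<^sub>R P\<^sup>2 \<partial>(lborel :: (real ^ 'n) measure))"
    proof (rule integral_mono)
      show "integrable lborel (\<lambda>x. 2 * (indicator torus x *\<^sub>R Re (p x * cnj (s x))) - indicator torus x *\<^sub>R (norm (s x))\<^sup>2)"
        by (intro Bochner_Integration.integrable_diff integrable_mult_right intp' ints')
      show "integrable lborel (\<lambda>x. indicator (torus :: (real ^ 'n) set) x *\<^sub>R P\<^sup>2)"
        by (rule integrable_torus_bounded[of _ "P\<^sup>2"]) auto
      fix x
      have "Re (p x * cnj (s x)) \<le> norm (p x) * norm (s x)"
        using complex_Re_le_cmod[of "p x * cnj (s x)"] by (simp add: norm_mult)
      moreover have "2 * (norm (p x) * norm (s x)) - (norm (s x))\<^sup>2 \<le> (norm (p x))\<^sup>2"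
        using zero_le_power2[of "norm (p x) - norm (s x)"] by (simp add: power2_diff)
      moreover have "(norm (p x))\<^sup>2 \<le> P\<^sup>2" using P by (intro power_mono) auto
      ultimately have "2 * Re (p x * cnj (s x)) - (norm (s x))\<^sup>2 \<le> P\<^sup>2" by linarith
      then show "2 * (indicator torus x *\<^sub>R Re (p x * cnj (s x))) - indicator torus x *\<^sub>R (norm (s x))\<^sup>2 \<le> indicator torus x *\<^sub>R P\<^sup>2"
        by (simp add: indicator_def)
    qed
    also have "\<dots> = P\<^sup>2" by (rule integral_torus_const)
    finally show ?thesis by simp
  qed
  then show ?thesis unfolding c_def by blast
qed

section \<open>Poisson summation\<close>

text \<open>The mean of cos^2(pi y_i) over the coordinates. On the cell it equals 1 at the origin
  only, and as an average it involves no frequencies besides 0 and the unit vectors with either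
  sign.\<close>

definition torus_kernel :: "real ^ 'n \<Rightarrow> real" where
  "torus_kernel y = (\<Sum>i\<in>UNIV. (1 + cos (2 * pi * y $ i)) / (2 * real CARD('n)))"

lemma torus_kernel_nonneg: "torus_kernel y \<ge> 0"
proof -
  have "0 \<le> 1 + cos t" for t :: real using cos_ge_minus_one[of t] by linarith
  then show ?thesis unfolding torus_kernel_def by (intro sum_nonneg divide_nonneg_nonneg) auto
qed

lemma continuous_on_torus_kernel [continuous_intros]: "continuous_on S torus_kernel"
  unfolding torus_kernel_def by (intro continuous_intros) auto

lemma torus_kernel_measurable [measurable]: "torus_kernel \<in> borel_measurable borel"
  by (intro borel_measurable_continuous_onI continuous_intros)

lemma torus_kernel_0: "torus_kernel 0 = 1"
  by (simp add: torus_kernel_def)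

lemma torus_kernel_le_1: "torus_kernel (y :: real ^ 'n) \<le> 1"
proof -
  have "torus_kernel y \<le> (\<Sum>i\<in>(UNIV :: 'n set). 1 / real CARD('n))"
    unfolding torus_kernel_def
  proof (rule sum_mono)
    fix i
    have "1 + cos (2 * pi * y $ i) \<le> 2" using cos_le_one[of "2 * pi * y $ i"] by linarith
    then show "(1 + cos (2 * pi * y $ i)) / (2 * real CARD('n)) \<le> 1 / real CARD('n)"
      by (simp add: field_simps)
  qed
  then show ?thesis by simp
qed

text \<open>A nonzero coordinate makes its own cosine smaller than 1. The closed cube is used in
  place of the cell because its part away from the origin is compact.\<close>

lemma torus_kernel_less_1:
  fixes y :: "real ^ 'n"
  assumes "y \<noteq> 0" and y: "\<And>i. \<bar>y $ i\<bar> \<le> 1 / 2"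
  shows "torus_kernel y < 1"
proof -
  obtain i where i: "y $ i \<noteq> 0" using assms(1) by (auto simp: vec_eq_iff)
  have le: "(1 + cos (2 * pi * y $ j)) / (2 * real CARD('n)) \<le> 1 / real CARD('n)" for j
    using cos_le_one[of "2 * pi * y $ j"] by (simp add: field_simps)
  have "cos (2 * pi * y $ i) < 1"
  proof -
    have "cos \<bar>2 * pi * y $ i\<bar> < cos 0"
    proof (rule cos_monotone_0_pi)
      show "0 < \<bar>2 * pi * y $ i\<bar>" using i by simp
      show "\<bar>2 * pi * y $ i\<bar> \<le> pi" using y[of i] by (simp add: abs_mult)
    qed simp
    then show ?thesis by simp
  qed
  then have "(1 + cos (2 * pi * y $ i)) / (2 * real CARD('n)) < 1 / real CARD('n)"
    by (simp add: field_simps)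
  then have "torus_kernel y < (\<Sum>i\<in>(UNIV :: 'n set). 1 / real CARD('n))"
    unfolding torus_kernel_def using le by (intro sum_strict_mono_ex1) auto
  then show ?thesis by simp
qed

text \<open>Multiplication by the kernel moves a lattice frequency by at most one unit vector.
  Orthogonality to all characters therefore passes from one power of the kernel to the next by
  induction.\<close>

lemma torus_kernel_wave:
  fixes y :: "real ^ 'n"
  shows "of_real (torus_kernel y) * wave m y = (1 / 2) * wave m y
    + (\<Sum>i\<in>UNIV. of_real (1 / (4 * real CARD('n))) * (wave (m + axis i 1) y + wave (m - axis i 1) y))"
proof -
  have ax: "wave (m + axis i 1) y + wave (m - axis i 1) y = of_real (2 * cos (2 * pi * y $ i)) * wave m y" for i
  proof -
    have "wave (m + axis i 1) y + wave (m - axis i 1) y = wave m y * (wave (axis i 1) y + cnj (wave (axis i 1) y))"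
      using wave_add(1)[of m "axis i 1" y] wave_add(1)[of m "- axis i 1" y] by (simp add: wave_minus algebra_simps)
    also have "wave (axis i 1) y + cnj (wave (axis i 1) y) = of_real (2 * cos (2 * pi * y $ i))"
      by (simp add: complex_eq_iff wave_def inner_axis' mult.commute)
    finally show ?thesis by (simp add: mult.commute)
  qed
  have "of_real (torus_kernel y) * wave m y
      = of_real (\<Sum>i\<in>(UNIV :: 'n set). 1 / (2 * real CARD('n)) + 1 / (4 * real CARD('n)) * (2 * cos (2 * pi * y $ i))) * wave m y"
    unfolding torus_kernel_def by (intro arg_cong[where f="\<lambda>x. of_real x * _"] sum.cong) (auto simp: field_simps)
  also have "(\<Sum>i\<in>(UNIV :: 'n set). 1 / (2 * real CARD('n)) + 1 / (4 * real CARD('n)) * (2 * cos (2 * pi * y $ i)))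
     = 1 / 2 + (\<Sum>i\<in>(UNIV :: 'n set). 1 / (4 * real CARD('n)) * (2 * cos (2 * pi * y $ i)))"
    by (simp add: sum.distrib)
  finally show ?thesis
    unfolding ax by (simp only: of_real_add distrib_right of_real_sum sum_distrib_right of_real_mult mult.assoc) simp
qed

text \<open>
  The powers of \<^const>\<open>torus_kernel\<close> are nonnegative trigonometric polynomials that
  concentrate at the origin.
\<close>

lemma fourier_coeffs_zero_imp_zero_at_0:
  fixes g :: "real ^ 'n \<Rightarrow> complex"
  assumes [measurable]: "g \<in> borel_measurable borel" and cont: "isCont g 0"
    and B: "\<And>x. x \<in> torus \<Longrightarrow> norm (g x) \<le> B"
    and orth: "\<And>m. m \<in> int_lattice \<Longrightarrow> (\<integral>x. indicator torus x *\<^sub>R (g x * wave m x) \<partial>lborel) = 0"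
  shows "g 0 = 0"
proof (rule ccontr)
  assume g0: "g 0 \<noteq> 0"
  have zero_torus: "(0 :: real ^ 'n) \<in> torus" by (simp add: torus_def)
  have int: "integrable lborel (\<lambda>x. indicator torus x *\<^sub>R (g x * of_real (torus_kernel x ^ N) * wave m x))" for N m
    by (rule integrable_torus_bounded[of _ B])
       (auto simp: norm_mult norm_power torus_kernel_nonneg power_le_one torus_kernel_le_1 intro!: order_trans[OF mult_left_le B])
  have trig: "(\<integral>x. indicator torus x *\<^sub>R (g x * of_real (torus_kernel x ^ N) * wave m x) \<partial>lborel) = 0"
    if "m \<in> int_lattice" for N m
    using that
  proof (induction N arbitrary: m)
    case 0
    then show ?case by (simp add: orth)
  next
    case (Suc N)
    let ?w = "\<lambda>m x. indicator torus x *\<^sub>R (g x * of_real (torus_kernel x ^ N) * wave m x)"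
    have "(\<integral>x. indicator torus x *\<^sub>R (g x * of_real (torus_kernel x ^ Suc N) * wave m x) \<partial>lborel)
      = (\<integral>x. (1 / 2) * ?w m x + (\<Sum>i\<in>UNIV. of_real (1 / (4 * real CARD('n))) * (?w (m + axis i 1) x + ?w (m - axis i 1) x)) \<partial>lborel)"
    proof (intro Bochner_Integration.integral_cong refl)
      fix x :: "real ^ 'n"
      have "indicator torus x *\<^sub>R (g x * of_real (torus_kernel x ^ Suc N) * wave m x)
        = of_real (indicator torus x) * g x * of_real (torus_kernel x ^ N) * (of_real (torus_kernel x) * wave m x)"
        by (simp add: scaleR_conv_of_real)
      also have "\<dots> = (1 / 2) * ?w m x + (\<Sum>i\<in>UNIV. of_real (1 / (4 * real CARD('n))) * (?w (m + axis i 1) x + ?w (m - axis i 1) x))"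
        unfolding torus_kernel_wave by (simp add: scaleR_conv_of_real distrib_left sum_distrib_left mult_ac)
      finally show "indicator torus x *\<^sub>R (g x * of_real (torus_kernel x ^ Suc N) * wave m x) = \<dots>" .
    qed
    also have "\<dots> = 0"
      by (subst Bochner_Integration.integral_add,
          intro integrable_mult_right int,
          intro Bochner_Integration.integrable_sum integrable_mult_right Bochner_Integration.integrable_add int,
          subst Bochner_Integration.integral_sum,
          intro integrable_mult_right Bochner_Integration.integrable_add int)
         (simp only: integral_mult_right_zero Bochner_Integration.integral_add[OF int int] Suc
            int_lattice_add int_lattice_diff int_lattice_axis mult_zero_right add_0 sum.neutral_const)
    finally show ?case .
  qed
  \<comment> \<open>Multiplying by the conjugate of \<open>g 0\<close> and taking real parts yields
    a real function that is positive near the origin.\<close>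
  define G where "G x = Re (cnj (g 0) * g x)" for x
  have [measurable]: "G \<in> borel_measurable borel" unfolding G_def by measurable
  define M where "M = norm (g 0) * B"
  have GM: "\<bar>G x\<bar> \<le> M" if "x \<in> torus" for x
  proof -
    have "\<bar>G x\<bar> \<le> norm (g 0) * norm (g x)"
      using abs_Re_le_cmod[of "cnj (g 0) * g x"] by (simp add: G_def norm_mult)
    then show ?thesis using mult_left_mono[OF B[OF that], of "norm (g 0)"] by (simp add: M_def)
  qed
  have M0: "M \<ge> 0" using GM[OF zero_torus] by linarith
  have intG: "integrable lborel (\<lambda>x. indicator torus x *\<^sub>R (G x * torus_kernel x ^ N))" for N
    by (rule integrable_torus_bounded[of _ M])
       (auto simp: abs_mult power_abs torus_kernel_nonneg power_le_one torus_kernel_le_1 intro!: order_trans[OF mult_left_le GM])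
  have G_trig: "(\<integral>x. indicator torus x *\<^sub>R (G x * torus_kernel x ^ N) \<partial>lborel) = 0" for N
  proof -
    have "(\<integral>x. indicator torus x *\<^sub>R (G x * torus_kernel x ^ N) \<partial>lborel)
      = (\<integral>x. Re (cnj (g 0) * (indicator torus x *\<^sub>R (g x * of_real (torus_kernel x ^ N) * wave 0 x))) \<partial>lborel)"
      by (intro Bochner_Integration.integral_cong refl) (simp add: G_def indicator_def algebra_simps flip: of_real_power)
    also have "\<dots> = Re (\<integral>x. cnj (g 0) * (indicator torus x *\<^sub>R (g x * of_real (torus_kernel x ^ N) * wave 0 x)) \<partial>lborel)"
      by (intro integral_Re integrable_mult_right int)
    also have "\<dots> = 0" unfolding integral_mult_right_zero trig[OF int_lattice_0] by simp
    finally show ?thesis .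
  qed
  define \<eta> where "\<eta> = (norm (g 0))\<^sup>2 / 2"
  have \<eta>: "\<eta> > 0" "G 0 = 2 * \<eta>" 
  proof -
    have "G 0 = (norm (g 0))\<^sup>2" unfolding cmod_power2 by (simp add: G_def power2_eq_square)
    then show "\<eta> > 0" "G 0 = 2 * \<eta>" using g0 by (simp_all add: \<eta>_def)
  qed
  have "isCont G 0" unfolding G_def isCont_def by (intro tendsto_intros cont[unfolded isCont_def])
  then obtain \<delta> where \<delta>: "\<delta> > 0" "\<And>y. norm y < \<delta> \<Longrightarrow> \<bar>G y - G 0\<bar> < \<eta>"
    using \<eta>(1) unfolding continuous_at_eps_delta by (auto simp: dist_norm)
  define Q where "Q = {y :: real ^ 'n. \<forall>i. \<bar>y $ i\<bar> \<le> 1 / 2} - ball 0 \<delta>"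
  have "compact Q"
  proof -
    have "{y :: real ^ 'n. \<forall>i. \<bar>y $ i\<bar> \<le> 1 / 2} = cbox (\<chi> i. - (1 / 2)) (\<chi> i. 1 / 2)"
    proof -
      have "\<bar>t\<bar> \<le> 1 / 2 \<longleftrightarrow> - (1 / 2) \<le> t \<and> t \<le> 1 / 2" for t :: real by linarith
      then show ?thesis by (auto simp: cbox_def Basis_vec_def inner_axis)
    qed
    then show ?thesis unfolding Q_def by (metis compact_cbox compact_diff open_ball)
  qed
  obtain q where q: "0 \<le> q" "q < 1" "\<And>y. y \<in> Q \<Longrightarrow> torus_kernel y \<le> q"
  proof (cases "Q = {}")
    case False
    obtain y where y: "y \<in> Q" "\<And>z. z \<in> Q \<Longrightarrow> torus_kernel z \<le> torus_kernel y"
      using continuous_attains_sup[OF \<open>compact Q\<close> False continuous_on_torus_kernel] by blast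
    show ?thesis
    proof (rule that)
      show "torus_kernel y < 1" using y(1) \<open>\<delta> > 0\<close> by (intro torus_kernel_less_1) (auto simp: Q_def)
    qed (use y torus_kernel_nonneg in auto)
  qed (use that[of 0] in auto)
  \<comment> \<open>A number strictly between \<open>q\<close> and 1: the kernel exceeds it near the
    origin by continuity, and is at most \<open>q\<close> on \<open>Q\<close>.\<close>
  define q' where "q' = (1 + q) / 2"
  have q': "q < q'" "q' < 1" "0 < q'" using q by (auto simp: q'_def)
  have "isCont (torus_kernel :: real ^ 'n \<Rightarrow> real) 0"
  proof -
    have "continuous_on UNIV (torus_kernel :: real ^ 'n \<Rightarrow> real)" by (rule continuous_on_torus_kernel)
    then show ?thesis by (simp add: continuous_on_eq_continuous_at)
  qed
  then obtain \<delta>' where \<delta>': "\<delta>' > 0" "\<And>y :: real ^ 'n. norm y < \<delta>' \<Longrightarrow> \<bar>torus_kernel y - 1\<bar> < 1 - q'"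
    using q'(2) unfolding continuous_at_eps_delta
    by (auto simp: dist_norm torus_kernel_0) (metis diff_gt_0_iff_gt)
  define r where "r = min (min \<delta> \<delta>') (1 / 2)"
  have r: "r > 0" "r \<le> \<delta>" "r \<le> \<delta>'" "r \<le> 1 / 2" using \<delta> \<delta>' by (auto simp: r_def)
  have ball_torus: "ball (0 :: real ^ 'n) r \<subseteq> torus"
  proof
    fix y :: "real ^ 'n" assume "y \<in> ball 0 r"
    then have "norm y < 1 / 2" using r by simp
    then have "- 1 / 2 < y $ i \<and> y $ i \<le> 1 / 2" for i
      using component_le_norm_cart[of y i] by linarith
    then show "y \<in> torus" by (simp add: torus_def)
  qed
  define V where "V = measure lborel (ball (0 :: real ^ 'n) r)"
  have V: "V > 0" unfolding V_def using r by (simp add: content_ball_gt_0_iff)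
  \<comment> \<open>The integrand is at least \<open>\<eta> * q' ^ N\<close> on the ball of radius
    \<open>r\<close>, nonnegative between the radii \<open>r\<close> and \<open>\<delta>\<close>,
    and at least \<open>- M * q ^ N\<close> farther out. Since its integral vanishes, the first
    contribution cannot exceed the last. As q < q', this fails for large N.\<close>
  have main: "\<eta> * V * q' ^ N \<le> M * q ^ N" for N
  proof -
    have intb: "integrable lborel (indicator (ball (0 :: real ^ 'n) r) :: _ \<Rightarrow> real)"
    proof (rule integrable_real_indicator)
      show "emeasure lborel (ball (0 :: real ^ 'n) r) < \<infinity>" by (rule emeasure_lborel_ball_finite)
    qed simp
    have intt: "integrable lborel (indicator (torus :: (real ^ 'n) set) :: _ \<Rightarrow> real)"
      by (rule integrable_real_indicator) (auto simp: emeasure_torus)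
    have "(\<integral>x. \<eta> * q' ^ N * indicator (ball (0 :: real ^ 'n) r) x - M * q ^ N * indicator torus x \<partial>lborel)
      \<le> (\<integral>x. indicator torus x *\<^sub>R (G x * torus_kernel x ^ N) \<partial>lborel)"
    proof (rule integral_mono)
      show "integrable lborel (\<lambda>x. \<eta> * q' ^ N * indicator (ball (0 :: real ^ 'n) r) x - M * q ^ N * indicator torus x)"
        by (intro Bochner_Integration.integrable_diff integrable_mult_right intb intt)
      fix x :: "real ^ 'n"
      consider "x \<notin> torus" | "x \<in> torus" "norm x < r" | "x \<in> torus" "norm x \<ge> r" "norm x < \<delta>" | "x \<in> torus" "norm x \<ge> r" "norm x \<ge> \<delta>"
        by linarith
      then show "\<eta> * q' ^ N * indicator (ball 0 r) x - M * q ^ N * indicator torus x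
         \<le> indicator torus x *\<^sub>R (G x * torus_kernel x ^ N)"
      proof cases
        case 1
        then have "x \<notin> ball 0 r" using ball_torus by blast
        then show ?thesis using 1 by (simp del: mem_ball)
      next
        case 2
        have "G x \<ge> \<eta>" using \<delta>(2)[of x] 2 r \<eta>(2) by linarith
        moreover have "q' \<le> torus_kernel x" using \<delta>'(2)[of x] 2 r by linarith
        then have "q' ^ N \<le> torus_kernel x ^ N" using q' by (intro power_mono) auto
        ultimately have "\<eta> * q' ^ N \<le> G x * torus_kernel x ^ N" using \<eta> q' by (intro mult_mono) auto
        moreover have "M * q ^ N \<ge> 0" using M0 q by simp
        ultimately show ?thesis using 2 by simp
      next
        case 3
        have "G x \<ge> 0" using \<delta>(2)[of x] 3 \<eta> by linarith
        then have "G x * torus_kernel x ^ N \<ge> 0" by (simp add: torus_kernel_nonneg)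
        moreover have "M * q ^ N \<ge> 0" using M0 q by simp
        ultimately show ?thesis using 3 by simp
      next
        case 4
        have "\<bar>x $ i\<bar> \<le> 1 / 2" for i
        proof -
          have "- 1 / 2 < x $ i" "x $ i \<le> 1 / 2" using 4 by (auto simp: torus_def)
          then show ?thesis by linarith
        qed
        then have "x \<in> Q" using 4 by (auto simp: Q_def)
        then have "torus_kernel x ^ N \<le> q ^ N" using q torus_kernel_nonneg by (intro power_mono) auto
        then have "\<bar>G x\<bar> * torus_kernel x ^ N \<le> M * q ^ N"
          using GM[of x] 4 by (intro mult_mono) (auto simp: torus_kernel_nonneg M0)
        moreover have "- (\<bar>G x\<bar> * torus_kernel x ^ N) \<le> G x * torus_kernel x ^ N"
          using mult_right_mono[of "- \<bar>G x\<bar>" "G x" "torus_kernel x ^ N"] by (simp add: torus_kernel_nonneg)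
        ultimately show ?thesis using 4 by simp
      qed
    qed (rule intG)
    also have "\<dots> = 0" by (rule G_trig)
    also have "(\<integral>x. \<eta> * q' ^ N * indicator (ball (0 :: real ^ 'n) r) x - M * q ^ N * indicator torus x \<partial>lborel)
      = \<eta> * q' ^ N * V - M * q ^ N * 1"
      using integral_torus_1[where 'n='n]
      by (subst Bochner_Integration.integral_diff, intro integrable_mult_right intb, intro integrable_mult_right intt)
         (simp add: V_def)
    finally show ?thesis by (simp add: mult_ac)
  qed
  have "(\<lambda>N. M * (q / q') ^ N) \<longlonglongrightarrow> M * 0"
    using q q' by (intro tendsto_mult tendsto_const LIMSEQ_power_zero) auto
  moreover have "\<eta> * V \<le> M * (q / q') ^ N" for N
    using main[of N] q' by (simp add: power_divide field_simps)
  ultimately have "\<eta> * V \<le> M * 0"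
    by (intro LIMSEQ_le_const) auto
  then show False using \<eta> V by (simp add: mult_le_0_iff)
qed

text \<open>The periodization and the absolutely convergent Fourier series are both continuous and
  have the same Fourier coefficients, so their difference vanishes at 0. Their values at 0 are the
  two sides.\<close>

lemma poisson_summation:
  fixes f :: "real ^ 'n \<Rightarrow> complex"
  assumes cont: "continuous_on UNIV f" and supp: "\<And>x. norm x > r \<Longrightarrow> f x = 0"
    and sm: "(\<lambda>m. norm (\<integral>x. f x * wave (- m) x \<partial>lborel)) summable_on int_lattice"
  shows "(\<Sum>\<^sub>\<infinity>m\<in>int_lattice. \<integral>x. f x * wave (- m) x \<partial>lborel) = (\<Sum>n\<in>lattice_ball (r + real CARD('n)). f n)"
proof -
  let ?N = "lattice_ball (r + real CARD('n)) :: (real ^ 'n) set"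
  define c where "c m = (\<integral>x. f x * wave (- m) x \<partial>lborel)" for m
  have f_meas [measurable]: "f \<in> borel_measurable borel" by (rule borel_measurable_continuous_onI[OF cont])
  have "\<exists>B. \<forall>x. norm (f x) \<le> B"
  proof -
    have "bounded (f ` cball 0 r)"
      by (intro compact_imp_bounded compact_continuous_image continuous_on_subset[OF cont]) auto
    then obtain B where "\<forall>y\<in>f ` cball 0 r. norm y \<le> B" unfolding bounded_iff by blast
    then have B: "norm (f x) \<le> B" if "norm x \<le> r" for x using that by simp
    have "norm (f x) \<le> max B 0" for x using B[of x] supp[of x] by (cases "norm x \<le> r") auto
    then show ?thesis by blast
  qed
  then obtain B where B: "\<And>x. norm (f x) \<le> B" by blast
  have f_int: "integrable lborel f" by (rule integrable_bounded_support[OF f_meas B supp])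
  define p where "p y = (\<Sum>n\<in>?N. f (y + n))" for y
  have p_cont: "continuous_on UNIV p"
    unfolding p_def by (intro continuous_intros continuous_on_compose2[OF cont]) auto
  have p_meas [measurable]: "p \<in> borel_measurable borel" unfolding p_def by measurable
  define P where "P = real (card ?N) * B"
  have P: "norm (p x) \<le> P" for x
    unfolding p_def P_def by (rule sum_norm_bound) (rule B)
  have c: "c m = (\<integral>x. indicator torus x *\<^sub>R (p x * wave (- m) x) \<partial>lborel)" if "m \<in> int_lattice" for m
    unfolding c_def p_def by (rule lattice_sum_integral[OF f_int supp that])
  define S where "S y = (\<Sum>\<^sub>\<infinity>m\<in>int_lattice. c m * wave m y)" for y
  have ul: "uniform_limit UNIV (\<lambda>X y. \<Sum>m\<in>X. c m * wave m y) S (finite_subsets_at_top int_lattice)"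
    unfolding S_def using sm
    by (intro Weierstrass_m_test_general[where M="\<lambda>m. norm (c m)"]) (auto simp: norm_mult c_def)
  have S_cont: "continuous_on UNIV S"
    by (rule uniform_limit_theorem[OF _ ul]) (auto intro!: always_eventually continuous_intros)
  have S_meas [measurable]: "S \<in> borel_measurable borel" by (rule borel_measurable_continuous_onI[OF S_cont])
  have S_approx: "\<exists>X0. finite X0 \<and> X0 \<subseteq> int_lattice \<and> (\<forall>X. finite X \<and> X0 \<subseteq> X \<and> X \<subseteq> int_lattice \<longrightarrow> (\<forall>y. norm ((\<Sum>m\<in>X. c m * wave m y) - S y) < \<epsilon>))"
    if "\<epsilon> > 0" for \<epsilon>
    using uniform_limitD[OF ul that] by (auto simp: eventually_finite_subsets_at_top dist_norm) 
  \<comment> \<open>A single partial sum at uniform distance less than 1 shows that the limit is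
    bounded.\<close>
  obtain X1 where X1: "finite X1" "\<And>y. norm ((\<Sum>m\<in>X1. c m * wave m y) - S y) < 1"
    using S_approx[of 1] by (metis order_refl zero_less_one)
  have S_bd: "norm (S y) \<le> (\<Sum>m\<in>X1. norm (c m)) + 1" for y
  proof -
    have "norm (\<Sum>m\<in>X1. c m * wave m y) \<le> (\<Sum>m\<in>X1. norm (c m))"
      by (rule order_trans[OF norm_sum]) (simp add: norm_mult)
    then show ?thesis using X1(2)[of y] by norm
  qed
  define g where "g y = p y - S y" for y
  have g_meas [measurable]: "g \<in> borel_measurable borel" unfolding g_def by measurable
  have g_bd: "norm (g y) \<le> P + ((\<Sum>m\<in>X1. norm (c m)) + 1)" for y
    unfolding g_def by (intro norm_triangle_le_diff add_mono P S_bd)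
  have "g 0 = 0"
  proof (rule fourier_coeffs_zero_imp_zero_at_0[OF g_meas _ g_bd])
    have "continuous_on UNIV g" unfolding g_def by (intro continuous_intros p_cont S_cont)
    then show "isCont g 0" by (simp add: continuous_on_eq_continuous_at)
    fix m :: "real ^ 'n" assume "m \<in> int_lattice"
    define n where "n = - m"
    have n: "n \<in> int_lattice" using \<open>m \<in> int_lattice\<close> by (simp add: n_def int_lattice_uminus)
    have m: "m = - n" by (simp add: n_def)
    let ?I = "\<integral>x. indicator torus x *\<^sub>R (g x * wave (- n) x) \<partial>lborel"
    have "norm ?I \<le> \<epsilon>" if \<epsilon>: "\<epsilon> > 0" for \<epsilon>
    proof -
      obtain X0 where X0: "finite X0" "X0 \<subseteq> int_lattice"
        "\<forall>X. finite X \<and> X0 \<subseteq> X \<and> X \<subseteq> int_lattice \<longrightarrow> (\<forall>y. norm ((\<Sum>m\<in>X. c m * wave m y) - S y) < \<epsilon>)"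
        using S_approx[OF \<epsilon>] by (elim exE conjE)
      \<comment> \<open>With n included, the partial sum has exactly \<open>c n\<close> as its n-th
        coefficient, and only the uniformly small tail is left to estimate.\<close>
      define X where "X = insert n X0"
      have X: "finite X" "X \<subseteq> int_lattice" "n \<in> X" "X0 \<subseteq> X" using X0(1,2) n by (auto simp: X_def)
      define s where "s y = (\<Sum>m\<in>X. c m * wave m y)" for y
      have s_meas [measurable]: "s \<in> borel_measurable borel" unfolding s_def by measurable
      have sS: "norm (s y - S y) \<le> \<epsilon>" for y
        unfolding s_def using X0(3)[rule_format, of X y] X by (simp add: less_imp_le)
      have intw: "integrable lborel (\<lambda>x. indicator torus x *\<^sub>R (wave m x * wave (- n) x))" for m
        by (rule integrable_torus_bounded[of _ 1]) (auto simp: norm_mult)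
      have orth: "(\<integral>x. indicator torus x *\<^sub>R (wave m x * wave (- n) x) \<partial>lborel) = (if m = n then 1 else 0)"
        if "m \<in> X" for m
      proof (cases "m = n")
        case True
        then show ?thesis using integral_torus_const[of "1::complex"] by (simp add: wave_minus)
      next
        case False
        have "wave m x * wave (- n) x = wave (m - n) x" for x
          using wave_add(1)[of m "- n" x] by simp
        then show ?thesis using False X(2) that n integral_torus_wave[of "m - n"] by (auto simp: int_lattice_diff subset_iff)
      qed
      have "(\<integral>x. indicator torus x *\<^sub>R (s x * wave (- n) x) \<partial>lborel)
        = (\<integral>x. (\<Sum>m\<in>X. c m * (indicator torus x *\<^sub>R (wave m x * wave (- n) x))) \<partial>lborel)"
        by (intro Bochner_Integration.integral_cong refl)
           (simp add: s_def sum_distrib_right scaleR_sum_right mult.assoc)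
      also have "\<dots> = (\<Sum>m\<in>X. c m * (if m = n then 1 else 0))"
        by (subst Bochner_Integration.integral_sum, intro integrable_mult_right intw, intro sum.cong refl)
           (simp only: integral_mult_right_zero orth)
      also have "\<dots> = c n" using X by (simp add: if_distrib cong: if_cong)
      finally have sn: "(\<integral>x. indicator torus x *\<^sub>R (s x * wave (- n) x) \<partial>lborel) = c n" .
      have ints: "integrable lborel (\<lambda>x. indicator torus x *\<^sub>R (s x * wave (- n) x))"
        by (rule integrable_torus_bounded[of _ "\<Sum>m\<in>X. norm (c m)"])
           (auto simp: norm_mult s_def intro!: order_trans[OF norm_sum])
      have intp: "integrable lborel (\<lambda>x. indicator torus x *\<^sub>R (p x * wave (- n) x))"
        by (rule integrable_torus_bounded[of _ P]) (auto simp: norm_mult P)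
      have intd: "integrable lborel (\<lambda>x. indicator torus x *\<^sub>R ((s x - S x) * wave (- n) x))"
        by (rule integrable_torus_bounded[of _ \<epsilon>]) (auto simp: norm_mult sS)
      have "?I = (\<integral>x. (indicator torus x *\<^sub>R (p x * wave (- n) x) - indicator torus x *\<^sub>R (s x * wave (- n) x))
          + indicator torus x *\<^sub>R ((s x - S x) * wave (- n) x) \<partial>lborel)"
        by (intro Bochner_Integration.integral_cong refl) (simp add: g_def indicator_def algebra_simps)
      also have "\<dots> = (c n - c n) + (\<integral>x. indicator torus x *\<^sub>R ((s x - S x) * wave (- n) x) \<partial>lborel)"
        by (subst Bochner_Integration.integral_add[OF Bochner_Integration.integrable_diff[OF intp ints] intd],
            subst Bochner_Integration.integral_diff[OF intp ints])
           (simp only: sn c[OF n])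
      finally have "norm ?I = norm (\<integral>x. indicator torus x *\<^sub>R ((s x - S x) * wave (- n) x) \<partial>lborel)" by simp
      also have "\<dots> \<le> (\<integral>x. norm (indicator torus x *\<^sub>R ((s x - S x) * wave (- n) x)) \<partial>lborel)"
        by (rule integral_norm_bound)
      also have "\<dots> \<le> (\<integral>x. indicator torus x *\<^sub>R \<epsilon> \<partial>(lborel :: (real ^ 'n) measure))"
      proof (rule integral_mono)
        show "integrable lborel (\<lambda>x. indicator (torus :: (real ^ 'n) set) x *\<^sub>R \<epsilon>)"
          by (rule integrable_torus_bounded[of _ \<epsilon>]) (use \<epsilon> in auto)
        show "integrable lborel (\<lambda>x. norm (indicator torus x *\<^sub>R ((s x - S x) * wave (- n) x)))"
          by (rule integrable_norm[OF intd])
      qed (use sS in \<open>auto simp: indicator_def norm_mult\<close>)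
      also have "\<dots> = \<epsilon>" by (rule integral_torus_const)
      finally show ?thesis .
    qed
    then have "norm ?I \<le> 0" by (metis field_le_epsilon add_0)
    then show "(\<integral>x. indicator torus x *\<^sub>R (g x * wave m x) \<partial>lborel) = 0" by (simp add: m)
  qed
  then have "S 0 = p 0" by (simp add: g_def)
  then show ?thesis by (simp add: S_def p_def c_def)
qed

section \<open>Fourier decay of truncated radial functions\<close>

lemma vector_derivative_quotient:
  fixes f :: "real \<Rightarrow> 'a::real_normed_vector"
  assumes "(f has_vector_derivative D) (at 0)"
  shows "((\<lambda>h. (f h - f 0) /\<^sub>R h) \<longlongrightarrow> D) (at 0)"
proof -
  have "((\<lambda>h. norm (f (0 + h) - f 0 - h *\<^sub>R D) / norm h) \<longlongrightarrow> 0) (at 0)"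
    using assms unfolding has_vector_derivative_def has_derivative_at by blast
  moreover have "\<forall>\<^sub>F h in at 0. norm (f (0 + h) - f 0 - h *\<^sub>R D) / norm h = norm ((f h - f 0) /\<^sub>R h - D)"
    unfolding eventually_at
  proof (intro exI[of _ 1] conjI ballI impI)
    fix h :: real assume "h \<noteq> 0 \<and> dist h 0 < 1"
    then have "(f h - f 0) /\<^sub>R h - D = (f (0 + h) - f 0 - h *\<^sub>R D) /\<^sub>R h"
      by (simp add: scaleR_diff_right)
    then show "norm (f (0 + h) - f 0 - h *\<^sub>R D) / norm h = norm ((f h - f 0) /\<^sub>R h - D)"
      by (simp add: divide_inverse_commute)
  qed simp
  ultimately have "((\<lambda>h. norm ((f h - f 0) /\<^sub>R h - D)) \<longlongrightarrow> 0) (at 0)"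
    by (rule Lim_transform_eventually)
  then show ?thesis by (simp add: tendsto_norm_zero_iff LIM_zero_iff)
qed

lemma wave_derivative:
  fixes y :: "real ^ 'n"
  shows "((\<lambda>h. (wave y (- (h *\<^sub>R axis i 1)) - 1) /\<^sub>R h) \<longlongrightarrow> - (2 * pi * \<i> * y $ i)) (at 0)"
proof -
  define c where "c = - (2 * pi * \<i> * y $ i)"
  have "((\<lambda>z. exp (c * z)) has_field_derivative c) (at (of_real 0))"
    by (auto intro!: derivative_eq_intros)
  then have "((\<lambda>h. exp (c * of_real h)) has_vector_derivative c) (at 0)"
    by (rule has_vector_derivative_real_field)
  moreover have "exp (c * of_real h) = wave y (- (h *\<^sub>R axis i 1))" for h
    by (simp add: wave_def inner_axis cis_conv_exp c_def mult_ac)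
  ultimately have "((\<lambda>h. wave y (- (h *\<^sub>R axis i 1))) has_vector_derivative - (2 * pi * \<i> * y $ i)) (at 0)"
    by (simp add: c_def)
  from vector_derivative_quotient[OF this] show ?thesis
    by simp
qed

text \<open>
  Integration by parts for a Lipschitz function that is differentiable almost everywhere, by
  dominated convergence of difference quotients under the translation-invariant integral.
\<close>

lemma integral_by_parts_wave:
  fixes f f' :: "real ^ 'n \<Rightarrow> complex"
  assumes [measurable]: "f \<in> borel_measurable borel" "f' \<in> borel_measurable borel"
    and B: "\<And>x. norm (f x) \<le> B" and supp: "\<And>x. norm x > r \<Longrightarrow> f x = 0"
    and L: "\<And>x h. norm (f (x + h *\<^sub>R axis i 1) - f x) \<le> L * \<bar>h\<bar>"
    and deriv: "AE x in lborel. ((\<lambda>h. f (x + h *\<^sub>R axis i 1)) has_vector_derivative f' x) (at 0)"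
  shows "(\<integral>x. f' x * wave y x \<partial>lborel) = - (2 * pi * \<i> * y $ i) * (\<integral>x. f x * wave y x \<partial>lborel)"
proof -
  let ?e = "axis i 1 :: real ^ 'n"
  \<comment> \<open>The steps are at most 1, so all difference quotients vanish outside the ball of
    radius r + 1.\<close>
  define h where "h k = inverse (real (Suc k))" for k
  have h: "h k \<noteq> 0" "\<bar>h k\<bar> \<le> 1" for k
  proof -
    show "h k \<noteq> 0" by (simp add: h_def del: of_nat_Suc)
    have "inverse (real (Suc k)) \<le> inverse 1" by (rule le_imp_inverse_le) simp_all
    then show "\<bar>h k\<bar> \<le> 1" by (simp add: h_def del: of_nat_Suc)
  qed
  have h_lim: "filterlim h (at 0) sequentially"
    unfolding filterlim_at
  proof
    show "h \<longlonglongrightarrow> 0" unfolding h_def by (rule LIMSEQ_inverse_real_of_nat)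
  qed (simp add: h(1))
  define s where "s k x = ((f (x + h k *\<^sub>R ?e) - f x) /\<^sub>R h k) * wave y x" for k x
  have f_int: "integrable lborel f" by (rule integrable_bounded_support[OF _ B supp]) simp
  have fw_int: "integrable lborel (\<lambda>x. f x * wave y x)"
    by (rule Bochner_Integration.integrable_bound[OF f_int]) (auto simp: norm_mult)
  have ft_int: "integrable lborel (\<lambda>x. f (x + h k *\<^sub>R ?e) * wave y x)" for k
  proof (rule integrable_bounded_support[of _ B "r + 1"])
    fix x :: "real ^ 'n" assume x: "norm x > r + 1"
    have "norm x \<le> norm (x + h k *\<^sub>R ?e) + norm (h k *\<^sub>R ?e)" by (metis add_diff_cancel norm_triangle_ineq4)
    then have "norm (x + h k *\<^sub>R ?e) > r" using x h(2)[of k] by simp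
    then show "f (x + h k *\<^sub>R ?e) * wave y x = 0" by (simp add: supp)
  qed (auto simp: norm_mult B)
  have "(\<lambda>k. integral\<^sup>L lborel (s k)) \<longlonglongrightarrow> (\<integral>x. f' x * wave y x \<partial>lborel)"
  proof (rule integral_dominated_convergence)
    show "integrable lborel (\<lambda>x. indicator (cball 0 (r + 1)) x * L :: real)"
      by (rule integrable_bounded_support[of _ "\<bar>L\<bar>" "r + 1"]) (auto simp: indicator_def)
    show "AE x in lborel. (\<lambda>k. s k x) \<longlonglongrightarrow> f' x * wave y x"
      using deriv
    proof eventually_elim
      case (elim x)
      have "((\<lambda>k. (f (x + h k *\<^sub>R ?e) - f (x + 0 *\<^sub>R ?e)) /\<^sub>R h k)) \<longlonglongrightarrow> f' x"
        by (rule filterlim_compose[OF vector_derivative_quotient[OF elim] h_lim])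
      then show ?case unfolding s_def by (intro tendsto_mult tendsto_const) simp
    qed
    show "AE x in lborel. norm (s k x) \<le> indicator (cball 0 (r + 1)) x * L" for k
    proof (rule AE_I2)
      fix x :: "real ^ 'n"
      show "norm (s k x) \<le> indicator (cball 0 (r + 1)) x * L"
      proof (cases "norm x \<le> r + 1")
        case True
        have "norm (s k x) = norm (f (x + h k *\<^sub>R ?e) - f x) / \<bar>h k\<bar>"
          by (simp add: s_def norm_mult divide_inverse_commute)
        also have "\<dots> \<le> L" using L[of x "h k"] h(1)[of k] by (simp add: pos_divide_le_eq)
        finally show ?thesis using True by simp
      next
        case False
        have "norm x \<le> norm (x + h k *\<^sub>R ?e) + norm (h k *\<^sub>R ?e)" by (metis add_diff_cancel norm_triangle_ineq4)
        then have "norm (x + h k *\<^sub>R ?e) > r" "norm x > r" using False h(2)[of k] by auto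
        then show ?thesis using False by (simp add: supp s_def)
      qed
    qed
    show "s k \<in> borel_measurable lborel" for k unfolding s_def by measurable
  qed measurable
  \<comment> \<open>Translation invariance moves the difference quotient from \<open>f\<close> to
    the character, where it is an explicit factor.\<close>
  moreover have "integral\<^sup>L lborel (s k) = ((wave y (- (h k *\<^sub>R ?e)) - 1) /\<^sub>R h k) * (\<integral>x. f x * wave y x \<partial>lborel)" for k
  proof -
    have "(\<integral>x. f (x + h k *\<^sub>R ?e) * wave y x \<partial>lborel)
      = (\<integral>x. wave y (- (h k *\<^sub>R ?e)) * (f (x + h k *\<^sub>R ?e) * wave y (x + h k *\<^sub>R ?e)) \<partial>lborel)"
    proof (intro Bochner_Integration.integral_cong refl)
      fix x
      have "wave y x = wave y (- (h k *\<^sub>R ?e)) * wave y (x + h k *\<^sub>R ?e)"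
        by (simp add: wave_add(2)[symmetric])
      then show "f (x + h k *\<^sub>R ?e) * wave y x = wave y (- (h k *\<^sub>R ?e)) * (f (x + h k *\<^sub>R ?e) * wave y (x + h k *\<^sub>R ?e))"
        by simp
    qed
    also have "\<dots> = wave y (- (h k *\<^sub>R ?e)) * (\<integral>x. f x * wave y x \<partial>lborel)"
      unfolding integral_mult_right_zero
      using integral_lborel_translate[of "\<lambda>x. f x * wave y x" "h k *\<^sub>R ?e"] by simp
    finally have "(\<integral>x. f (x + h k *\<^sub>R ?e) * wave y x \<partial>lborel) - (\<integral>x. f x * wave y x \<partial>lborel)
      = (wave y (- (h k *\<^sub>R ?e)) - 1) * (\<integral>x. f x * wave y x \<partial>lborel)" by (simp add: left_diff_distrib)
    moreover have "integral\<^sup>L lborel (s k) = (\<integral>x. (f (x + h k *\<^sub>R ?e) * wave y x - f x * wave y x) /\<^sub>R h k \<partial>lborel)"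
      by (intro Bochner_Integration.integral_cong refl) (simp add: s_def left_diff_distrib)
    moreover have "\<dots> = (\<integral>x. f (x + h k *\<^sub>R ?e) * wave y x - f x * wave y x \<partial>lborel) /\<^sub>R h k"
      by (rule integral_scaleR_right)
    ultimately show ?thesis
      by (simp only: Bochner_Integration.integral_diff[OF ft_int fw_int] mult_scaleR_left)
  qed
  moreover have "(\<lambda>k. ((wave y (- (h k *\<^sub>R ?e)) - 1) /\<^sub>R h k) * (\<integral>x. f x * wave y x \<partial>lborel))
     \<longlonglongrightarrow> - (2 * pi * \<i> * y $ i) * (\<integral>x. f x * wave y x \<partial>lborel)"
    by (intro tendsto_mult tendsto_const filterlim_compose[OF wave_derivative h_lim])
  ultimately show ?thesis by (simp add: LIMSEQ_unique)
qed

text \<open>\<open>P b\<close> is the b-th derivative of \<open>P 0\<close>, which vanishes at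
  \<open>S\<close> to order \<open>p\<close>. In the application \<open>P\<close> is the family of
  Taylor remainders at S = l^2, and p = J + 1.\<close>

locale truncated_radial =
  fixes P :: "nat \<Rightarrow> real \<Rightarrow> complex" and S :: real and p :: nat
  assumes S_pos: "S > 0"
    and P_deriv: "\<And>b u. (P b has_vector_derivative P (Suc b) u) (at u)"
    and P_S: "\<And>b. b < p \<Longrightarrow> P b S = 0"
begin

lemma P_cont: "continuous_on UNIV (P b)"
  using P_deriv by (auto intro!: continuous_at_imp_continuous_on has_vector_derivative_continuous)

lemma P_meas [measurable]: "P b \<in> borel_measurable borel"
  by (rule borel_measurable_continuous_onI[OF P_cont])

text \<open>A family closed under differentiation along axis i, because |\<xi>|^2 has the partial
  derivative 2 \<xi>_i: one term lowers n, the other raises n and b by 1. Each derivative costs at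
  most one order of vanishing on the sphere.\<close>

definition core :: "'n \<Rightarrow> nat \<Rightarrow> nat \<Rightarrow> real ^ 'n \<Rightarrow> complex" where
  "core i n b \<xi> = (\<xi> $ i) ^ n *\<^sub>R P b ((norm \<xi>)\<^sup>2)"

text \<open>For n = 0 the truncated difference \<open>n - 1\<close> is harmless, since its factor is
  0.\<close>

definition core' :: "'n \<Rightarrow> nat \<Rightarrow> nat \<Rightarrow> real ^ 'n \<Rightarrow> complex" where
  "core' i n b \<xi> = of_nat n * core i (n - 1) b \<xi> + 2 * core i (n + 1) (Suc b) \<xi>"

definition trunc :: "'n \<Rightarrow> nat \<Rightarrow> nat \<Rightarrow> real ^ 'n \<Rightarrow> complex" where
  "trunc i n b \<xi> = (if (norm \<xi>)\<^sup>2 < S then core i n b \<xi> else 0)"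

definition trunc' :: "'n \<Rightarrow> nat \<Rightarrow> nat \<Rightarrow> real ^ 'n \<Rightarrow> complex" where
  "trunc' i n b \<xi> = of_nat n * trunc i (n - 1) b \<xi> + 2 * trunc i (n + 1) (Suc b) \<xi>"

lemma continuous_on_core: "continuous_on A (core i n b)"
  unfolding core_def by (intro continuous_intros continuous_on_compose2[OF P_cont]) auto

lemma core_meas [measurable]: "core i n b \<in> borel_measurable borel"
  by (rule borel_measurable_continuous_onI[OF continuous_on_core])

lemma trunc_meas [measurable]: "trunc i n b \<in> borel_measurable borel"
  unfolding trunc_def by measurable

lemma norm_sqr_less_iff: "(norm (\<xi> :: real ^ 'n))\<^sup>2 < S \<longleftrightarrow> norm \<xi> < sqrt S"
  using real_sqrt_less_iff[of "(norm \<xi>)\<^sup>2" S] by simp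

lemma trunc_supp: "norm \<xi> > sqrt S \<Longrightarrow> trunc i n b \<xi> = 0"
  by (simp add: trunc_def norm_sqr_less_iff)

lemma core_bounded: "\<exists>B. \<forall>\<xi>. norm \<xi> \<le> sqrt S \<longrightarrow> norm (core i n b \<xi>) \<le> B"
proof -
  have "bounded (core i n b ` cball 0 (sqrt S))"
    by (intro compact_imp_bounded compact_continuous_image continuous_on_core) auto
  then obtain B where "\<forall>y\<in>core i n b ` cball 0 (sqrt S). norm y \<le> B" unfolding bounded_iff by blast
  then have "norm \<xi> \<le> sqrt S \<longrightarrow> norm (core i n b \<xi>) \<le> B" for \<xi> by simp
  then show ?thesis by blast
qed

lemma trunc_bounded: "\<exists>B. \<forall>\<xi>. norm (trunc i n b \<xi>) \<le> B"
proof -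
  obtain B where B: "\<And>\<xi>. norm \<xi> \<le> sqrt S \<Longrightarrow> norm (core i n b \<xi>) \<le> B" using core_bounded by blast
  have "norm (trunc i n b \<xi>) \<le> max B 0" for \<xi>
    using B[of \<xi>] by (auto simp: trunc_def norm_sqr_less_iff)
  then show ?thesis by blast
qed

lemma core_has_vector_derivative:
  "((\<lambda>t. core i n b (\<xi> + t *\<^sub>R axis i 1)) has_vector_derivative core' i n b (\<xi> + t *\<^sub>R axis i 1)) (at t)"
proof -
  define w where "w = (norm \<xi>)\<^sup>2"
  have nrm: "(norm (\<xi> + t *\<^sub>R axis i 1))\<^sup>2 = w + 2 * t * \<xi> $ i + t\<^sup>2" for t
    unfolding w_def power2_norm_eq_inner by (simp add: inner_simps inner_axis inner_axis' inner_commute power2_eq_square)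
  have eq: "core i n b (\<xi> + t *\<^sub>R axis i 1) = (\<xi> $ i + t) ^ n *\<^sub>R P b (w + 2 * t * \<xi> $ i + t\<^sup>2)" for n b t
    unfolding core_def nrm by simp
  have "((\<lambda>t. w + 2 * t * \<xi> $ i + t\<^sup>2) has_vector_derivative 2 * (\<xi> $ i + t)) (at t)"
    unfolding has_real_derivative_iff_has_vector_derivative[symmetric]
    by (auto intro!: derivative_eq_intros)
  from vector_diff_chain_at[OF this P_deriv]
  have 1: "((\<lambda>t. P b (w + 2 * t * \<xi> $ i + t\<^sup>2)) has_vector_derivative (2 * (\<xi> $ i + t)) *\<^sub>R P (Suc b) (w + 2 * t * \<xi> $ i + t\<^sup>2)) (at t)"
    by (simp add: o_def)
  have 2: "((\<lambda>t. (\<xi> $ i + t) ^ n) has_real_derivative real n * (\<xi> $ i + t) ^ (n - 1)) (at t)"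
    by (auto intro!: derivative_eq_intros)
  have "((\<lambda>t. (\<xi> $ i + t) ^ n *\<^sub>R P b (w + 2 * t * \<xi> $ i + t\<^sup>2)) has_vector_derivative
      (\<xi> $ i + t) ^ n *\<^sub>R ((2 * (\<xi> $ i + t)) *\<^sub>R P (Suc b) (w + 2 * t * \<xi> $ i + t\<^sup>2))
      + (real n * (\<xi> $ i + t) ^ (n - 1)) *\<^sub>R P b (w + 2 * t * \<xi> $ i + t\<^sup>2)) (at t)"
    by (rule has_vector_derivative_scaleR[OF 2 1])
  then show ?thesis unfolding eq core'_def
    by (simp add: scaleR_conv_of_real algebra_simps)
qed

lemma core_boundary: "b < p \<Longrightarrow> (norm \<xi>)\<^sup>2 = S \<Longrightarrow> core i n b \<xi> = 0"
  by (simp add: core_def P_S)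

lemma norm_convex_line:
  fixes \<xi> e :: "real ^ 'n"
  assumes "norm \<xi> \<le> R" "norm (\<xi> + h *\<^sub>R e) \<le> R" "0 \<le> \<tau>" "\<tau> \<le> 1"
  shows "norm (\<xi> + (\<tau> * h) *\<^sub>R e) \<le> R"
proof -
  have "\<xi> + (\<tau> * h) *\<^sub>R e = (1 - \<tau>) *\<^sub>R \<xi> + \<tau> *\<^sub>R (\<xi> + h *\<^sub>R e)"
    by (simp add: algebra_simps)
  then show ?thesis
    using assms convexD[OF convex_cball[of 0 R], of \<xi> "\<xi> + h *\<^sub>R e" "1 - \<tau>" \<tau>] by simp
qed

text \<open>For b < p the function vanishes on the sphere, so the cut creates no jump. Inside the
  ball the mean value inequality applies, and a step that leaves the ball is shortened to a point of
  the sphere.\<close>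

lemma trunc_lipschitz:
  fixes i :: "'n::finite"
  assumes b: "b < p"
  shows "\<exists>L. \<forall>\<xi> h. norm (trunc i n b (\<xi> + h *\<^sub>R axis i 1) - trunc i n b \<xi>) \<le> L * \<bar>h\<bar>"
proof -
  let ?e = "axis i 1 :: real ^ 'n"
  obtain B1 B2 where B1: "\<And>\<xi>. norm \<xi> \<le> sqrt S \<Longrightarrow> norm (core i (n - 1) b \<xi>) \<le> B1"
    and B2: "\<And>\<xi>. norm \<xi> \<le> sqrt S \<Longrightarrow> norm (core i (n + 1) (Suc b) \<xi>) \<le> B2"
    using core_bounded by meson
  define L where "L = real n * B1 + 2 * B2"
  have L: "norm (core' i n b \<xi>) \<le> L" if "norm \<xi> \<le> sqrt S" for \<xi>
  proof -
    have "norm (core' i n b \<xi>) \<le> real n * norm (core i (n - 1) b \<xi>) + 2 * norm (core i (n + 1) (Suc b) \<xi>)"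
      unfolding core'_def by (rule order_trans[OF norm_triangle_ineq]) (simp add: norm_mult)
    also have "\<dots> \<le> L" unfolding L_def using B1[OF that] B2[OF that] by (intro add_mono mult_left_mono) auto
    finally show ?thesis .
  qed
  have L0: "L \<ge> 0" by (rule order_trans[OF norm_ge_zero L[of 0]]) (use S_pos in simp)
  \<comment> \<open>The closed ball is convex, so the whole segment stays where the derivative is
    bounded by \<open>L\<close>.\<close>
  have inside: "norm (core i n b (\<xi> + h *\<^sub>R ?e) - core i n b \<xi>) \<le> L * \<bar>h\<bar>"
    if "norm \<xi> \<le> sqrt S" "norm (\<xi> + h *\<^sub>R ?e) \<le> sqrt S" for \<xi> h
  proof -
    define G where "G \<tau> = core i n b (\<xi> + (\<tau> * h) *\<^sub>R ?e)" for \<tau>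
    have dG: "(G has_vector_derivative h *\<^sub>R core' i n b (\<xi> + (\<tau> * h) *\<^sub>R ?e)) (at \<tau>)" for \<tau>
    proof -
      have "((\<lambda>\<tau>. \<tau> * h) has_vector_derivative h) (at \<tau>)"
        unfolding has_real_derivative_iff_has_vector_derivative[symmetric] by (auto intro!: derivative_eq_intros)
      from vector_diff_chain_at[OF this core_has_vector_derivative] show ?thesis by (simp add: G_def[abs_def] o_def)
    qed
    have "\<exists>\<tau>\<in>{0<..<1}. norm (G 1 - G 0) \<le> norm ((\<lambda>u. u *\<^sub>R (h *\<^sub>R core' i n b (\<xi> + (\<tau> * h) *\<^sub>R ?e))) (1 - 0 :: real))"
    proof (rule mvt_general)
      show "continuous_on {0..1} G"
        by (intro continuous_at_imp_continuous_on ballI has_vector_derivative_continuous[OF dG])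
      show "(G has_derivative (\<lambda>u. u *\<^sub>R (h *\<^sub>R core' i n b (\<xi> + (\<tau> * h) *\<^sub>R ?e)))) (at \<tau>)" for \<tau>
        using dG[of \<tau>] unfolding has_vector_derivative_def .
    qed simp
    then obtain \<tau> where \<tau>: "0 < \<tau>" "\<tau> < 1" "norm (G 1 - G 0) \<le> \<bar>h\<bar> * norm (core' i n b (\<xi> + (\<tau> * h) *\<^sub>R ?e))"
      by auto
    have "norm (core' i n b (\<xi> + (\<tau> * h) *\<^sub>R ?e)) \<le> L"
      by (rule L, rule norm_convex_line[OF that]) (use \<tau> in auto)
    then have "\<bar>h\<bar> * norm (core' i n b (\<xi> + (\<tau> * h) *\<^sub>R ?e)) \<le> L * \<bar>h\<bar>"
      by (subst mult.commute) (rule mult_right_mono, auto)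
    then show ?thesis using \<tau>(3) by (simp add: G_def)
  qed
  \<comment> \<open>At the crossing point the function is 0, so its value at \<open>\<xi>\<close> is
    itself a difference over a step not longer than h.\<close>
  have cross: "norm (core i n b \<xi>) \<le> L * \<bar>h\<bar>"
    if "(norm \<xi>)\<^sup>2 < S" "\<not> (norm (\<xi> + h *\<^sub>R ?e))\<^sup>2 < S" for \<xi> h
  proof -
    have "continuous_on {0..1} (\<lambda>\<tau>. (norm (\<xi> + (\<tau> * h) *\<^sub>R ?e))\<^sup>2)" by (intro continuous_intros)
    then have "\<exists>\<tau>\<ge>0. \<tau> \<le> 1 \<and> (norm (\<xi> + (\<tau> * h) *\<^sub>R ?e))\<^sup>2 = S"
      using that by (intro IVT') auto
    then obtain \<tau> where \<tau>: "0 \<le> \<tau>" "\<tau> \<le> 1" "(norm (\<xi> + (\<tau> * h) *\<^sub>R ?e))\<^sup>2 = S"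
      by blast
    have "norm (\<xi> + (\<tau> * h) *\<^sub>R ?e) \<le> sqrt S" using \<tau>(3) by (intro real_le_rsqrt) simp
    moreover have "norm \<xi> \<le> sqrt S" using that(1) by (simp add: norm_sqr_less_iff)
    ultimately have "norm (core i n b (\<xi> + (\<tau> * h) *\<^sub>R ?e) - core i n b \<xi>) \<le> L * \<bar>\<tau> * h\<bar>"
      by (intro inside) auto
    also have "\<dots> \<le> L * \<bar>h\<bar>"
      using L0 \<tau> by (intro mult_left_mono) (auto simp: abs_mult mult_left_le_one_le)
    finally show ?thesis using core_boundary[OF b \<tau>(3)] by simp
  qed
  have "norm (trunc i n b (\<xi> + h *\<^sub>R ?e) - trunc i n b \<xi>) \<le> L * \<bar>h\<bar>" for \<xi> h
  proof -
    consider "(norm \<xi>)\<^sup>2 < S" "(norm (\<xi> + h *\<^sub>R ?e))\<^sup>2 < S" | "(norm \<xi>)\<^sup>2 < S" "\<not> (norm (\<xi> + h *\<^sub>R ?e))\<^sup>2 < S"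
      | "\<not> (norm \<xi>)\<^sup>2 < S" "(norm (\<xi> + h *\<^sub>R ?e))\<^sup>2 < S" | "\<not> (norm \<xi>)\<^sup>2 < S" "\<not> (norm (\<xi> + h *\<^sub>R ?e))\<^sup>2 < S"
      by blast
    then show ?thesis
    proof cases
      case 1
      then show ?thesis using inside[of \<xi> h] by (simp add: trunc_def norm_sqr_less_iff)
    next
      case 2
      then show ?thesis using cross[of \<xi> h] by (simp add: trunc_def)
    next
      case 3
      \<comment> \<open>The crossing is read backwards, from the endpoint inside the ball with step
        - h.\<close>
      then show ?thesis using cross[of "\<xi> + h *\<^sub>R ?e" "- h"] by (simp add: trunc_def)
    next
      case 4
      then show ?thesis using L0 by (simp add: trunc_def)
    qed
  qed
  then show ?thesis by blast
qed

text \<open>Off the sphere the truncation is locally either the smooth function or 0. The sphere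
  itself is a null set, which integration by parts tolerates.\<close>

lemma trunc_has_vector_derivative:
  assumes "(norm \<xi>)\<^sup>2 \<noteq> S"
  shows "((\<lambda>h. trunc i n b (\<xi> + h *\<^sub>R axis i 1)) has_vector_derivative trunc' i n b \<xi>) (at 0)"
proof -
  let ?N = "\<lambda>h. (norm (\<xi> + h *\<^sub>R axis i 1))\<^sup>2"
  have cont: "continuous_on UNIV ?N" by (intro continuous_intros)
  show ?thesis
  proof (cases "(norm \<xi>)\<^sup>2 < S")
    case True
    have "((\<lambda>h. core i n b (\<xi> + h *\<^sub>R axis i 1)) has_vector_derivative core' i n b (\<xi> + 0 *\<^sub>R axis i 1)) (at 0)"
      by (rule core_has_vector_derivative)
    moreover have "open {h. ?N h < S}" by (intro open_Collect_less cont continuous_on_const)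
    ultimately have "((\<lambda>h. trunc i n b (\<xi> + h *\<^sub>R axis i 1)) has_vector_derivative core' i n b (\<xi> + 0 *\<^sub>R axis i 1)) (at 0)"
      by (rule has_vector_derivative_transform_within_open) (use True in \<open>auto simp: trunc_def\<close>)
    then show ?thesis using True by (simp add: trunc'_def core'_def trunc_def)
  next
    case False
    then have "(norm \<xi>)\<^sup>2 > S" using assms by simp
    have "((\<lambda>h. 0) has_vector_derivative (0 :: complex)) (at (0::real))" by (rule has_vector_derivative_const)
    moreover have "open {h. S < ?N h}" by (intro open_Collect_less cont continuous_on_const)
    ultimately have "((\<lambda>h. trunc i n b (\<xi> + h *\<^sub>R axis i 1)) has_vector_derivative 0) (at 0)"
      by (rule has_vector_derivative_transform_within_open) (use \<open>S < (norm \<xi>)\<^sup>2\<close> in \<open>auto simp: trunc_def\<close>)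
    then show ?thesis using False by (simp add: trunc'_def trunc_def)
  qed
qed

end

context truncated_radial
begin

definition trunc_transform :: "'n::finite \<Rightarrow> nat \<Rightarrow> nat \<Rightarrow> real ^ 'n \<Rightarrow> complex" where
  "trunc_transform i n b y = (\<integral>\<xi>. trunc i n b \<xi> * wave y \<xi> \<partial>lborel)"

lemma trunc_integrable: "integrable lborel (trunc i n b)"
proof -
  obtain B where "\<And>\<xi>. norm (trunc i n b \<xi>) \<le> B" using trunc_bounded by blast
  then show ?thesis by (rule integrable_bounded_support[OF trunc_meas _ trunc_supp])
qed

lemma trunc_wave_integrable: "integrable lborel (\<lambda>\<xi>. trunc i n b \<xi> * wave y \<xi>)"
  by (rule Bochner_Integration.integrable_bound[OF trunc_integrable[of i n b]]) (auto simp: norm_mult)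

lemma AE_not_sphere: "AE \<xi> in (lborel :: (real ^ 'n) measure). (norm \<xi>)\<^sup>2 \<noteq> S"
proof (rule AE_I')
  have "sphere (0 :: real ^ 'n) (sqrt S) \<in> null_sets lebesgue"
    using negligible_sphere by (simp add: negligible_iff_null_sets)
  then show "sphere (0 :: real ^ 'n) (sqrt S) \<in> null_sets lborel"
    by (subst (asm) null_sets_completion_iff) auto
  show "{\<xi> \<in> space lborel. \<not> (norm \<xi>)\<^sup>2 \<noteq> S} \<subseteq> sphere (0 :: real ^ 'n) (sqrt S)"
    by auto
qed

text \<open>Integration by parts trades the factor y_i for a derivative. For b < p the truncation is
  Lipschitz across the sphere, so no boundary term appears.\<close>

lemma trunc_transform_recursion:
  assumes b: "b < p"
  shows "of_nat n * trunc_transform i (n - 1) b y + 2 * trunc_transform i (n + 1) (Suc b) y = - (2 * pi * \<i> * y $ i) * trunc_transform i n b y"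
proof -
  obtain B where B: "\<And>\<xi>. norm (trunc i n b \<xi>) \<le> B" using trunc_bounded by blast
  obtain L where L: "\<And>\<xi> h. norm (trunc i n b (\<xi> + h *\<^sub>R axis i 1) - trunc i n b \<xi>) \<le> L * \<bar>h\<bar>"
    using trunc_lipschitz[OF b] by blast
  have "(\<integral>\<xi>. trunc' i n b \<xi> * wave y \<xi> \<partial>lborel) = - (2 * pi * \<i> * y $ i) * (\<integral>\<xi>. trunc i n b \<xi> * wave y \<xi> \<partial>lborel)"
  proof (rule integral_by_parts_wave[OF trunc_meas _ B trunc_supp L])
    show "trunc' i n b \<in> borel_measurable borel" unfolding trunc'_def[abs_def] by measurable
    show "AE \<xi> in lborel. ((\<lambda>h. trunc i n b (\<xi> + h *\<^sub>R axis i 1)) has_vector_derivative trunc' i n b \<xi>) (at 0)"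
      using AE_not_sphere by eventually_elim (rule trunc_has_vector_derivative)
  qed
  moreover have "(\<integral>\<xi>. trunc' i n b \<xi> * wave y \<xi> \<partial>lborel)
     = (\<integral>\<xi>. of_nat n * (trunc i (n - 1) b \<xi> * wave y \<xi>) + 2 * (trunc i (n + 1) (Suc b) \<xi> * wave y \<xi>) \<partial>lborel)"
    by (intro Bochner_Integration.integral_cong refl) (simp add: trunc'_def algebra_simps)
  moreover have "\<dots> = of_nat n * trunc_transform i (n - 1) b y + 2 * trunc_transform i (n + 1) (Suc b) y"
    by (subst Bochner_Integration.integral_add, intro integrable_mult_right trunc_wave_integrable,
        intro integrable_mult_right trunc_wave_integrable) (simp only: integral_mult_right_zero trunc_transform_def)
  ultimately show ?thesis by (simp add: trunc_transform_def)
qed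

text \<open>Square sums are controlled rather than individual values. The recursion trades one power
  of the coordinate for two transforms, one of them with b raised by 1. The condition b + q \<le> p
  lets this continue down to q = 0, where Bessel's inequality for a bounded function
  finishes.\<close>

lemma trunc_transform_decay:
  fixes x :: "real ^ 'n"
  assumes "b + q \<le> p"
  shows "\<exists>C. \<forall>F. finite F \<and> F \<subseteq> int_lattice \<longrightarrow> (\<Sum>m\<in>F. (\<bar>(x - m) $ i\<bar> ^ q * norm (trunc_transform i n b (x - m)))\<^sup>2) \<le> C"
  using assms
proof (induction q arbitrary: n b)
  case 0
  obtain B where B: "\<And>\<xi>. norm (trunc i n b \<xi>) \<le> B" using trunc_bounded by blast
  \<comment> \<open>The extra factor \<open>wave x\<close> shifts the frequencies from - m to x -
    m.\<close>
  have "\<exists>C. \<forall>F. finite F \<and> F \<subseteq> int_lattice \<longrightarrow> (\<Sum>m\<in>F. (norm (\<integral>\<xi>. (trunc i n b \<xi> * wave x \<xi>) * wave (- m) \<xi> \<partial>lborel))\<^sup>2) \<le> C"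
    by (rule bessel_inequality_lattice[of _ B "sqrt S"]) (auto simp: norm_mult B trunc_supp)
  moreover have "(\<integral>\<xi>. (trunc i n b \<xi> * wave x \<xi>) * wave (- m) \<xi> \<partial>lborel) = trunc_transform i n b (x - m)" for m
    unfolding trunc_transform_def using wave_add(1)[of x "- m"] by (simp add: mult.assoc)
  ultimately show ?case by simp
next
  case (Suc q)
  have "b + q \<le> p" "Suc b + q \<le> p" "b < p" using Suc.prems by auto
  obtain C1 where C1: "\<And>F. finite F \<Longrightarrow> F \<subseteq> int_lattice \<Longrightarrow> (\<Sum>m\<in>F. (\<bar>(x - m) $ i\<bar> ^ q * norm (trunc_transform i (n - 1) b (x - m)))\<^sup>2) \<le> C1"
    using Suc.IH[OF \<open>b + q \<le> p\<close>, of "n - 1"] by blast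
  obtain C2 where C2: "\<And>F. finite F \<Longrightarrow> F \<subseteq> int_lattice \<Longrightarrow> (\<Sum>m\<in>F. (\<bar>(x - m) $ i\<bar> ^ q * norm (trunc_transform i (n + 1) (Suc b) (x - m)))\<^sup>2) \<le> C2"
    using Suc.IH[OF \<open>Suc b + q \<le> p\<close>, of "n + 1"] by blast
  have step: "(\<bar>y $ i\<bar> ^ Suc q * norm (trunc_transform i n b y))\<^sup>2
     \<le> 2 * (real n)\<^sup>2 * (\<bar>y $ i\<bar> ^ q * norm (trunc_transform i (n - 1) b y))\<^sup>2 + 8 * (\<bar>y $ i\<bar> ^ q * norm (trunc_transform i (n + 1) (Suc b) y))\<^sup>2" for y
  proof -
    let ?A = "norm (trunc_transform i (n - 1) b y)" and ?B = "norm (trunc_transform i (n + 1) (Suc b) y)"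
    have "2 * pi * (\<bar>y $ i\<bar> * norm (trunc_transform i n b y)) = norm (of_nat n * trunc_transform i (n - 1) b y + 2 * trunc_transform i (n + 1) (Suc b) y)"
      unfolding trunc_transform_recursion[OF \<open>b < p\<close>] by (simp add: norm_mult)
    also have "\<dots> \<le> real n * ?A + 2 * ?B"
      by (rule order_trans[OF norm_triangle_ineq]) (simp add: norm_mult)
    finally have "2 * pi * (\<bar>y $ i\<bar> * norm (trunc_transform i n b y)) \<le> real n * ?A + 2 * ?B" .
    moreover have "1 * (\<bar>y $ i\<bar> * norm (trunc_transform i n b y)) \<le> 2 * pi * (\<bar>y $ i\<bar> * norm (trunc_transform i n b y))"
      by (rule mult_right_mono) (use pi_gt3 in auto)
    ultimately have "\<bar>y $ i\<bar> * norm (trunc_transform i n b y) \<le> real n * ?A + 2 * ?B" by simp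
    from mult_left_mono[OF this, of "\<bar>y $ i\<bar> ^ q"]
    have "\<bar>y $ i\<bar> ^ Suc q * norm (trunc_transform i n b y) \<le> real n * (\<bar>y $ i\<bar> ^ q * ?A) + 2 * (\<bar>y $ i\<bar> ^ q * ?B)"
      by (simp add: algebra_simps)
    then have "(\<bar>y $ i\<bar> ^ Suc q * norm (trunc_transform i n b y))\<^sup>2 \<le> (real n * (\<bar>y $ i\<bar> ^ q * ?A) + 2 * (\<bar>y $ i\<bar> ^ q * ?B))\<^sup>2"
      by (intro power_mono) auto
    also have "\<dots> \<le> 2 * (real n)\<^sup>2 * (\<bar>y $ i\<bar> ^ q * ?A)\<^sup>2 + 8 * (\<bar>y $ i\<bar> ^ q * ?B)\<^sup>2"
    proof -
      have "(a + 2 * c)\<^sup>2 \<le> 2 * a\<^sup>2 + 8 * c\<^sup>2" for a c :: real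
        using zero_le_power2[of "a - 2 * c"] by (simp add: power2_eq_square algebra_simps)
      from this[of "real n * (\<bar>y $ i\<bar> ^ q * ?A)" "\<bar>y $ i\<bar> ^ q * ?B"] show ?thesis
        by (simp add: power_mult_distrib mult.assoc)
    qed
    finally show ?thesis .
  qed
  have "(\<Sum>m\<in>F. (\<bar>(x - m) $ i\<bar> ^ Suc q * norm (trunc_transform i n b (x - m)))\<^sup>2) \<le> 2 * (real n)\<^sup>2 * C1 + 8 * C2"
    if F: "finite F" "F \<subseteq> int_lattice" for F
  proof -
    have "(\<Sum>m\<in>F. (\<bar>(x - m) $ i\<bar> ^ Suc q * norm (trunc_transform i n b (x - m)))\<^sup>2)
      \<le> (\<Sum>m\<in>F. 2 * (real n)\<^sup>2 * (\<bar>(x - m) $ i\<bar> ^ q * norm (trunc_transform i (n - 1) b (x - m)))\<^sup>2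
           + 8 * (\<bar>(x - m) $ i\<bar> ^ q * norm (trunc_transform i (n + 1) (Suc b) (x - m)))\<^sup>2)"
      by (intro sum_mono step)
    also have "\<dots> = 2 * (real n)\<^sup>2 * (\<Sum>m\<in>F. (\<bar>(x - m) $ i\<bar> ^ q * norm (trunc_transform i (n - 1) b (x - m)))\<^sup>2)
      + 8 * (\<Sum>m\<in>F. (\<bar>(x - m) $ i\<bar> ^ q * norm (trunc_transform i (n + 1) (Suc b) (x - m)))\<^sup>2)"
      by (simp add: sum.distrib sum_distrib_left)
    also have "\<dots> \<le> 2 * (real n)\<^sup>2 * C1 + 8 * C2"
      by (intro add_mono mult_left_mono C1[OF F] C2[OF F]) auto
    finally show ?thesis .
  qed
  then show ?case by blast
qed

end

section \<open>Absolute summability over the lattice\<close>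

lemma sum_int_powr_bounded:
  assumes a: "a > (1::real)"
  obtains V where "V \<ge> 0" "\<And>T. finite T \<Longrightarrow> T \<subseteq> \<int> \<Longrightarrow> (\<Sum>t\<in>T. (1 + \<bar>t\<bar>) powr - a) \<le> V"
proof
  let ?v = "\<lambda>t::real. (1 + \<bar>t\<bar>) powr - a"
  have "summable (\<lambda>n. real n powr - a)" using a by (subst summable_real_powr_iff) simp
  then have "summable (\<lambda>n. real (Suc n) powr - a)" by (subst summable_Suc_iff)
  then have sm: "summable (\<lambda>n. ?v (real n))" by (simp add: add.commute)
  let ?V = "\<Sum>n. ?v (real n)"
  show "0 \<le> 2 * ?V" using sm by (simp add: suminf_nonneg)
  fix T :: "real set" assume T: "finite T" "T \<subseteq> \<int>"
  \<comment> \<open>Where the absolute value is injective, the sum is part of a series over the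
    naturals. It is injective on the nonnegative and on the negative integers, whence the factor
    2.\<close>
  have part: "(\<Sum>t\<in>U. ?v t) \<le> ?V" if U: "finite U" "U \<subseteq> \<int>" "inj_on abs U" for U
  proof -
    define g where "g t = nat \<lfloor>\<bar>t\<bar>\<rfloor>" for t :: real
    have g: "real (g t) = \<bar>t\<bar>" if "t \<in> U" for t
    proof -
      obtain n where "t = of_int n" using \<open>t \<in> U\<close> U(2) by (meson Ints_cases subsetD)
      then show ?thesis by (simp add: g_def flip: of_int_abs)
    qed
    then have inj: "inj_on g U" using U(3) by (metis inj_onD inj_onI)
    have "(\<Sum>t\<in>U. ?v t) = (\<Sum>t\<in>U. ?v (real (g t)))" by (intro sum.cong) (auto simp: g)
    also have "\<dots> = (\<Sum>n\<in>g ` U. ?v (real n))" using inj by (simp add: sum.reindex)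
    also have "\<dots> \<le> ?V" using sm U(1) by (intro sum_le_suminf) auto
    finally show ?thesis .
  qed
  have "(\<Sum>t\<in>T. ?v t) = (\<Sum>t\<in>T \<inter> {0..}. ?v t) + (\<Sum>t\<in>T - {0..}. ?v t)"
    using T(1) by (rule sum.Int_Diff)
  also have "\<dots> \<le> ?V + ?V"
    by (intro add_mono part) (use T in \<open>auto simp: inj_on_def\<close>)
  finally show "(\<Sum>t\<in>T. ?v t) \<le> 2 * ?V" by simp
qed

lemma sum_vec_prod:
  fixes v :: "real \<Rightarrow> real"
  assumes T: "finite T"
  shows "(\<Sum>m\<in>{m :: real ^ 'n. \<forall>i. m $ i \<in> T}. \<Prod>i\<in>UNIV. v (m $ i)) = (\<Sum>t\<in>T. v t) ^ CARD('n)"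
proof -
  have "(\<Prod>i\<in>(UNIV::'n set). \<Sum>t\<in>T. v t) = (\<Sum>g\<in>PiE (UNIV :: 'n set) (\<lambda>_. T). \<Prod>i\<in>UNIV. v (g i))"
    by (rule prod_sum_PiE) (use T in auto)
  also have "\<dots> = (\<Sum>m\<in>{m :: real ^ 'n. \<forall>i. m $ i \<in> T}. \<Prod>i\<in>UNIV. v (m $ i))"
    by (rule sum.reindex_bij_witness[of _ "\<lambda>m i. m $ i" "\<lambda>g. \<chi> i. g i"]) auto
  finally show ?thesis by simp
qed

text \<open>
  The exponent exceeds the dimension, so the weights dominate a product of summable
  one-dimensional weights, each coordinate contributing the power \<open>2p/d > 1\<close>.
\<close>

lemma sum_inverse_weight_bounded:
  fixes x :: "real ^ 'n"
  assumes x: "x \<in> torus" and p: "2 * p > CARD('n)"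
  shows "\<exists>C. \<forall>F. finite F \<and> F \<subseteq> int_lattice \<longrightarrow> (\<Sum>m\<in>F. 1 / (1 + (\<Sum>i\<in>UNIV. \<bar>(x - m) $ i\<bar> ^ (2 * p)))) \<le> C"
proof -
  define w where "w m = 1 + (\<Sum>i\<in>UNIV. \<bar>(x - m) $ i\<bar> ^ (2 * p))" for m
  define a where "a = real (2 * p) / real CARD('n)"
  have a: "a > 1" using p by (simp add: a_def)
  obtain V where V: "V \<ge> 0" "\<And>T. finite T \<Longrightarrow> T \<subseteq> \<int> \<Longrightarrow> (\<Sum>t\<in>T. (1 + \<bar>t\<bar>) powr - a) \<le> V"
    using sum_int_powr_bounded[OF a] by blast
  have w1: "w m \<ge> 1" for m unfolding w_def by (simp add: sum_nonneg)
  \<comment> \<open>As x lies in the cell, |m_i| \<le> t + 1/2 with t = |(x - m)_i|, hence 1 + |m_i|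
    \<le> 4 max(1, t).\<close>
  have coord: "(1 + \<bar>m $ i\<bar>) ^ (2 * p) \<le> 4 ^ (2 * p) * w m" for m i
  proof -
    let ?t = "\<bar>(x - m) $ i\<bar>"
    have "- 1 / 2 < x $ i" "x $ i \<le> 1 / 2" using x by (auto simp: torus_def)
    then have "\<bar>m $ i\<bar> \<le> ?t + 1 / 2" unfolding vector_minus_component by linarith
    moreover have "1 \<le> max 1 ?t" "?t \<le> max 1 ?t" by simp_all
    ultimately have "1 + \<bar>m $ i\<bar> \<le> 4 * max 1 ?t" by linarith
    then have "(1 + \<bar>m $ i\<bar>) ^ (2 * p) \<le> (4 * max 1 ?t) ^ (2 * p)" by (intro power_mono) auto
    also have "\<dots> = 4 ^ (2 * p) * (max 1 ?t) ^ (2 * p)" by (simp add: power_mult_distrib)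
    also have "(max 1 ?t) ^ (2 * p) \<le> w m"
    proof -
      have "?t ^ (2 * p) \<le> (\<Sum>i\<in>UNIV. \<bar>(x - m) $ i\<bar> ^ (2 * p))" by (rule member_le_sum) auto
      then show ?thesis using w1[of m] by (auto simp: max_def w_def)
    qed
    finally show ?thesis by simp
  qed
  \<comment> \<open>Each of the d coordinates is compared with the d-th root of the common bound, so
    the product over the coordinates restores the bound itself.\<close>
  have main: "1 / w m \<le> 4 ^ (2 * p) * (\<Prod>i\<in>UNIV. (1 + \<bar>m $ i\<bar>) powr - a)" for m
  proof -
    let ?X = "4 ^ (2 * p) * w m"
    have X: "?X > 0" using w1[of m] by simp
    have "(\<Prod>i\<in>(UNIV :: 'n set). (1 + \<bar>m $ i\<bar>) powr a) \<le> (\<Prod>i\<in>(UNIV :: 'n set). ?X powr (1 / real CARD('n)))"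
    proof (rule prod_mono, rule conjI)
      fix i
      have "(1 + \<bar>m $ i\<bar>) powr a = ((1 + \<bar>m $ i\<bar>) ^ (2 * p)) powr (1 / real CARD('n))"
        by (subst powr_realpow[symmetric]) (auto simp: powr_powr a_def)
      also have "\<dots> \<le> ?X powr (1 / real CARD('n))"
        by (rule powr_mono2) (use coord in auto)
      finally show "(1 + \<bar>m $ i\<bar>) powr a \<le> ?X powr (1 / real CARD('n))" .
    qed simp
    also have "\<dots> = (?X powr (1 / real CARD('n))) ^ CARD('n)" by simp
    also have "\<dots> = ?X powr (1 / real CARD('n) * real CARD('n))"
    proof -
      have "?X powr (1 / real CARD('n)) > 0" using w1[of m] by simp
      from powr_realpow[OF this, of "CARD('n)"] show ?thesis by (simp only: powr_powr)
    qed
    also have "\<dots> = ?X" using X w1[of m] by simp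
    finally have "(\<Prod>i\<in>(UNIV :: 'n set). (1 + \<bar>m $ i\<bar>) powr a) \<le> ?X" .
    moreover have pos: "(\<Prod>i\<in>(UNIV :: 'n set). (1 + \<bar>m $ i\<bar>) powr a) > 0" by (intro prod_pos) auto
    moreover have "(\<Prod>i\<in>(UNIV :: 'n set). (1 + \<bar>m $ i\<bar>) powr - a) = 1 / (\<Prod>i\<in>(UNIV :: 'n set). (1 + \<bar>m $ i\<bar>) powr a)"
      by (simp add: powr_minus_divide prod_dividef)
    ultimately show ?thesis using w1[of m] by (simp add: field_simps)
  qed
  have "(\<Sum>m\<in>F. 1 / w m) \<le> 4 ^ (2 * p) * V ^ CARD('n)" if F: "finite F" "F \<subseteq> int_lattice" for F
  proof -
    \<comment> \<open>Enlarging \<open>F\<close> to all vectors with coordinates in \<open>T\<close>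
      makes the sum of products factor.\<close>
    define T where "T = (\<Union>m\<in>F. range (\<lambda>i. m $ i))"
    have T: "finite T" "T \<subseteq> \<int>" using F by (auto simp: T_def int_lattice_def)
    have "(\<Sum>m\<in>F. 1 / w m) \<le> (\<Sum>m\<in>F. 4 ^ (2 * p) * (\<Prod>i\<in>UNIV. (1 + \<bar>m $ i\<bar>) powr - a))"
      by (intro sum_mono main)
    also have "\<dots> \<le> (\<Sum>m\<in>{m :: real ^ 'n. \<forall>i. m $ i \<in> T}. 4 ^ (2 * p) * (\<Prod>i\<in>UNIV. (1 + \<bar>m $ i\<bar>) powr - a))"
      by (intro sum_mono2 finite_vec_coordinates T) (auto simp: T_def intro!: mult_nonneg_nonneg prod_nonneg)
    also have "\<dots> = 4 ^ (2 * p) * (\<Sum>t\<in>T. (1 + \<bar>t\<bar>) powr - a) ^ CARD('n)"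
      by (subst sum_vec_prod[OF T(1), symmetric]) (simp add: sum_distrib_left)
    also have "\<dots> \<le> 4 ^ (2 * p) * V ^ CARD('n)"
      by (intro mult_left_mono power_mono V T) (auto intro!: sum_nonneg)
    finally show ?thesis .
  qed
  then show ?thesis unfolding w_def by blast
qed

context truncated_radial
begin

text \<open>The Cauchy-Schwarz inequality in the additive form 2K \<le> w K^2 + 1/w, with w = 1 +
  sum_i |(x - m)_i|^(2p). The sums of w K^2 are bounded by the decay estimates with q = 0 and q = p,
  those of 1/w because 2p exceeds the dimension.\<close>

lemma trunc_transform_abs_summable:
  fixes x :: "real ^ 'n"
  assumes x: "x \<in> torus" and p: "2 * p > CARD('n)"
  shows "(\<lambda>m. norm (\<integral>\<xi>. (if (norm \<xi>)\<^sup>2 < S then P 0 ((norm \<xi>)\<^sup>2) else 0) * wave (x - m) \<xi> \<partial>lborel)) summable_on int_lattice"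
proof -
  define K where "K m = norm (\<integral>\<xi>. (if (norm \<xi>)\<^sup>2 < S then P 0 ((norm \<xi>)\<^sup>2) else 0) * wave (x - m) \<xi> \<partial>lborel)" for m
  have K: "norm (trunc_transform i 0 0 (x - m)) = K m" for i m
    unfolding K_def trunc_transform_def trunc_def core_def power_0 scaleR_one ..
  have "\<forall>i. \<exists>C. \<forall>F. finite F \<and> F \<subseteq> int_lattice \<longrightarrow> (\<Sum>m\<in>F. (\<bar>(x - m) $ i\<bar> ^ p * K m)\<^sup>2) \<le> C"
  proof
    fix i
    show "\<exists>C. \<forall>F. finite F \<and> F \<subseteq> int_lattice \<longrightarrow> (\<Sum>m\<in>F. (\<bar>(x - m) $ i\<bar> ^ p * K m)\<^sup>2) \<le> C"
      using trunc_transform_decay[of 0 p x i 0] by (simp add: K)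
  qed
  from choice[OF this]
  obtain C where C: "\<forall>i F. finite F \<and> F \<subseteq> int_lattice \<longrightarrow> (\<Sum>m\<in>F. (\<bar>(x - m) $ i\<bar> ^ p * K m)\<^sup>2) \<le> C i"
    by (elim exE)
  \<comment> \<open>For q = 0 the coordinate enters with exponent 0, so an arbitrary index stands in
    for it.\<close>
  have "\<exists>C. \<forall>F. finite F \<and> F \<subseteq> int_lattice \<longrightarrow> (\<Sum>m\<in>F. (K m)\<^sup>2) \<le> C"
    using trunc_transform_decay[of 0 0 x undefined 0] by (simp add: K)
  then obtain C0 where C0: "\<forall>F. finite F \<and> F \<subseteq> int_lattice \<longrightarrow> (\<Sum>m\<in>F. (K m)\<^sup>2) \<le> C0"
    by (elim exE)
  define w where "w m = 1 + (\<Sum>i\<in>UNIV. \<bar>(x - m) $ i\<bar> ^ (2 * p))" for m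
  obtain W where W: "\<forall>F. finite F \<and> F \<subseteq> int_lattice \<longrightarrow> (\<Sum>m\<in>F. 1 / w m) \<le> W"
    using sum_inverse_weight_bounded[OF x p] unfolding w_def by (elim exE)
  have w1: "w m \<ge> 1" for m unfolding w_def by (simp add: sum_nonneg)
  have bound: "(\<Sum>m\<in>F. K m) \<le> C0 + (\<Sum>i\<in>UNIV. C i) + W" if F: "finite F" "F \<subseteq> int_lattice" for F
  proof -
    have "K m \<le> w m * (K m)\<^sup>2 + 1 / w m" for m
    proof -
      have "0 \<le> (w m * K m - 1)\<^sup>2 / w m" using w1[of m] by simp
      also have "\<dots> = w m * (K m)\<^sup>2 - 2 * K m + 1 / w m"
        using w1[of m] by (simp add: power2_eq_square field_simps)
      finally have "2 * K m \<le> w m * (K m)\<^sup>2 + 1 / w m" by simp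
      moreover have "K m \<ge> 0" by (simp add: K_def)
      ultimately show ?thesis by linarith
    qed
    then have "(\<Sum>m\<in>F. K m) \<le> (\<Sum>m\<in>F. w m * (K m)\<^sup>2 + 1 / w m)" by (rule sum_mono)
    also have "\<dots> = (\<Sum>m\<in>F. (K m)\<^sup>2) + (\<Sum>i\<in>UNIV. \<Sum>m\<in>F. (\<bar>(x - m) $ i\<bar> ^ p * K m)\<^sup>2) + (\<Sum>m\<in>F. 1 / w m)"
    proof -
      have "w m * (K m)\<^sup>2 = (K m)\<^sup>2 + (\<Sum>i\<in>UNIV. (\<bar>(x - m) $ i\<bar> ^ p * K m)\<^sup>2)" for m
        unfolding w_def by (simp only: distrib_right sum_distrib_right power_mult_distrib power_mult[symmetric] mult.commute[of p 2] mult_1)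
      then show ?thesis by (subst sum.swap) (simp add: sum.distrib)
    qed
    also have "\<dots> \<le> C0 + (\<Sum>i\<in>UNIV. C i) + W"
      by (intro add_mono sum_mono C0[rule_format] C[rule_format] W[rule_format] conjI F)
    finally show ?thesis .
  qed
  have "K summable_on int_lattice"
  proof (rule nonneg_bdd_above_summable_on)
    show "bdd_above (sum K ` {F. F \<subseteq> int_lattice \<and> finite F})"
      by (rule bdd_aboveI[of _ "C0 + (\<Sum>i\<in>UNIV. C i) + W"]) (auto intro: bound)
  qed (simp add: K_def)
  then show ?thesis by (simp only: K_def[abs_def])
qed

end

section \<open>The Taylor remainder\<close>

text \<open>The index b counts derivatives with respect to u, so that the family fits
  \<open>truncated_radial\<close>. For b = J + 1 the sum is empty and \<open>B (Suc J)\<close> is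
  left.\<close>

definition taylor_remainder :: "(nat \<Rightarrow> real \<Rightarrow> complex) \<Rightarrow> nat \<Rightarrow> real \<Rightarrow> nat \<Rightarrow> real \<Rightarrow> complex" where
  "taylor_remainder B J S b u = B b u - (\<Sum>j=b..J. of_real ((u - S) ^ (j - b) / fact (j - b)) * B j S)"

lemma taylor_remainder_deriv:
  assumes B: "\<And>j u. (B j has_vector_derivative B (Suc j) u) (at u)"
  shows "(taylor_remainder B J S b has_vector_derivative taylor_remainder B J S (Suc b) u) (at u)"
proof -
  have summand: "((\<lambda>u. of_real ((u - S) ^ k / fact k) * c) has_vector_derivative
      (if k = 0 then 0 else of_real ((u - S) ^ (k - 1) / fact (k - 1)) * c)) (at u)" for k and c :: complex
  proof -
    have "((\<lambda>u. (u - S) ^ k / fact k) has_real_derivative (if k = 0 then 0 else (u - S) ^ (k - 1) / fact (k - 1))) (at u)"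
    proof (cases k)
      case (Suc m)
      have "((\<lambda>u. (u - S) ^ Suc m / fact (Suc m)) has_real_derivative (real (Suc m) * (u - S) ^ m) / fact (Suc m)) (at u)"
      proof -
        have "((\<lambda>u. u - S) has_real_derivative 1) (at u)" by (auto intro!: derivative_eq_intros)
        from DERIV_cdivide[OF DERIV_power_Suc[OF this, of m], of "fact (Suc m)"] show ?thesis
          by (simp add: add.commute)
      qed
      also have "(real (Suc m) * (u - S) ^ m) / fact (Suc m) = (u - S) ^ m / fact m" by simp
      finally show ?thesis using Suc by simp
    qed simp
    from has_vector_derivative_mult_left[OF has_vector_derivative_of_real[OF this], of c]
    show ?thesis by (simp split: if_splits)
  qed
  have "((\<lambda>u. \<Sum>j=b..J. of_real ((u - S) ^ (j - b) / fact (j - b)) * B j S) has_vector_derivative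
      (\<Sum>j=b..J. if j - b = 0 then 0 else of_real ((u - S) ^ (j - b - 1) / fact (j - b - 1)) * B j S)) (at u)"
    by (intro has_vector_derivative_sum summand)
  also have "(\<Sum>j=b..J. if j - b = 0 then 0 else of_real ((u - S) ^ (j - b - 1) / fact (j - b - 1)) * B j S)
     = (\<Sum>j=Suc b..J. of_real ((u - S) ^ (j - Suc b) / fact (j - Suc b)) * B j S)"
    by (intro sum.mono_neutral_cong_right) auto
  finally show ?thesis
    unfolding taylor_remainder_def[abs_def] by (intro has_vector_derivative_diff B)
qed

lemma taylor_remainder_at:
  assumes "b \<le> J"
  shows "taylor_remainder B J S b S = 0"
proof -
  have "(\<Sum>j=b..J. of_real ((S - S) ^ (j - b) / fact (j - b)) * B j S) = (\<Sum>j=b..J. if j = b then B b S else 0)"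
    by (intro sum.cong) (auto simp: power_0_left)
  then show ?thesis using assms by (simp add: taylor_remainder_def)
qed

text \<open>The expansion point S is the right end of the interval. Reflecting t to - t makes it the
  left end, as in the usual integral form of Taylor's formula, and the J + 1 derivatives of the
  reflected function account for the sign.\<close>

lemma taylor_remainder_integral:
  assumes B: "\<And>j u. (B j has_vector_derivative B (Suc j) u) (at u)" and u: "u \<le> S"
  shows "(\<integral>s. indicator {u..S} s *\<^sub>R (((s - u) ^ J / fact J) *\<^sub>R B (Suc J) s) \<partial>lborel) = (- 1) ^ Suc J * taylor_remainder B J S 0 u"
proof -
  let ?P = "taylor_remainder B J S"
  define Df where "Df m t = (- 1) ^ m * ?P m (- t)" for m t
  have Df: "(Df m has_vector_derivative Df (Suc m) t) (at t within {- S..- u})" for m t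
  proof -
    have "((\<lambda>t. - t) has_vector_derivative - 1) (at t)" by (auto intro!: derivative_eq_intros)
    from vector_diff_chain_at[OF this taylor_remainder_deriv[where B=B, OF B]]
    have "((\<lambda>t. ?P m (- t)) has_vector_derivative - ?P (Suc m) (- t)) (at t)" by (simp add: o_def)
    from has_vector_derivative_mult_right[OF this, of "(- 1) ^ m"] show ?thesis
      unfolding Df_def[abs_def] by (simp add: has_vector_derivative_at_within)
  qed
  have PB: "?P (Suc J) = B (Suc J)" by (simp add: taylor_remainder_def fun_eq_iff)
  have "((\<lambda>t. ((- u - t) ^ (Suc J - 1) / fact (Suc J - 1)) *\<^sub>R Df (Suc J) t) has_integral
     Df 0 (- u) - (\<Sum>i<Suc J. ((- u - - S) ^ i / fact i) *\<^sub>R Df i (- S))) {- S..- u}"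
    by (rule Taylor_has_integral[where f="Df 0"]) (use u Df in auto)
  moreover have "Df i (- S) = 0" if "i < Suc J" for i
    using that taylor_remainder_at[of i J B S] by (simp add: Df_def)
  ultimately have "((\<lambda>t. ((- u - t) ^ J / fact J) *\<^sub>R ((- 1) ^ Suc J * B (Suc J) (- t))) has_integral ?P 0 u) {- S..- u}"
    by (simp add: Df_def PB)
  then have "((\<lambda>t. ((- u + t) ^ J / fact J) *\<^sub>R ((- 1) ^ Suc J * B (Suc J) t)) has_integral ?P 0 u) {u..S}"
    by (subst (asm) has_integral_reflect_real[symmetric]) simp
  from has_integral_mult_right[OF this, of "(- 1) ^ Suc J"]
  have HK: "((\<lambda>s. ((s - u) ^ J / fact J) *\<^sub>R B (Suc J) s) has_integral (- 1) ^ Suc J * ?P 0 u) {u..S}"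
    by (simp add: scaleR_conv_of_real mult_ac flip: power_mult_distrib mult.assoc)
  have "continuous_on {u..S} (\<lambda>s. ((s - u) ^ J / fact J) *\<^sub>R B (Suc J) s)"
    by (intro continuous_intros continuous_at_imp_continuous_on ballI has_vector_derivative_continuous[OF B]) auto
  then have "set_integrable lborel {u..S} (\<lambda>s. ((s - u) ^ J / fact J) *\<^sub>R B (Suc J) s)"
    unfolding set_integrable_def by (rule borel_integrable_compact[OF compact_Icc])
  from set_borel_integral_eq_integral(2)[OF this] integral_unique[OF HK]
  show ?thesis by (simp add: set_lebesgue_integral_def)
qed

section \<open>Riesz means of integer order and the remainder integral\<close>

lemma Gamma_real_Suc: "Gamma (real j + 1) = fact j"
  using Gamma_fact[of j, where 'a=real] by (simp add: add.commute)

text \<open>The strict inequality in the range of summation keeps the base positive, so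
  \<open>powr\<close> is the ordinary power even for j = 0.\<close>

lemma D_lattice_nat:
  "D_lattice (real j) s x = (\<Sum>m\<in>{m \<in> int_lattice. (norm m)\<^sup>2 < s}. of_real ((s - (norm m)\<^sup>2) ^ j / fact j) * wave x m)"
  unfolding D_lattice_def Gamma_real_Suc sum_distrib_left
proof (rule sum.cong[OF refl])
  fix m :: "real ^ 'a" assume "m \<in> {m \<in> int_lattice. (norm m)\<^sup>2 < s}"
  then have "(s - (norm m)\<^sup>2) powr real j = (s - (norm m)\<^sup>2) ^ j" by (intro powr_realpow) simp
  then show "of_real (1 / fact j) * (of_real ((s - (norm m)\<^sup>2) powr real j) * cis (2 * pi * (m \<bullet> x)))
     = of_real ((s - (norm m)\<^sup>2) ^ j / fact j) * wave x m"
    by (simp add: wave_def inner_commute)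
qed

lemma D_cont_nat:
  fixes y :: "real ^ 'n"
  shows "D_cont (real j) s y = (\<integral>\<xi>. indicator {\<xi>. (norm \<xi>)\<^sup>2 < s} \<xi> *\<^sub>R (of_real ((s - (norm \<xi>)\<^sup>2) ^ j / fact j) * wave y \<xi>) \<partial>lborel)"
proof -
  have eq: "indicator {\<xi>. (norm \<xi>)\<^sup>2 < s} \<xi> *\<^sub>R (of_real ((s - (norm \<xi>)\<^sup>2) powr real j) * cis (2 * pi * (\<xi> \<bullet> y)))
     = indicator {\<xi>. (norm \<xi>)\<^sup>2 < s} \<xi> *\<^sub>R (of_real ((s - (norm \<xi>)\<^sup>2) ^ j) * wave y \<xi>)" for \<xi>
  proof (cases "(norm \<xi>)\<^sup>2 < s")
    case True
    then have "(s - (norm \<xi>)\<^sup>2) powr real j = (s - (norm \<xi>)\<^sup>2) ^ j" by (intro powr_realpow) simp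
    then show ?thesis by (simp add: wave_def inner_commute)
  qed simp
  have meas: "(\<lambda>\<xi>. indicator {\<xi>. (norm \<xi>)\<^sup>2 < s} \<xi> *\<^sub>R (of_real ((s - (norm \<xi>)\<^sup>2) ^ j) * wave y \<xi>)) \<in> borel_measurable lborel"
    by measurable
  have "D_cont (real j) s y = of_real (1 / fact j) * (\<integral>\<xi>. indicator {\<xi>. (norm \<xi>)\<^sup>2 < s} \<xi> *\<^sub>R (of_real ((s - (norm \<xi>)\<^sup>2) ^ j) * wave y \<xi>) \<partial>lborel)"
    unfolding D_cont_def Gamma_real_Suc set_lebesgue_integral_def eq integral_completion[OF meas] ..
  also have "\<dots> = (\<integral>\<xi>. of_real (1 / fact j) * (indicator {\<xi>. (norm \<xi>)\<^sup>2 < s} \<xi> *\<^sub>R (of_real ((s - (norm \<xi>)\<^sup>2) ^ j) * wave y \<xi>)) \<partial>lborel)"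
    by (rule integral_mult_right_zero[symmetric])
  also have "\<dots> = (\<integral>\<xi>. indicator {\<xi>. (norm \<xi>)\<^sup>2 < s} \<xi> *\<^sub>R (of_real ((s - (norm \<xi>)\<^sup>2) ^ j / fact j) * wave y \<xi>) \<partial>lborel)"
    by (intro Bochner_Integration.integral_cong refl) (simp add: indicator_def)
  finally show ?thesis .
qed

text \<open>The parameter s occurs in the domain and in the integrand; a case distinction merges
  both into one jointly measurable function.\<close>

lemma D_cont_measurable [measurable]: "(\<lambda>s. D_cont (real j) s y) \<in> borel_measurable borel"
proof -
  have "(\<lambda>s. \<integral>\<xi>. (if (norm \<xi>)\<^sup>2 < s then of_real ((s - (norm \<xi>)\<^sup>2) ^ j / fact j) * wave y \<xi> else 0) \<partial>lborel) \<in> borel_measurable borel"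
    unfolding wave_def by (rule lborel.borel_measurable_lebesgue_integral) measurable
  also have "(\<lambda>s. \<integral>\<xi>. (if (norm \<xi>)\<^sup>2 < s then of_real ((s - (norm \<xi>)\<^sup>2) ^ j / fact j) * wave y \<xi> else 0) \<partial>lborel)
    = (\<lambda>s. D_cont (real j) s y)"
    unfolding D_cont_nat by (intro ext Bochner_Integration.integral_cong refl) (simp add: indicator_def)
  finally show ?thesis .
qed

text \<open>Fubini's theorem and Taylor's formula turn the remainder integral into a Fourier transform.\<close>

lemma D_cont_remainder_integral:
  fixes y :: "real ^ 'n"
  assumes B: "\<And>j u. (B j has_vector_derivative B (Suc j) u) (at u)" and J: "J > 0" and S: "S > 0"
  shows "(\<integral>s. indicator {0..S} s *\<^sub>R (D_cont (real J) s y * B (Suc J) s) \<partial>lborel)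
    = (- 1) ^ Suc J * (\<integral>\<xi>. (if (norm \<xi>)\<^sup>2 < S then taylor_remainder B J S 0 ((norm \<xi>)\<^sup>2) else 0) * wave y \<xi> \<partial>lborel)"
proof -
  have B_cont: "continuous_on A (B j)" for A j
    by (intro continuous_at_imp_continuous_on ballI has_vector_derivative_continuous[OF B])
  have [measurable]: "B j \<in> borel_measurable borel" for j
    by (rule borel_measurable_continuous_onI[OF B_cont])
  \<comment> \<open>The integrand on the product of [0, S] with the space, cut to |\<xi>|^2 < s. It
    is bounded with bounded support, hence integrable, and Fubini's theorem applies.\<close>
  define h where "h s \<xi> = (indicator {0..S} s * indicator {\<xi>. (norm \<xi>)\<^sup>2 < s} \<xi> * ((s - (norm \<xi>)\<^sup>2) ^ J / fact J)) *\<^sub>R (B (Suc J) s * wave y \<xi>)" for s \<xi>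
  have h_alt: "h s \<xi> = (if 0 \<le> s \<and> s \<le> S \<and> (norm \<xi>)\<^sup>2 < s then ((s - (norm \<xi>)\<^sup>2) ^ J / fact J) *\<^sub>R (B (Suc J) s * wave y \<xi>) else 0)" for s \<xi>
    by (simp add: h_def indicator_def)
  have h_meas: "case_prod h \<in> borel_measurable (lborel \<Otimes>\<^sub>M lborel)"
    unfolding h_alt[abs_def] wave_def by measurable
  have "bounded (B (Suc J) ` {0..S})"
    by (intro compact_imp_bounded compact_continuous_image B_cont compact_Icc)
  then obtain M where "\<forall>z\<in>B (Suc J) ` {0..S}. norm z \<le> M" unfolding bounded_iff by blast
  then have M: "norm (B (Suc J) s) \<le> M" if "0 \<le> s" "s \<le> S" for s using that by simp
  have h_bound: "norm (h s \<xi>) \<le> S ^ J / fact J * M" for s \<xi>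
  proof (cases "0 \<le> s \<and> s \<le> S \<and> (norm \<xi>)\<^sup>2 < s")
    case True
    then have "(s - (norm \<xi>)\<^sup>2) ^ J / fact J \<le> S ^ J / fact J"
      by (intro divide_right_mono power_mono) (auto intro: order_trans[OF _ True[THEN conjunct2, THEN conjunct1]])
    then have "(s - (norm \<xi>)\<^sup>2) ^ J / fact J * norm (B (Suc J) s) \<le> S ^ J / fact J * M"
      using True M[of s] S by (intro mult_mono) auto
    then show ?thesis using True by (simp add: h_alt norm_mult)
  next
    case False
    have "M \<ge> 0" by (rule order_trans[OF norm_ge_zero M[of 0]]) (use S in auto)
    moreover have "h s \<xi> = 0" using False by (simp only: h_alt if_False)
    ultimately show ?thesis using S by simp
  qed
  have h_supp: "h s \<xi> = 0" if "norm (s, \<xi>) > S + sqrt S" for s \<xi>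
  proof (rule ccontr)
    assume "h s \<xi> \<noteq> 0"
    then have *: "0 \<le> s" "s \<le> S" "(norm \<xi>)\<^sup>2 < s" by (auto simp: h_alt split: if_splits)
    then have "(norm \<xi>)\<^sup>2 \<le> S" by simp
    then have "norm \<xi> \<le> sqrt S" by (rule real_le_rsqrt)
    moreover have "norm (s, \<xi>) \<le> \<bar>s\<bar> + norm \<xi>" using norm_Pair_le[of s \<xi>] by simp
    ultimately show False using that * by simp
  qed
  have h_int: "integrable (lborel \<Otimes>\<^sub>M lborel) (case_prod h)"
    unfolding lborel_prod
    by (rule integrable_bounded_support[of _ "S ^ J / fact J * M" "S + sqrt S"])
       (use h_meas h_bound h_supp in \<open>auto simp: lborel_prod split: prod.splits\<close>)
  have "(\<integral>s. indicator {0..S} s *\<^sub>R (D_cont (real J) s y * B (Suc J) s) \<partial>lborel) = (\<integral>s. (\<integral>\<xi>. h s \<xi> \<partial>lborel) \<partial>lborel)"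
  proof (intro Bochner_Integration.integral_cong refl)
    fix s
    have "(\<integral>\<xi>. h s \<xi> \<partial>lborel) = (\<integral>\<xi>. (of_real (indicator {0..S} s) * B (Suc J) s) * (indicator {\<xi>. (norm \<xi>)\<^sup>2 < s} \<xi> *\<^sub>R (of_real ((s - (norm \<xi>)\<^sup>2) ^ J / fact J) * wave y \<xi>)) \<partial>lborel)"
      by (intro Bochner_Integration.integral_cong refl) (simp add: h_def scaleR_conv_of_real mult_ac)
    also have "\<dots> = (of_real (indicator {0..S} s) * B (Suc J) s) * D_cont (real J) s y"
      unfolding D_cont_nat by (rule integral_mult_right_zero)
    finally show "indicator {0..S} s *\<^sub>R (D_cont (real J) s y * B (Suc J) s) = (\<integral>\<xi>. h s \<xi> \<partial>lborel)"
      by (simp add: scaleR_conv_of_real mult_ac)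
  qed
  also have "\<dots> = (\<integral>\<xi>. (\<integral>s. h s \<xi> \<partial>lborel) \<partial>lborel)"
    by (rule lborel_pair.Fubini_integral[OF h_int, symmetric])
  also have "\<dots> = (\<integral>\<xi>. (- 1) ^ Suc J * ((if (norm \<xi>)\<^sup>2 < S then taylor_remainder B J S 0 ((norm \<xi>)\<^sup>2) else 0) * wave y \<xi>) \<partial>lborel)"
  proof (intro Bochner_Integration.integral_cong refl)
    fix \<xi> :: "real ^ 'n"
    let ?u = "(norm \<xi>)\<^sup>2"
    show "(\<integral>s. h s \<xi> \<partial>lborel) = (- 1) ^ Suc J * ((if ?u < S then taylor_remainder B J S 0 ?u else 0) * wave y \<xi>)"
    proof (cases "?u < S")
      case True
      have "(\<integral>s. h s \<xi> \<partial>lborel) = (\<integral>s. wave y \<xi> * (indicator {?u..S} s *\<^sub>R (((s - ?u) ^ J / fact J) *\<^sub>R B (Suc J) s)) \<partial>lborel)"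
      proof (intro Bochner_Integration.integral_cong refl)
        fix s
        \<comment> \<open>The strict and the weak inequality differ at s = |\<xi>|^2, where the
          power vanishes because J > 0; the integrands agree everywhere.\<close>
        have "s = ?u \<Longrightarrow> (s - ?u) ^ J = 0" using J by simp
        then show "h s \<xi> = wave y \<xi> * (indicator {?u..S} s *\<^sub>R (((s - ?u) ^ J / fact J) *\<^sub>R B (Suc J) s))"
          using order_trans[of 0 ?u s] by (auto simp: h_alt indicator_def mult.commute not_less)
      qed
      also have "\<dots> = wave y \<xi> * ((- 1) ^ Suc J * taylor_remainder B J S 0 ?u)"
        unfolding integral_mult_right_zero using taylor_remainder_integral[where B=B, OF B, of ?u S J] True by simp
      finally show ?thesis using True by (simp add: mult_ac)
    next
      case False
      then have "h s \<xi> = 0" for s by (simp add: h_alt)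
      then show ?thesis using False by simp
    qed
  qed
  also have "\<dots> = (- 1) ^ Suc J * (\<integral>\<xi>. (if (norm \<xi>)\<^sup>2 < S then taylor_remainder B J S 0 ((norm \<xi>)\<^sup>2) else 0) * wave y \<xi> \<partial>lborel)"
    by (rule integral_mult_right_zero)
  finally show ?thesis .
qed

section \<open>The summation formula\<close>

lemma AE_lborel_translate:
  fixes a :: "'a::euclidean_space"
  assumes "AE x in lborel. Q x"
  shows "AE x in lborel. Q (x + a)"
proof -
  obtain N where N: "N \<in> null_sets lborel" "{x. \<not> Q x} \<subseteq> N"
    using assms by (auto simp: eventually_ae_filter)
  have "{x. x - (- a) \<in> N} \<in> null_sets lborel" by (rule null_sets_translation[OF N(1)])
  then show ?thesis by (rule AE_I') (use N(2) in auto)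
qed

text \<open>On the cell the periodization has finitely many possibly nonzero terms, so an almost
  everywhere equality of \<open>F\<close> and \<open>G\<close> survives the translations involved,
  and \<open>G\<close> may be unfolded instead.\<close>

lemma fourier_coeff_periodization:
  fixes F G :: "real ^ 'n \<Rightarrow> complex"
  assumes G: "integrable lborel G" and FG: "AE x in lborel. F x = G x"
    and suppF: "\<And>x. norm x > r \<Longrightarrow> F x = 0" and suppG: "\<And>x. norm x > r \<Longrightarrow> G x = 0"
    and m: "m \<in> int_lattice"
  shows "fourier_coeff (periodization F) m = (\<integral>x. G x * wave (- m) x \<partial>lborel)"
proof -
  let ?N = "lattice_ball (r + real CARD('n)) :: (real ^ 'n) set"
  have [measurable]: "G \<in> borel_measurable borel" using G by auto
  have w: "cis (- 2 * pi * (m \<bullet> x)) = wave (- m) x" for x by (simp add: wave_def)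
  have per: "periodization F x = (\<Sum>n\<in>?N. F (x + n))" if x: "x \<in> torus" for x
  proof -
    have "F (x + n) = 0" if "n \<in> int_lattice - ?N" for n
    proof -
      have "norm n \<le> norm (x + n) + norm x" using norm_triangle_ineq4[of "x + n" x] by simp
      then have "norm (x + n) > r" using that norm_torus_le[OF x] by (auto simp: lattice_ball_def)
      then show ?thesis by (rule suppF)
    qed
    then have "infsum (\<lambda>n. F (x + n)) int_lattice = infsum (\<lambda>n. F (x + n)) ?N"
      by (intro infsum_cong_neutral) (auto simp: lattice_ball_def)
    then show ?thesis by (simp add: periodization_def)
  qed
  have "AE x in lborel. \<forall>n\<in>?N. F (x + n) = G (x + n)"
    using FG by (intro AE_finite_allI finite_lattice_ball) (rule AE_lborel_translate)
  then have ae: "AE x in lborel. indicator torus x *\<^sub>R (periodization F x * wave (- m) x)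
     = indicator torus x *\<^sub>R ((\<Sum>n\<in>?N. G (x + n)) * wave (- m) x)"
    by eventually_elim (auto simp: per indicator_def)
  have "fourier_coeff (periodization F) m = (\<integral>x. indicator torus x *\<^sub>R ((\<Sum>n\<in>?N. G (x + n)) * wave (- m) x) \<partial>lborel)"
    unfolding fourier_coeff_def set_lebesgue_integral_def w
    by (rule integral_lebesgue_AE[OF _ ae]) measurable
  then show ?thesis using lattice_sum_integral[OF G suppG m] by simp
qed

theorem theorem2p1:
  fixes \<phi> :: "real \<Rightarrow> complex" and l :: real and x :: "real ^ 'n"
  assumes "compact_support_halfline \<phi>"
    and "integrable lebesgue (radial \<phi> :: real ^ 'n \<Rightarrow> complex)"
    and "l > 0"
    and "x \<in> torus"
  defines "d \<equiv> CARD('n)"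
  defines "A \<equiv> \<lambda>j. nth_deriv_halfline j (radial_profile d \<phi>)"
  defines "R \<equiv> \<lambda>m :: real ^ 'n. LINT s:{0..l\<^sup>2}|lebesgue.
             D_cont (real (d_sharp d)) s (x - m) * A (d_sharp d + 1) s"
  shows "R summable_on (int_lattice - {0}) \<and>
         fourier_partial_sum l (periodization (radial \<phi>)) x =
           fourier_partial_integral l (radial \<phi>) x
           + (\<Sum>j = 0..d_sharp d. (- 1) ^ j * D_diff (real j) (l\<^sup>2) x * A j (l\<^sup>2))
           + (- 1) ^ (d_sharp d + 1) * (\<Sum>\<^sub>\<infinity>m\<in>int_lattice - {0}. R m)"
proof -
  let ?F = "radial \<phi> :: real ^ 'n \<Rightarrow> complex"
  define S where "S = l\<^sup>2"
  define J where "J = d_sharp d"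
  have S: "S > 0" using \<open>l > 0\<close> by (simp add: S_def)
  \<comment> \<open>\<open>d_sharp d\<close> exceeds (d - 1)/2, hence 2J \<ge> d and 2(J + 1) \<ge>
    d + 2.\<close>
  have J: "J > 0" "2 * Suc J > CARD('n)" by (auto simp: J_def d_sharp_def d_def)

  have "bounded {t. 0 \<le> t \<and> \<phi> t \<noteq> 0}"
    using assms(1) unfolding compact_support_halfline_def by (meson bounded_closure_image bounded_subset closure_subset compact_imp_bounded)
  then obtain r0 where r0: "\<forall>t\<in>{t. 0 \<le> t \<and> \<phi> t \<noteq> 0}. norm t \<le> r0" unfolding bounded_iff by blast
  \<comment> \<open>The maximum with 1 keeps the radius positive.\<close>
  define \<rho> where "\<rho> = max r0 1"
  have \<rho>: "\<rho> > 0" by (simp add: \<rho>_def)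
  have supp_phi: "\<phi> t = 0" if "t > \<rho>" for t
  proof (rule ccontr)
    assume "\<phi> t \<noteq> 0"
    moreover have "t > 0" using that \<rho> by simp
    ultimately have "norm t \<le> r0" using r0 by simp
    then show False using that \<open>t > 0\<close> by (simp add: \<rho>_def)
  qed
  have "(\<lambda>x::real ^ 'n. \<phi> (norm x)) \<in> borel_measurable lebesgue"
    using borel_measurable_integrable[OF assms(2)] by (simp add: radial_def[abs_def])
  from radial_borel_version[OF this supp_phi]
  obtain \<psi> where psi: "\<psi> \<in> borel_measurable borel" "\<And>t. t < 0 \<or> t > \<rho> \<Longrightarrow> \<psi> t = 0"
    and phi_psi: "AE t in lborel. t \<ge> 0 \<longrightarrow> \<phi> t = \<psi> t"
    and F_psi: "AE x in (lborel :: (real ^ 'n) measure). \<phi> (norm x) = \<psi> (norm x)" by blast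
  note [measurable] = psi(1)
  have F_psi': "AE x in lborel. ?F x = \<psi> (norm x)" using F_psi by (simp add: radial_def)
  have psi_int: "integrable lborel (\<lambda>x::real ^ 'n. \<psi> (norm x))"
    using assms(2) integrable_lebesgue_AE[OF _ F_psi'] by simp
  interpret radial_function \<psi> \<rho> d "TYPE(real ^ 'n)"
    by unfold_locales (use psi psi_int \<rho> in \<open>auto simp: d_def\<close>)

  \<comment> \<open>\<open>A\<close> consists of one-sided derivatives on the half-line;
    \<open>B\<close> is its entire counterpart, differentiable at every real point as Taylor's
    formula and \<open>truncated_radial\<close> require.\<close>
  define B where "B = entire_deriv (profile_coeff d \<psi>)"
  have B: "(B j has_vector_derivative B (Suc j) u) (at u)" for j u
    unfolding B_def by (rule entire_deriv_has_vector_derivative[OF summable_profile])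
  have B_cont: "continuous_on T (B j)" for T j
    by (intro continuous_at_imp_continuous_on ballI has_vector_derivative_continuous[OF B])
  have B_meas [measurable]: "B j \<in> borel_measurable borel" for j
    by (rule borel_measurable_continuous_onI[OF B_cont])
  have A: "A j s = B j s" if "s \<ge> 0" for j s
    unfolding A_def B_def
  proof (rule nth_deriv_halfline_entire[OF summable_profile _ that])
    fix s :: real assume "s \<ge> 0"
    from radial_profile_sums[OF this phi_psi] show "radial_profile d \<phi> s = entire_deriv (profile_coeff d \<psi>) 0 s"
      by (simp add: entire_deriv_def sums_iff)
  qed
  have ft_psi: "(\<integral>x. \<psi> (norm x) * wave (- \<xi>) x \<partial>lborel) = B 0 ((norm \<xi>)\<^sup>2)" for \<xi> :: "real ^ 'n"
    using fourier_radial[of \<xi>] by (simp add: B_def entire_deriv_def sums_iff wave_def)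
  have ft: "fourier_transform ?F \<xi> = B 0 ((norm \<xi>)\<^sup>2)" for \<xi> :: "real ^ 'n"
  proof -
    have "AE x in lborel. ?F x * cis (- 2 * pi * (\<xi> \<bullet> x)) = \<psi> (norm x) * wave (- \<xi>) x"
      using F_psi' by eventually_elim (simp add: wave_def)
    then show ?thesis
      unfolding fourier_transform_def ft_psi[symmetric] by (intro integral_lebesgue_AE) measurable
  qed
  have fc: "fourier_coeff (periodization ?F) m = B 0 ((norm m)\<^sup>2)" if "m \<in> int_lattice" for m
    unfolding ft_psi[symmetric]
    by (rule fourier_coeff_periodization[OF psi_int F_psi' _ _ that, of \<rho>]) (simp_all add: radial_def supp_phi psi(2))

  let ?P = "taylor_remainder B J S"
  \<comment> \<open>The remainder and its derivatives up to order J vanish at \<open>S\<close>,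
    whence the order \<open>Suc J\<close>.\<close>
  interpret truncated_radial ?P S "Suc J"
    by unfold_locales (auto simp: S taylor_remainder_deriv[where B=B, OF B] taylor_remainder_at)
  define K where "K \<xi> = (if (norm \<xi>)\<^sup>2 < S then ?P 0 ((norm \<xi>)\<^sup>2) else 0)" for \<xi> :: "real ^ 'n"
  define \<kappa> where "\<kappa> m = (\<integral>\<xi>. K \<xi> * wave (x - m) \<xi> \<partial>lborel)" for m
  \<comment> \<open>The sign is the one that stands in front of the series in the theorem, so the
    two cancel.\<close>
  have R: "R m = (- 1) ^ Suc J * \<kappa> m" for m
  proof -
    have meas: "(\<lambda>s. indicator {0..S} s *\<^sub>R (D_cont (real J) s (x - m) * B (Suc J) s)) \<in> borel_measurable lborel"
      by measurable
    have "R m = (\<integral>s. indicator {0..S} s *\<^sub>R (D_cont (real J) s (x - m) * B (Suc J) s) \<partial>lebesgue)"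
      unfolding R_def set_lebesgue_integral_def J_def[symmetric] S_def[symmetric]
      by (intro Bochner_Integration.integral_cong refl) (simp add: indicator_def A)
    also have "\<dots> = (\<integral>s. indicator {0..S} s *\<^sub>R (D_cont (real J) s (x - m) * B (Suc J) s) \<partial>lborel)"
      by (rule integral_completion[OF meas])
    also have "\<dots> = (- 1) ^ Suc J * \<kappa> m"
      unfolding \<kappa>_def K_def by (rule D_cont_remainder_integral[where B=B, OF B J(1) S])
    finally show ?thesis .
  qed
  have \<kappa>_sm: "(\<lambda>m. norm (\<kappa> m)) summable_on int_lattice"
    unfolding \<kappa>_def K_def by (rule trunc_transform_abs_summable[OF \<open>x \<in> torus\<close> J(2)])
  then have \<kappa>_sm': "\<kappa> summable_on int_lattice" by (rule abs_summable_summable)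
  have \<kappa>_sm0: "\<kappa> summable_on (int_lattice - {0})"
    by (rule summable_on_subset_banach[OF \<kappa>_sm']) auto

  have norm_l: "norm m < l \<longleftrightarrow> (norm m)\<^sup>2 < S" for m :: "real ^ 'n"
  proof -
    have "sqrt S = l" using \<open>l > 0\<close> by (simp add: S_def)
    then show ?thesis by (simp only: norm_sqr_less_iff)
  qed

  have poisson: "(\<Sum>\<^sub>\<infinity>m\<in>int_lattice. \<kappa> m) = (\<Sum>m\<in>{m \<in> int_lattice. (norm m)\<^sup>2 < S}. ?P 0 ((norm m)\<^sup>2) * wave x m)"
  proof -
    \<comment> \<open>The remainder is 0 at \<open>S\<close>, so the truncation is a composition
      with \<open>min\<close>, which shows continuity across the sphere.\<close>
    have K_alt: "K \<xi> = ?P 0 (min ((norm \<xi>)\<^sup>2) S)" for \<xi>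
      by (simp add: K_def min_def taylor_remainder_at)
    have \<kappa>_alt: "\<kappa> m = (\<integral>\<xi>. (K \<xi> * wave x \<xi>) * wave (- m) \<xi> \<partial>lborel)" for m
      unfolding \<kappa>_def using wave_add(1)[of x "- m"] by (simp add: mult.assoc)
    have "(\<Sum>\<^sub>\<infinity>m\<in>int_lattice. \<kappa> m) = (\<Sum>n\<in>lattice_ball (sqrt S + real CARD('n)). K n * wave x n)"
      unfolding \<kappa>_alt
    proof (rule poisson_summation)
      show "continuous_on UNIV (\<lambda>\<xi>. K \<xi> * wave x \<xi>)"
        unfolding K_alt by (intro continuous_intros continuous_on_compose2[OF P_cont[of 0]]) auto
      show "K \<xi> * wave x \<xi> = 0" if "norm \<xi> > sqrt S" for \<xi>
        using that by (simp add: K_def norm_sqr_less_iff)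
      show "(\<lambda>m. norm (\<integral>\<xi>. K \<xi> * wave x \<xi> * wave (- m) \<xi> \<partial>lborel)) summable_on int_lattice"
        using \<kappa>_sm by (simp add: \<kappa>_alt)
    qed
    also have "\<dots> = (\<Sum>m\<in>{m \<in> int_lattice. (norm m)\<^sup>2 < S}. ?P 0 ((norm m)\<^sup>2) * wave x m)"
      by (intro sum.mono_neutral_cong_right finite_lattice_ball) (auto simp: K_def lattice_ball_def norm_sqr_less_iff)
    finally show ?thesis .
  qed

  have P0: "?P 0 u = B 0 u - (\<Sum>j=0..J. (- 1) ^ j * (of_real ((S - u) ^ j / fact j) * A j S))" for u
  proof -
    have "(u - S) ^ j = (- 1) ^ j * (S - u) ^ j" for j
      by (simp add: power_mult_distrib[symmetric])
    then show ?thesis using S by (simp add: taylor_remainder_def A mult.assoc)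
  qed
  \<comment> \<open>The free factor \<open>w\<close> lets one identity serve both the lattice sum
    and the integral.\<close>
  have BP: "B 0 u * w = ?P 0 u * w + (\<Sum>j=0..J. (- 1) ^ j * (of_real ((S - u) ^ j / fact j) * w) * A j S)" for u w
  proof -
    have "(\<Sum>j=0..J. (- 1) ^ j * (of_real ((S - u) ^ j / fact j) * w) * A j S)
        = (\<Sum>j=0..J. (- 1) ^ j * (of_real ((S - u) ^ j / fact j) * A j S)) * w"
      unfolding sum_distrib_right by (intro sum.cong refl) (simp only: mult_ac)
    then show ?thesis unfolding P0 by (simp only: left_diff_distrib diff_add_cancel)
  qed
  have FPS: "fourier_partial_sum l (periodization ?F) x
      = (\<Sum>\<^sub>\<infinity>m\<in>int_lattice. \<kappa> m) + (\<Sum>j=0..J. (- 1) ^ j * D_lattice (real j) S x * A j S)"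
  proof -
    let ?M = "{m \<in> (int_lattice :: (real ^ 'n) set). (norm m)\<^sup>2 < S}"
    have "fourier_partial_sum l (periodization ?F) x = (\<Sum>m\<in>?M. B 0 ((norm m)\<^sup>2) * wave x m)"
      unfolding fourier_partial_sum_def norm_l
      by (intro sum.cong) (auto simp: fc wave_def inner_commute)
    also have "\<dots> = (\<Sum>m\<in>?M. ?P 0 ((norm m)\<^sup>2) * wave x m)
        + (\<Sum>m\<in>?M. \<Sum>j=0..J. (- 1) ^ j * (of_real ((S - (norm m)\<^sup>2) ^ j / fact j) * wave x m) * A j S)"
      unfolding sum.distrib[symmetric] by (intro sum.cong refl BP)
    also have "(\<Sum>m\<in>?M. \<Sum>j=0..J. (- 1) ^ j * (of_real ((S - (norm m)\<^sup>2) ^ j / fact j) * wave x m) * A j S)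
        = (\<Sum>j=0..J. (- 1) ^ j * D_lattice (real j) S x * A j S)"
      unfolding D_lattice_nat sum_distrib_left sum_distrib_right by (rule sum.swap)
    finally show ?thesis unfolding poisson .
  qed
  \<comment> \<open>The remainder contributes its transform at x itself, which is the term m = 0 of
    the lattice series and cancels there.\<close>
  have FPI: "fourier_partial_integral l ?F x = \<kappa> 0 + (\<Sum>j=0..J. (- 1) ^ j * D_cont (real j) S x * A j S)"
  proof -
    let ?I = "\<lambda>\<xi>. indicator {\<xi>. (norm \<xi>)\<^sup>2 < S} (\<xi> :: real ^ 'n) :: real"
    have int: "integrable lborel (\<lambda>\<xi>. ?I \<xi> *\<^sub>R (f \<xi> * wave x \<xi>))" if f: "continuous_on UNIV f" for f :: "real ^ 'n \<Rightarrow> complex"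
    proof -
      have [measurable]: "f \<in> borel_measurable borel" by (rule borel_measurable_continuous_onI[OF f])
      have "bounded (f ` cball 0 (sqrt S))"
        by (intro compact_imp_bounded compact_continuous_image continuous_on_subset[OF f]) auto
      then obtain M where M: "\<forall>y\<in>f ` cball 0 (sqrt S). norm y \<le> M" unfolding bounded_iff by blast
      show ?thesis
        by (rule integrable_bounded_support[of _ "max M 0" "sqrt S"])
           (use M in \<open>auto simp: indicator_def norm_mult norm_sqr_less_iff le_max_iff_disj\<close>)
    qed
    have int_j: "integrable lborel (\<lambda>\<xi>. ?I \<xi> *\<^sub>R (of_real ((S - (norm \<xi>)\<^sup>2) ^ j / fact j) * wave x \<xi>))" for j
      by (rule int) (intro continuous_intros, auto)
    have int_P: "integrable lborel (\<lambda>\<xi>. K \<xi> * wave x \<xi>)"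
    proof -
      have "integrable lborel (\<lambda>\<xi>. ?I \<xi> *\<^sub>R (?P 0 ((norm \<xi>)\<^sup>2) * wave x \<xi>))"
        by (rule int) (intro continuous_intros continuous_on_compose2[OF P_cont[of 0]], auto)
      also have "(\<lambda>\<xi>. ?I \<xi> *\<^sub>R (?P 0 ((norm \<xi>)\<^sup>2) * wave x \<xi>)) = (\<lambda>\<xi>. K \<xi> * wave x \<xi>)"
        by (auto simp: K_def indicator_def)
      finally show ?thesis .
    qed
    have meas: "(\<lambda>\<xi>. ?I \<xi> *\<^sub>R (B 0 ((norm \<xi>)\<^sup>2) * wave x \<xi>)) \<in> borel_measurable lborel" by measurable
    have "fourier_partial_integral l ?F x = (\<integral>\<xi>. ?I \<xi> *\<^sub>R (B 0 ((norm \<xi>)\<^sup>2) * wave x \<xi>) \<partial>lebesgue)"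
      unfolding fourier_partial_integral_def set_lebesgue_integral_def norm_l ft
      by (intro Bochner_Integration.integral_cong refl) (simp add: wave_def inner_commute)
    also have "\<dots> = (\<integral>\<xi>. ?I \<xi> *\<^sub>R (B 0 ((norm \<xi>)\<^sup>2) * wave x \<xi>) \<partial>lborel)"
      by (rule integral_completion[OF meas])
    also have "\<dots> = (\<integral>\<xi>. K \<xi> * wave x \<xi> + (\<Sum>j=0..J. ((- 1) ^ j * A j S) * (?I \<xi> *\<^sub>R (of_real ((S - (norm \<xi>)\<^sup>2) ^ j / fact j) * wave x \<xi>))) \<partial>lborel)"
    proof (intro Bochner_Integration.integral_cong refl)
      fix \<xi> :: "real ^ 'n"
      show "?I \<xi> *\<^sub>R (B 0 ((norm \<xi>)\<^sup>2) * wave x \<xi>)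
        = K \<xi> * wave x \<xi> + (\<Sum>j=0..J. ((- 1) ^ j * A j S) * (?I \<xi> *\<^sub>R (of_real ((S - (norm \<xi>)\<^sup>2) ^ j / fact j) * wave x \<xi>)))"
      proof (cases "(norm \<xi>)\<^sup>2 < S")
        case True
        then show ?thesis using BP[of "(norm \<xi>)\<^sup>2" "wave x \<xi>"] by (simp add: K_def mult_ac)
      qed (simp add: K_def)
    qed
    also have "\<dots> = (\<integral>\<xi>. K \<xi> * wave x \<xi> \<partial>lborel) + (\<Sum>j=0..J. ((- 1) ^ j * A j S) * D_cont (real j) S x)"
      unfolding D_cont_nat
      by (subst Bochner_Integration.integral_add[OF int_P], intro Bochner_Integration.integrable_sum integrable_mult_right int_j,
          subst Bochner_Integration.integral_sum, intro integrable_mult_right int_j) (simp only: integral_mult_right_zero)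
    finally show ?thesis by (simp add: \<kappa>_def mult_ac)
  qed
  have split: "(\<Sum>\<^sub>\<infinity>m\<in>int_lattice. \<kappa> m) = \<kappa> 0 + (\<Sum>\<^sub>\<infinity>m\<in>int_lattice - {0}. \<kappa> m)"
  proof -
    have "(\<Sum>\<^sub>\<infinity>m\<in>{0} \<union> (int_lattice - {0}). \<kappa> m) = (\<Sum>\<^sub>\<infinity>m\<in>{0}. \<kappa> m) + (\<Sum>\<^sub>\<infinity>m\<in>int_lattice - {0}. \<kappa> m)"
      by (rule infsum_Un_disjoint) (use \<kappa>_sm0 in auto)
    moreover have "{0} \<union> (int_lattice - {0}) = (int_lattice :: (real ^ 'n) set)" using int_lattice_0 by auto
    ultimately show ?thesis by simp
  qed
  have R_sum: "(- 1) ^ Suc J * (\<Sum>\<^sub>\<infinity>m\<in>int_lattice - {0}. R m) = (\<Sum>\<^sub>\<infinity>m\<in>int_lattice - {0}. \<kappa> m)"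
    unfolding R by (subst infsum_cmult_right) (use \<kappa>_sm0 in \<open>auto simp flip: power_mult_distrib mult.assoc\<close>)
  have "R summable_on (int_lattice - {0})"
    unfolding R by (intro summable_on_cmult_right \<kappa>_sm0)
  moreover have "fourier_partial_sum l (periodization ?F) x = fourier_partial_integral l ?F x
      + (\<Sum>j=0..J. (- 1) ^ j * D_diff (real j) S x * A j S) + (- 1) ^ Suc J * (\<Sum>\<^sub>\<infinity>m\<in>int_lattice - {0}. R m)"
    unfolding R_sum FPS FPI split D_diff_def by (simp add: algebra_simps sum_subtractf)
  ultimately show ?thesis by (simp add: J_def S_def)
qed

end
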